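(* Let $q=1$, $u\in\mathcal{M}$ with $u\ge0$, and for $t\in\mathbb{R}$ let $E_t=\{x:u(x)>t\}$. (a) For almost every $t>0$, $\chi_{E_t}\in\mathcal{M}$. (b) For all nonnegative $c_1,\dots,c_n$ and almost all $t_1<\dots<t_n$, $\sum_{j=1}^n c_j\chi_{E_{t_j}}\in\mathcal{M}$.
   Context: $BV=BV(\mathbb{R}^d)$ is the space of real $u\in L^1_{\rm loc}(\mathbb{R}^d)$ with $\|u\|_{\dot{BV}}=\sup\{\int u\,{\rm div}\varphi\,dx:\varphi\in C^1_c(\mathbb{R}^d;\mathbb{R}^d),\ \sup|\varphi|\le 1\}<\infty$. Standing assumptions: $K$ is a positive, even, bounded, real analytic function on $\mathbb{R}^d$ with $\int K\,dx=1$, such that $u\mapsto K*u$ is injective on $L^p$; $\lambda>0$, $1\le p<\infty$. $\mathcal{M}_{p,1,\lambda}(f)$ is the set of minimizers $u\in BV$ of $\|u\|_{\dot{BV}}+\lambda\|K*(f-u)\|_{L^p}$, and $\mathcal{M}=\bigcup_f\mathcal{M}_{p,1,\lambda}(f)$, the union over all real $f$. *)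

theory Defs
  imports "HOL-Analysis.Analysis"
begin

definition loc_integrable :: "('a::euclidean_space \<Rightarrow> real) \<Rightarrow> bool" where
  "loc_integrable u \<longleftrightarrow> u \<in> borel_measurable lborel \<and>
     (\<forall>C. compact C \<longrightarrow> set_integrable lborel C u)"

definition test_fields :: "('a::euclidean_space \<Rightarrow> 'a) set" where
  "test_fields = {\<phi>. (\<forall>x. \<phi> differentiable (at x)) \<and>
      (\<forall>b\<in>Basis. continuous_on UNIV (\<lambda>x. frechet_derivative \<phi> (at x) b)) \<and>
      compact (closure {x. \<phi> x \<noteq> 0}) \<and> (\<forall>x. norm (\<phi> x) \<le> 1)}"

definition divergence :: "('a::euclidean_space \<Rightarrow> 'a) \<Rightarrow> 'a \<Rightarrow> real" where
  "divergence \<phi> x = (\<Sum>b\<in>Basis. frechet_derivative \<phi> (at x) b \<bullet> b)"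

definition bv_seminorm :: "('a::euclidean_space \<Rightarrow> real) \<Rightarrow> ereal" where
  "bv_seminorm u = (SUP \<phi>\<in>test_fields. ereal (LINT x|lborel. u x * divergence \<phi> x))"

definition BV :: "('a::euclidean_space \<Rightarrow> real) set" where
  "BV = {u. loc_integrable u \<and> bv_seminorm u < \<infinity>}"

definition conv :: "('a::euclidean_space \<Rightarrow> real) \<Rightarrow> ('a \<Rightarrow> real) \<Rightarrow> 'a \<Rightarrow> real" where
  "conv K g = (\<lambda>x. LINT y|lborel. K (x - y) * g y)"

definition in_Lp :: "real \<Rightarrow> ('a::euclidean_space \<Rightarrow> real) \<Rightarrow> bool" where
  "in_Lp p h \<longleftrightarrow> h \<in> borel_measurable lborel \<and> integrable lborel (\<lambda>x. \<bar>h x\<bar> powr p)"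

definition lp_norm :: "real \<Rightarrow> ('a::euclidean_space \<Rightarrow> real) \<Rightarrow> ereal" where
  "lp_norm p h = (if in_Lp p h then ereal ((LINT x|lborel. \<bar>h x\<bar> powr p) powr (1 / p)) else \<infinity>)"

text \<open>Real analyticity on R^d: locally the sum of an (absolutely, i.e. unconditionally)
  convergent multivariate power series indexed by multi-indices on the Basis.\<close>
definition real_analytic :: "('a::euclidean_space \<Rightarrow> real) \<Rightarrow> bool" where
  "real_analytic K \<longleftrightarrow> (\<forall>x0. \<exists>r>0. \<exists>c :: ('a \<Rightarrow> nat) \<Rightarrow> real.
      \<forall>x\<in>ball x0 r.
        ((\<lambda>\<alpha>. c \<alpha> * (\<Prod>b\<in>Basis. ((x - x0) \<bullet> b) ^ \<alpha> b)) has_sum K x)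
          {\<alpha>. \<forall>i. i \<notin> Basis \<longrightarrow> \<alpha> i = 0})"

definition admissible_kernel :: "real \<Rightarrow> ('a::euclidean_space \<Rightarrow> real) \<Rightarrow> bool" where
  "admissible_kernel p K \<longleftrightarrow>
     (\<forall>x. K x > 0) \<and> (\<forall>x. K (- x) = K x) \<and> bounded (range K) \<and> real_analytic K \<and>
     integrable lborel K \<and> (LINT x|lborel. K x) = 1 \<and>
     (\<forall>g h. in_Lp p g \<and> in_Lp p h \<and> conv K g = conv K h \<longrightarrow> (AE x in lborel. g x = h x))"

text \<open>Energy  |u|_BV + lambda |K*(f-u)|_p  (q = 1); infinity if the convolution is undefined.\<close>
definition energy :: "('a::euclidean_space \<Rightarrow> real) \<Rightarrow> real \<Rightarrow> real \<Rightarrow> ('a \<Rightarrow> real) \<Rightarrow> ('a \<Rightarrow> real) \<Rightarrow> ereal" where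
  "energy K p lam f u =
     (if (\<forall>x. integrable lborel (\<lambda>y. K (x - y) * (f y - u y)))
      then bv_seminorm u + ereal lam * lp_norm p (conv K (\<lambda>y. f y - u y))
      else \<infinity>)"

definition minimizers :: "('a::euclidean_space \<Rightarrow> real) \<Rightarrow> real \<Rightarrow> real \<Rightarrow> ('a \<Rightarrow> real) \<Rightarrow> ('a \<Rightarrow> real) set" where
  "minimizers K p lam f = {u \<in> BV. energy K p lam f u < \<infinity> \<and> (\<forall>v\<in>BV. energy K p lam f u \<le> energy K p lam f v)}"

definition Mset :: "('a::euclidean_space \<Rightarrow> real) \<Rightarrow> real \<Rightarrow> real \<Rightarrow> ('a \<Rightarrow> real) set" where
  "Mset K p lam = (\<Union>f. minimizers K p lam f)"

definition superlevel :: "('a \<Rightarrow> real) \<Rightarrow> real \<Rightarrow> 'a set" where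
  "superlevel u t = {x. u x > t}"

end

theory Submission
  imports Defs
begin

text \<open>Write \<open>J\<close> for the seminorm, \<open>N(g) = \<lambda> \<parallel>K * g\<parallel>\<close>, and \<open>h = f - u\<close> for the residual of a minimizer \<open>u\<close>.
  Minimality says \<open>J(u + w) - J(u) \<ge> N(h) - N(h - w)\<close> for all \<open>w\<close>. For fixed \<open>h\<close> this inequality passes from
  \<open>u\<close> to each summand of a splitting \<open>u = u\<^sub>1 + u\<^sub>2\<close> with \<open>J(u) = J(u\<^sub>1) + J(u\<^sub>2)\<close>, and from \<open>u\<close> to \<open>s u\<close> with
  \<open>s \<ge> 0\<close> by convexity of \<open>N\<close>. If \<open>\<phi>\<close> and \<open>id - \<phi>\<close> are monotone, then \<open>\<phi> \<circ> u\<close> and \<open>u - \<phi> \<circ> u\<close> split \<open>u\<close>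
  in this sense, so the inequality holds for nonnegative combinations of the difference quotients
  \<open>n (min u (t + 1/n) - min u t)\<close>, which converge to the indicators of the superlevel sets.

  The error of this approximation need not be integrable: a band \<open>t < u < t + 1/n\<close> could have infinite measure.
  It is therefore cut at a large radius \<open>R\<close>. The inner part is small in \<open>N\<close>, being bounded and small in
  \<open>L\<^sup>1\<close>. The outer part is small in \<open>J\<close>: the total variation of \<open>u\<close> outside a large ball tends to \<open>0\<close>, and by
  Fatou's lemma, applied to the monotone function sending \<open>t\<close> to the variation of \<open>min u t\<close> outside the ball,
  so does that of the difference quotients for almost every \<open>t\<close>. The limit thus satisfies the inequality with
  the same \<open>h\<close>, that is, it is a minimizer for the datum obtained by adding \<open>h\<close> to it.\<close>

subsection \<open>Continuity of translations in the mean\<close>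

text \<open>Everything is done with test fields. The splitting of the variation rests on the chain
  rule for a mollified \<open>u\<close>: testing \<open>\<phi> \<circ> u\<close> with one field and
  the remainder with another amounts to testing \<open>u\<close> with a pointwise convex combination
  of the two, which still has norm at most 1. Such a combination is only continuous; mollifying it,
  in place of \<open>u\<close>, turns it into a test field.

  No step adds the inequality for one level to that for another. A nonnegative combination of
  difference quotients is, up to one factor, a single function with slopes in [0,1] applied to
  \<open>u\<close>, so that splitting and scaling treat all levels at once.

  Fatou's lemma controls only a lower limit, so indices with small variation occur infinitely often,
  not eventually. Closeness in L^1 on a fixed ball holds eventually, hence some index has both
  properties. The inner error is bounded by the sum of the coefficients; interpolating between this
  bound and its integral makes its convolution with \<open>K\<close> small in L^p for every finite
  \<open>p\<close>.\<close>

lemma lborel_distr_isometric: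
  fixes t :: "'a::euclidean_space"
  assumes "\<bar>c\<bar> = 1"
  shows "distr lborel borel (\<lambda>x. t + c *\<^sub>R x) = lborel"
proof -
  have "c \<noteq> 0" using assms by auto
  from lborel_affine[OF this, of t] show ?thesis
    by (simp add: assms density_1)
qed

lemma lborel_integral_isometric:
  fixes f :: "'a::euclidean_space \<Rightarrow> 'b::{banach, second_countable_topology}"
  assumes "\<bar>c\<bar> = 1" and [measurable]: "f \<in> borel_measurable borel"
  shows "(LINT x|lborel. f (t + c *\<^sub>R x)) = (LINT x|lborel. f x)"
    and "integrable lborel (\<lambda>x. f (t + c *\<^sub>R x)) \<longleftrightarrow> integrable lborel f"
proof -
  have "(LINT x|lborel. f x) = (LINT x|distr lborel borel (\<lambda>x. t + c *\<^sub>R x). f x)"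
    by (simp add: lborel_distr_isometric[OF assms(1)])
  also have "\<dots> = (LINT x|lborel. f (t + c *\<^sub>R x))"
    by (rule integral_distr) auto
  finally show "(LINT x|lborel. f (t + c *\<^sub>R x)) = (LINT x|lborel. f x)" by simp
  have "integrable lborel f \<longleftrightarrow> integrable (distr lborel borel (\<lambda>x. t + c *\<^sub>R x)) f"
    by (simp add: lborel_distr_isometric[OF assms(1)])
  also have "\<dots> \<longleftrightarrow> integrable lborel (\<lambda>x. f (t + c *\<^sub>R x))"
    by (rule integrable_distr_eq) auto
  finally show "integrable lborel (\<lambda>x. f (t + c *\<^sub>R x)) \<longleftrightarrow> integrable lborel f" by simp
qed

lemma lborel_integral_translate:
  fixes f :: "'a::euclidean_space \<Rightarrow> 'b::{banach, second_countable_topology}"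
  assumes "f \<in> borel_measurable borel"
  shows "(LINT x|lborel. f (x + t)) = (LINT x|lborel. f x)"
    and "integrable lborel (\<lambda>x. f (x + t)) \<longleftrightarrow> integrable lborel f"
  using lborel_integral_isometric[of 1 f t] assms by (simp_all add: add.commute)

lemma lborel_integral_reflect:
  fixes f :: "'a::euclidean_space \<Rightarrow> 'b::{banach, second_countable_topology}"
  assumes "f \<in> borel_measurable borel"
  shows "(LINT x|lborel. f (t - x)) = (LINT x|lborel. f x)"
    and "integrable lborel (\<lambda>x. f (t - x)) \<longleftrightarrow> integrable lborel f"
  using lborel_integral_isometric[of "-1" f t] assms by simp_all

text \<open>Regularity of Lebesgue measure gives a compact \<open>D\<close> inside \<open>A\<close>
  and an open \<open>U\<close> around \<open>A\<close> with \<open>U - D\<close> small. A shift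
  shorter than the distance from \<open>D\<close> to the complement of \<open>U\<close> can change
  the indicator only where \<open>x\<close> or \<open>x + h\<close> lies in
  \<open>U - D\<close>.\<close>

lemma L1_translation_indicator:
  fixes A :: "'a::euclidean_space set"
  assumes A: "A \<in> sets borel" "emeasure lborel A < \<infinity>" and e: "e > 0"
  shows "\<exists>d>0. \<forall>h. norm h < d \<longrightarrow>
    (LINT x|lborel. \<bar>indicator A (x + h) - indicator A x\<bar>) < (e::real)"
proof -
  obtain U where U: "open U" "A \<subseteq> U" "emeasure lborel (U - A) < ennreal (e/8)"
    by (rule outer_regular_lborel[OF A(1), of "e/8"]) (use e in auto)
  have Al: "A \<in> sets lebesgue" using A(1) by simp
  obtain T where T: "closed T" "T \<subseteq> A" "emeasure lebesgue (A - T) < ennreal (e/8)"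
    by (rule sets_lebesgue_inner_closed[OF Al, of "e/8"]) (use e in auto)
  have T': "emeasure lborel (A - T) < ennreal (e/8)"
    using T A by (simp add: borel_closed sets.Diff)
  \<comment> \<open>Inner regularity provides a closed set, but the separation from the complement
    of \<open>U\<close> wants a compact one. Cutting with large balls costs arbitrarily little
    because \<open>A\<close> has finite measure.\<close>
  define C where "C n = T \<inter> cball 0 (real n)" for n
  have Cc: "compact (C n)" for n unfolding C_def using T(1) by (simp add: closed_Int_compact)
  have Cs: "C n \<subseteq> A" for n unfolding C_def using T by auto
  have mC[measurable]: "C n \<in> sets borel" for n using Cc by (simp add: borel_compact)
  have [measurable]: "A \<in> sets borel" "U \<in> sets borel" using A U by auto
  have UnC: "(\<Union>n. C n) = T"
    unfolding C_def by (auto, metis real_nat_ceiling_ge)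
  have "(\<lambda>n. emeasure lborel (A - C n)) \<longlonglongrightarrow> emeasure lborel (\<Inter>n. A - C n)"
  proof (rule Lim_emeasure_decseq)
    show "range (\<lambda>n. A - C n) \<subseteq> sets lborel" by auto
    show "decseq (\<lambda>n. A - C n)"
      unfolding decseq_def C_def by auto
    show "emeasure lborel (A - C i) \<noteq> \<infinity>" for i
      using A emeasure_mono[of "A - C i" A lborel] by (auto simp: top_unique)
  qed
  moreover have "(\<Inter>n. A - C n) = A - T" using UnC by auto
  ultimately have "(\<lambda>n. emeasure lborel (A - C n)) \<longlonglongrightarrow> emeasure lborel (A - T)" by simp
  from order_tendstoD(2)[OF this T'] obtain n where n: "emeasure lborel (A - C n) < ennreal (e/8)"
    by (auto simp: eventually_sequentially)
  define D where "D = C n"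
  have D: "compact D" "D \<subseteq> A" "emeasure lborel (A - D) < ennreal (e/8)"
    using Cc Cs n by (auto simp: D_def)
  have [measurable]: "D \<in> sets borel" by (simp add: D_def)
  obtain d where d: "d > 0" "\<And>x y. x \<in> D \<Longrightarrow> y \<in> - U \<Longrightarrow> d \<le> dist x y"
    using separate_compact_closed[OF D(1), of "- U"] U(1,2) D(2)
    by (metis Compl_disjoint closed_Compl disjoint_eq_subset_Compl double_complement order_trans)
  have "emeasure lborel (U - D) \<le> emeasure lborel (U - A) + emeasure lborel (A - D)"
    using emeasure_mono[of "U - D" "(U - A) \<union> (A - D)" lborel]
      emeasure_subadditive[of "U - A" lborel "A - D"] by (auto intro: order_trans)
  also have "\<dots> < ennreal (e/8) + ennreal (e/8)"
    using U(3) D(3) by (rule add_strict_mono)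
  also have "\<dots> = ennreal (e/4)" using e by (simp flip: ennreal_plus)
  finally have UD: "emeasure lborel (U - D) < ennreal (e/4)" .
  then have fUD: "emeasure lborel (U - D) < \<infinity>" by (rule order.strict_trans2) simp
  have mUD: "measure lborel (U - D) < e/4"
    using UD e fUD by (simp add: emeasure_eq_ennreal_measure ennreal_less_iff)
  have iUD: "integrable lborel (indicator (U - D) :: 'a \<Rightarrow> real)"
    using fUD by (simp add: integrable_real_indicator)
  show ?thesis
  proof (intro exI[of _ d] conjI allI impI d(1))
    fix h :: 'a assume h: "norm h < d"
    let ?g = "\<lambda>x. indicator (U - D) (x + h) + indicator (U - D) x :: real"
    have i1: "integrable lborel (\<lambda>x. indicator (U - D) (x + h) :: real)"
      using iUD lborel_integral_translate(2)[of "indicator (U - D) :: 'a \<Rightarrow> real" h] by simp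
    have pt: "\<bar>indicator A (x + h) - indicator A x\<bar> \<le> ?g x" for x
    proof -
      have "x \<in> U" if "x + h \<in> D"
        using d(2)[OF that, of x] h by (auto simp: dist_norm)
      moreover have "x + h \<in> U" if "x \<in> D"
        using d(2)[OF that, of "x + h"] h by (auto simp: dist_norm)
      ultimately show ?thesis using D(2) U(2) by (auto simp: indicator_def)
    qed
    have "(LINT x|lborel. \<bar>indicator A (x + h) - indicator A x\<bar>) \<le> (LINT x|lborel. ?g x)"
      using pt i1 iUD by (intro integral_mono' Bochner_Integration.integrable_add) auto
    also have "\<dots> = 2 * measure lborel (U - D)"
      using i1 iUD lborel_integral_translate(1)[of "indicator (U - D) :: 'a \<Rightarrow> real" h]
      by simp
    also have "\<dots> < e" using mUD e by simp
    finally show "(LINT x|lborel. \<bar>indicator A (x + h) - indicator A x\<bar>) < e" .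
  qed
qed

text \<open>Integrable functions are reached from indicators by sums and dominated limits. In the
  limit step the two outer errors are equal by translation invariance, so one approximant serves for
  all shifts \<open>h\<close>.\<close>

lemma L1_translation:
  fixes f :: "'a::euclidean_space \<Rightarrow> real"
  assumes "integrable lborel f"
  shows "\<forall>e>0. \<exists>d>0. \<forall>h. norm h < d \<longrightarrow> (LINT x|lborel. \<bar>f (x + h) - f x\<bar>) < e"
  using assms
proof (induction rule: integrable_induct)
  case (base A c)
  show ?case
  proof (intro allI impI)
    fix e :: real assume "e > 0"
    then have "e / (\<bar>c\<bar> + 1) > 0" by simp
    from L1_translation_indicator[OF _ _ this, of A] base obtain d where d: "d > 0"
      "\<And>h. norm h < d \<Longrightarrow> (LINT x|lborel. \<bar>indicator A (x + h) - indicator A x\<bar>) < e / (\<bar>c\<bar> + 1)"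
      by auto
    have "(LINT x|lborel. \<bar>indicator A (x + h) *\<^sub>R c - indicator A x *\<^sub>R c\<bar>) < e" if "norm h < d" for h
    proof -
      let ?I = "LINT x|lborel. \<bar>indicator A (x + h) - indicator A x\<bar>"
      have "(LINT x|lborel. \<bar>indicator A (x + h) *\<^sub>R c - indicator A x *\<^sub>R c\<bar>)
          = (LINT x|lborel. \<bar>c\<bar> * \<bar>indicator A (x + h) - indicator A x\<bar>)"
        by (intro Bochner_Integration.integral_cong refl)
          (simp add: abs_mult[symmetric] algebra_simps)
      also have "\<dots> = \<bar>c\<bar> * ?I" by simp
      also have "\<dots> \<le> (\<bar>c\<bar> + 1) * ?I" by (intro mult_right_mono) auto
      also have "\<dots> < e" using d(2)[OF that] by (simp add: field_simps)
      finally show ?thesis .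
    qed
    with d(1) show "\<exists>d>0. \<forall>h. norm h < d \<longrightarrow>
      (LINT x|lborel. \<bar>indicator A (x + h) *\<^sub>R c - indicator A x *\<^sub>R c\<bar>) < e" by blast
  qed
next
  case (add f g)
  have tr: "integrable lborel (\<lambda>x. f (x + h))" "integrable lborel (\<lambda>x. g (x + h))" for h
    using add lborel_integral_translate(2)[of f h] lborel_integral_translate(2)[of g h] by auto
  show ?case
  proof (intro allI impI)
    fix e :: real assume "e > 0"
    then have "e/2 > 0" by simp
    then obtain d1 d2 where d: "d1 > 0" "d2 > 0"
      "\<And>h. norm h < d1 \<Longrightarrow> (LINT x|lborel. \<bar>f (x + h) - f x\<bar>) < e/2"
      "\<And>h. norm h < d2 \<Longrightarrow> (LINT x|lborel. \<bar>g (x + h) - g x\<bar>) < e/2"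
      using add.IH by blast
    have "(LINT x|lborel. \<bar>f (x + h) + g (x + h) - (f x + g x)\<bar>) < e" if "norm h < min d1 d2" for h
    proof -
      have "(LINT x|lborel. \<bar>f (x + h) + g (x + h) - (f x + g x)\<bar>)
          \<le> (LINT x|lborel. \<bar>f (x + h) - f x\<bar> + \<bar>g (x + h) - g x\<bar>)"
        using tr add by (intro integral_mono) auto
      also have "\<dots> = (LINT x|lborel. \<bar>f (x + h) - f x\<bar>) + (LINT x|lborel. \<bar>g (x + h) - g x\<bar>)"
        using tr add by (intro Bochner_Integration.integral_add) auto
      also have "\<dots> < e" using d(3)[of h] d(4)[of h] that by simp
      finally show ?thesis .
    qed
    with d(1,2) show "\<exists>d>0. \<forall>h. norm h < d \<longrightarrow>
      (LINT x|lborel. \<bar>f (x + h) + g (x + h) - (f x + g x)\<bar>) < e"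
      by (intro exI[of _ "min d1 d2"]) auto
  qed
next
  case (lim f s)
  have conv: "(\<lambda>i. s i x) \<longlonglongrightarrow> f x" and bd: "\<bar>s i x\<bar> \<le> 2 * \<bar>f x\<bar>" for x i
    using lim by auto
  have intf: "integrable lborel f" and ints: "integrable lborel (s i)" for i
    using lim by blast+
  have trf: "integrable lborel (\<lambda>x. f (x + h))" for h
    using intf lborel_integral_translate(2)[of f h] by auto
  have trs: "integrable lborel (\<lambda>x. s i (x + h))" for h i
    using ints[of i] lborel_integral_translate(2)[of "s i" h] by auto
  have "(\<lambda>i. LINT x|lborel. \<bar>s i x - f x\<bar>) \<longlonglongrightarrow> (LINT x|(lborel :: 'a measure). 0::real)"
  proof (rule integral_dominated_convergence[where M=lborel and w="\<lambda>x. 3 * \<bar>f x\<bar>"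
        and s="\<lambda>i x. \<bar>s i x - f x\<bar>" and f="\<lambda>x. 0::real"])
    show "AE x in lborel. (\<lambda>i. \<bar>s i x - f x\<bar>) \<longlonglongrightarrow> 0"
      using conv by (intro AE_I2 tendsto_rabs_zero LIM_zero)
    show "AE x in lborel. norm \<bar>s i x - f x\<bar> \<le> 3 * \<bar>f x\<bar>" for i
    proof (rule AE_I2)
      fix x show "norm \<bar>s i x - f x\<bar> \<le> 3 * \<bar>f x\<bar>" using bd[of i x] by simp
    qed
  qed (use intf ints in auto)
  then have to0: "(\<lambda>i. LINT x|lborel. \<bar>s i x - f x\<bar>) \<longlonglongrightarrow> 0" by simp
  show ?case
  proof (intro allI impI)
    fix e :: real assume e: "e > 0"
    from order_tendstoD(2)[OF to0, of "e/4"] e obtain i where i: "(LINT x|lborel. \<bar>s i x - f x\<bar>) < e/4"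
      by (auto simp: eventually_sequentially)
    from e have "e/4 > 0" by simp
    with lim.IH[of i] obtain d where d: "d > 0"
      "\<And>h. norm h < d \<Longrightarrow> (LINT x|lborel. \<bar>s i (x + h) - s i x\<bar>) < e/4" by blast
    have "(LINT x|lborel. \<bar>f (x + h) - f x\<bar>) < e" if "norm h < d" for h
    proof -
      have eq: "(LINT x|lborel. \<bar>s i (x + h) - f (x + h)\<bar>) = (LINT x|lborel. \<bar>s i x - f x\<bar>)"
        by (rule lborel_integral_translate(1)[of "\<lambda>x. \<bar>s i x - f x\<bar>" h]) (use intf ints in auto)
      have "(LINT x|lborel. \<bar>f (x + h) - f x\<bar>)
          \<le> (LINT x|lborel. \<bar>s i (x + h) - f (x + h)\<bar> + \<bar>s i (x + h) - s i x\<bar> + \<bar>s i x - f x\<bar>)"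
        using trf trs ints intf by (intro integral_mono) auto
      also have "\<dots> = (LINT x|lborel. \<bar>s i (x + h) - f (x + h)\<bar>)
          + (LINT x|lborel. \<bar>s i (x + h) - s i x\<bar>) + (LINT x|lborel. \<bar>s i x - f x\<bar>)"
        using trf trs ints intf by simp
      also have "\<dots> < e" using i d(2)[OF that] eq e by simp
      finally show ?thesis .
    qed
    with d(1) show "\<exists>d>0. \<forall>h. norm h < d \<longrightarrow> (LINT x|lborel. \<bar>f (x + h) - f x\<bar>) < e" by blast
  qed
qed

subsection \<open>Local integrability and mollifiers\<close>

lemma loc_integrable_measurable [measurable_dest]:
  "loc_integrable u \<Longrightarrow> u \<in> borel_measurable borel"
  by (simp add: loc_integrable_def)

lemma loc_integrable_cball:
  "loc_integrable u \<Longrightarrow> set_integrable lborel (cball a r) u"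
  by (simp add: loc_integrable_def)

lemma integrable_indicator_compact:
  fixes C :: "'a::euclidean_space set"
  assumes "compact C" shows "integrable lborel (indicator C :: 'a \<Rightarrow> real)"
  using emeasure_compact_finite[OF assms] assms
  by (intro integrable_real_indicator) (auto simp: borel_compact)

lemma loc_integrable_bounded:
  fixes f :: "'a::euclidean_space \<Rightarrow> real"
  assumes [measurable]: "f \<in> borel_measurable borel" and M: "\<And>x. \<bar>f x\<bar> \<le> M"
  shows "loc_integrable f"
  unfolding loc_integrable_def
proof (intro conjI allI impI)
  fix C :: "'a set" assume C: "compact C"
  then have [measurable]: "C \<in> sets borel" by (rule borel_compact)
  have "integrable lborel (\<lambda>x. M * indicator C x)" using integrable_indicator_compact[OF C] by simp
  then show "set_integrable lborel C f"
    unfolding set_integrable_def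
  proof (rule Bochner_Integration.integrable_bound)
    show "AE x in lborel. norm (indicat_real C x *\<^sub>R f x) \<le> norm (M * indicat_real C x)"
      using order_trans[OF M abs_ge_self] by (intro AE_I2) (simp add: indicator_def)
  qed measurable
qed measurable

text \<open>The codomain is general because the same bound is used for scalar factors such as a
  divergence and for the vector-valued gradient of a kernel.\<close>

lemma loc_integrable_scaleR:
  fixes \<psi> :: "'a::euclidean_space \<Rightarrow> 'b::euclidean_space"
  assumes u: "loc_integrable u" and [measurable]: "\<psi> \<in> borel_measurable borel"
    and M: "\<And>x. norm (\<psi> x) \<le> M" and z: "\<And>x. x \<notin> cball a r \<Longrightarrow> \<psi> x = 0"
  shows "integrable lborel (\<lambda>x. u x *\<^sub>R \<psi> x)"
    and "norm (LINT x|lborel. u x *\<^sub>R \<psi> x) \<le> M * (LINT x:cball a r|lborel. \<bar>u x\<bar>)"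
proof -
  have [measurable]: "u \<in> borel_measurable borel" using u by (rule loc_integrable_measurable)
  have i: "integrable lborel (\<lambda>x. indicator (cball a r) x * \<bar>u x\<bar>)"
    using set_integrable_abs[OF loc_integrable_cball[OF u, of a r]] by (simp add: set_integrable_def)
  then have i': "integrable lborel (\<lambda>x. M * (indicator (cball a r) x * \<bar>u x\<bar>))" by simp
  have b: "norm (u x *\<^sub>R \<psi> x) \<le> M * (indicator (cball a r) x * \<bar>u x\<bar>)" for x
  proof (cases "x \<in> cball a r")
    case True
    then show ?thesis using mult_left_mono[OF M[of x], of "\<bar>u x\<bar>"] by (simp add: mult.commute)
  qed (simp add: z)
  have Mn: "0 \<le> M" using norm_ge_zero[of "\<psi> 0"] M[of 0] by linarith
  show int: "integrable lborel (\<lambda>x. u x *\<^sub>R \<psi> x)"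
  proof (rule Bochner_Integration.integrable_bound[OF i'])
    show "AE x in lborel. norm (u x *\<^sub>R \<psi> x) \<le> norm (M * (indicator (cball a r) x * \<bar>u x\<bar>))"
      using b Mn by (intro AE_I2) (smt (verit) real_norm_def)
  qed measurable
  have "norm (LINT x|lborel. u x *\<^sub>R \<psi> x) \<le> (LINT x|lborel. norm (u x *\<^sub>R \<psi> x))"
    by (rule integral_norm_bound)
  also have "\<dots> \<le> (LINT x|lborel. M * (indicator (cball a r) x * \<bar>u x\<bar>))"
    using b int i' by (intro integral_mono integrable_norm) auto
  also have "\<dots> = M * (LINT x:cball a r|lborel. \<bar>u x\<bar>)"
    by (simp add: set_lebesgue_integral_def)
  finally show "norm (LINT x|lborel. u x *\<^sub>R \<psi> x) \<le> M * (LINT x:cball a r|lborel. \<bar>u x\<bar>)" .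
qed

lemmas loc_integrable_mult = loc_integrable_scaleR[where 'b=real, unfolded real_scaleR_def]

lemma compact_support_bounded:
  fixes \<psi> :: "'a::euclidean_space \<Rightarrow> 'b::real_normed_vector"
  assumes c: "continuous_on UNIV \<psi>" and z: "\<And>x. norm x > r \<Longrightarrow> \<psi> x = 0"
  obtains M where "M > 0" "\<And>x. norm (\<psi> x) \<le> M"
proof -
  have "compact (\<psi> ` cball 0 r)"
    using c by (intro compact_continuous_image) (auto intro: continuous_on_subset)
  then obtain M where M: "M > 0" "\<forall>y\<in>\<psi> ` cball 0 r. norm y \<le> M"
    by (meson bounded_pos compact_imp_bounded)
  have "norm (\<psi> x) \<le> M" for x
    by (cases "norm x > r") (use M z in auto)
  with M(1) show ?thesis using that by blast
qed

lemma integrable_continuous_compact_support: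
  fixes f :: "'a::euclidean_space \<Rightarrow> real"
  assumes "continuous_on UNIV f" "\<And>x. norm x > r \<Longrightarrow> f x = 0"
  shows "integrable lborel f"
proof -
  obtain M where "\<And>x. norm (f x) \<le> M" using compact_support_bounded[OF assms] by metis
  moreover have "loc_integrable (\<lambda>x::'a. 1::real)" by (rule loc_integrable_bounded[of _ 1]) simp_all
  ultimately show ?thesis
    using loc_integrable_mult(1)[OF _ borel_measurable_continuous_onI[OF assms(1)], of "\<lambda>x. 1" M 0 r] assms(2) by simp
qed

text \<open>A step of at most 1 keeps both points in \<open>cball 0 (r + 1)\<close> or puts both
  outside the support. It also lets later integrals of \<open>u\<close> be taken over one fixed ball
  of radius \<open>r + 1\<close>.\<close>

lemma compact_support_uniform:
  fixes \<psi> :: "'a::euclidean_space \<Rightarrow> 'b::real_normed_vector"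
  assumes c: "continuous_on UNIV \<psi>" and z: "\<And>x. norm x > r \<Longrightarrow> \<psi> x = 0" and e: "e > 0"
  obtains d where "d > 0" "d \<le> 1" "\<And>x y. norm (x - y) < d \<Longrightarrow> norm (\<psi> x - \<psi> y) < e"
proof -
  have "uniformly_continuous_on (cball 0 (r + 1)) \<psi>"
    using c by (intro compact_uniformly_continuous) (auto intro: continuous_on_subset)
  then obtain d where d: "d > 0" "\<And>x y. x \<in> cball 0 (r + 1) \<Longrightarrow> y \<in> cball 0 (r + 1) \<Longrightarrow>
      dist x y < d \<Longrightarrow> dist (\<psi> x) (\<psi> y) < e"
    unfolding uniformly_continuous_on_def using e by (metis dist_commute)
  have "norm (\<psi> x - \<psi> y) < e" if "norm (x - y) < min d 1" for x y
  proof (cases "norm x \<le> r + 1 \<and> norm y \<le> r + 1")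
    case True
    with d(2)[of x y] that show ?thesis by (simp add: dist_norm)
  next
    case False
    have "norm x \<le> norm y + norm (x - y)" "norm y \<le> norm x + norm (x - y)"
      using norm_triangle_ineq[of y "x - y"] norm_triangle_ineq[of x "y - x"]
      by (auto simp: norm_minus_commute)
    with False that have "norm x > r" "norm y > r" by auto
    then show ?thesis using z e by simp
  qed
  then show ?thesis using that[of "min d 1"] d(1) by simp
qed

lemma continuous_conv:
  fixes \<psi> :: "'a::euclidean_space \<Rightarrow> 'b::euclidean_space"
  assumes u: "loc_integrable u"
    and c: "continuous_on UNIV \<psi>" and z: "\<And>x. norm x > r \<Longrightarrow> \<psi> x = 0"
  shows "continuous_on UNIV (\<lambda>x. LINT y|lborel. u y *\<^sub>R \<psi> (x - y))"
    and "integrable lborel (\<lambda>y. u y *\<^sub>R \<psi> (x - y))"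
proof -
  have [measurable]: "\<psi> \<in> borel_measurable borel" using c by (rule borel_measurable_continuous_onI)
  obtain M where M: "M > 0" "\<And>x. norm (\<psi> x) \<le> M" using compact_support_bounded[OF c z] by metis
  have int: "integrable lborel (\<lambda>y. u y *\<^sub>R \<psi> (x - y))" for x
  proof (rule loc_integrable_scaleR(1)[OF u, where M=M and a=x and r=r])
    show "\<And>y. y \<notin> cball x r \<Longrightarrow> \<psi> (x - y) = 0" using z by (auto simp: dist_norm)
  qed (use M in auto)
  then show "integrable lborel (\<lambda>y. u y *\<^sub>R \<psi> (x - y))" .
  show "continuous_on UNIV (\<lambda>x. LINT y|lborel. u y *\<^sub>R \<psi> (x - y))"
    unfolding continuous_on_iff
  proof (intro ballI allI impI)
    fix x :: 'a and e :: real assume e: "e > 0"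
    define I where "I = (LINT y:cball x (r + 1)|lborel. \<bar>u y\<bar>)"
    have I: "I \<ge> 0" unfolding I_def set_lebesgue_integral_def by (intro integral_nonneg_AE) auto
    obtain d where d: "d > 0" "d \<le> 1" "\<And>x y. norm (x - y) < d \<Longrightarrow> norm (\<psi> x - \<psi> y) < e / (I + 1)"
      by (rule compact_support_uniform[OF c, of r "e / (I + 1)"]) (use e I z in auto)
    show "\<exists>d>0. \<forall>x'\<in>UNIV. dist x' x < d \<longrightarrow>
        dist (LINT y|lborel. u y *\<^sub>R \<psi> (x' - y)) (LINT y|lborel. u y *\<^sub>R \<psi> (x - y)) < e"
    proof (intro exI[of _ d] conjI ballI impI d(1))
      fix x' assume x': "dist x' x < d"
      have "dist (LINT y|lborel. u y *\<^sub>R \<psi> (x' - y)) (LINT y|lborel. u y *\<^sub>R \<psi> (x - y))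
          = norm (LINT y|lborel. u y *\<^sub>R (\<psi> (x' - y) - \<psi> (x - y)))"
        using int by (simp add: dist_norm scaleR_diff_right)
      also have "\<dots> \<le> e / (I + 1) * I"
        unfolding I_def
      proof (rule loc_integrable_scaleR(2)[OF u])
        show "norm (\<psi> (x' - y) - \<psi> (x - y)) \<le> e / ((LINT y:cball x (r + 1)|lborel. \<bar>u y\<bar>) + 1)" for y
          using d(3)[of "x' - y" "x - y"] x' by (simp add: dist_norm I_def)
        show "\<psi> (x' - y) - \<psi> (x - y) = 0" if "y \<notin> cball x (r + 1)" for y
        proof -
          have "norm (x - y) > r + 1" using that by (simp add: dist_norm)
          moreover have "norm (x - y) \<le> norm (x' - y) + norm (x' - x)"
            using norm_triangle_ineq[of "x' - y" "x - x'"] by (simp add: norm_minus_commute)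
          ultimately have "norm (x' - y) > r" "norm (x - y) > r" using x' d(2) by (auto simp: dist_norm)
          then show ?thesis using z by simp
        qed
      qed measurable
      also have "\<dots> < e" using e I by (simp add: field_simps)
      finally show "dist (LINT y|lborel. u y *\<^sub>R \<psi> (x' - y)) (LINT y|lborel. u y *\<^sub>R \<psi> (x - y)) < e" .
    qed
  qed
qed

text \<open>Differentiation under the integral by a uniform first-order expansion: the mean value
  inequality and the uniform continuity of \<open>g\<close> bound the linearization error of
  \<open>k\<close> by a small multiple of \<open>norm (x' - x)\<close>, and this error lives on one
  ball, where \<open>u\<close> is integrable.\<close>

lemma has_derivative_conv:
  fixes k :: "'a::euclidean_space \<Rightarrow> real"
  assumes u: "loc_integrable u"
    and k: "\<And>x. (k has_derivative (\<lambda>v. g x \<bullet> v)) (at x)"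
    and g: "continuous_on UNIV g"
    and z: "\<And>x. norm x > r \<Longrightarrow> k x = 0" "\<And>x. norm x > r \<Longrightarrow> g x = 0"
  shows "(conv k u has_derivative (\<lambda>v. (LINT y|lborel. u y *\<^sub>R g (x - y)) \<bullet> v)) (at x)"
proof -
  have kc: "continuous_on UNIV k"
    using k has_derivative_continuous by (fastforce simp: continuous_on_eq_continuous_at)
  have [measurable]: "g \<in> borel_measurable borel" "k \<in> borel_measurable borel"
    using g kc by (auto intro: borel_measurable_continuous_onI)
  have ik: "integrable lborel (\<lambda>y. u y * k (x - y))" for x
    using continuous_conv(2)[OF u kc, of r] z by simp
  have ig: "integrable lborel (\<lambda>y. u y *\<^sub>R g (x - y))" for x
    using continuous_conv(2)[OF u g, of r] z by simp
  have convk: "conv k u = (\<lambda>x. LINT y|lborel. u y * k (x - y))"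
    by (simp add: conv_def mult.commute)
  show ?thesis
    unfolding has_derivative_at_alt
  proof (intro conjI allI impI)
    show "bounded_linear (\<lambda>v. (LINT y|lborel. u y *\<^sub>R g (x - y)) \<bullet> v)"
      by (rule bounded_linear_inner_right)
    fix e :: real assume e: "e > 0"
    define I where "I = (LINT y:cball x (r + 1)|lborel. \<bar>u y\<bar>)"
    have I: "I \<ge> 0" unfolding I_def set_lebesgue_integral_def by (intro integral_nonneg_AE) auto
    obtain d where d: "d > 0" "d \<le> 1" "\<And>x y. norm (x - y) < d \<Longrightarrow> norm (g x - g y) < e / (I + 1)"
      by (rule compact_support_uniform[OF g, of r "e / (I + 1)"]) (use e I z in auto)
    show "\<exists>d>0. \<forall>x'. norm (x' - x) < d \<longrightarrow>
        norm (conv k u x' - conv k u x - (LINT y|lborel. u y *\<^sub>R g (x - y)) \<bullet> (x' - x)) \<le> e * norm (x' - x)"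
    proof (intro exI[of _ d] conjI allI impI d(1))
      fix x' assume x': "norm (x' - x) < d"
      let ?\<psi> = "\<lambda>y. k (x' - y) - k (x - y) - g (x - y) \<bullet> (x' - x)"
      have "conv k u x' - conv k u x - (LINT y|lborel. u y *\<^sub>R g (x - y)) \<bullet> (x' - x)
          = (LINT y|lborel. u y * ?\<psi> y)"
        using ik[of x] ik[of x'] ig[of x]
        by (simp add: convk right_diff_distrib flip: integral_inner_left inner_scaleR_left)
      moreover have "norm (LINT y|lborel. u y * ?\<psi> y) \<le> (e / (I + 1) * norm (x' - x)) * I"
        unfolding I_def
      proof (rule loc_integrable_mult(2)[OF u])
        show "?\<psi> y = 0" if "y \<notin> cball x (r + 1)" for y
        proof -
          have "norm (x - y) > r + 1" using that by (simp add: dist_norm)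
          moreover have "norm (x - y) \<le> norm (x' - y) + norm (x' - x)"
            using norm_triangle_ineq[of "x' - y" "x - x'"] by (simp add: norm_minus_commute)
          ultimately have "norm (x' - y) > r" "norm (x - y) > r" using x' d(2) by auto
          then show ?thesis using z by simp
        qed
        show "norm (?\<psi> y) \<le> e / ((LINT y:cball x (r + 1)|lborel. \<bar>u y\<bar>) + 1) * norm (x' - x)" for y
        proof -
          have "norm (k (x' - y) - k (x - y) - g (x - y) \<bullet> (x' - y - (x - y)))
              \<le> norm (x' - y - (x - y)) * (e / (I + 1))"
          proof (rule differentiable_bound_linearization[of "x - y" "x' - y" "ball (x - y) d" k
              "\<lambda>w. (\<bullet>) (g w)" "x - y"])
            show "x - y + t *\<^sub>R (x' - y - (x - y)) \<in> ball (x - y) d" if "t \<in> {0..1}" for t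
            proof -
              have "\<bar>t\<bar> * norm (x' - x) \<le> 1 * norm (x' - x)" using that by (intro mult_right_mono) auto
              then show ?thesis using x' by (simp add: dist_norm)
            qed
            show "(k has_derivative (\<bullet>) (g w)) (at w within ball (x - y) d)" for w
              by (rule has_derivative_at_withinI[OF k])
            show "onorm ((\<bullet>) (g w) - (\<bullet>) (g (x - y))) \<le> e / (I + 1)" if "w \<in> ball (x - y) d" for w
            proof (rule onorm_bound)
              show "0 \<le> e / (I + 1)" using e I by simp
              fix v
              have "norm (g w \<bullet> v - g (x - y) \<bullet> v) \<le> norm (g w - g (x - y)) * norm v"
                using Cauchy_Schwarz_ineq2 by (simp flip: inner_diff_left)
              also have "\<dots> \<le> e / (I + 1) * norm v"
                using d(3)[of w "x - y"] that
                by (intro mult_right_mono) (auto simp: dist_norm norm_minus_commute)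
              finally show "norm (((\<bullet>) (g w) - (\<bullet>) (g (x - y))) v) \<le> e / (I + 1) * norm v"
                by simp
            qed
            show "x - y \<in> ball (x - y) d" using d(1) by simp
          qed
          then show ?thesis by (simp add: I_def mult.commute)
        qed
      qed measurable
      moreover have "(e / (I + 1) * norm (x' - x)) * I \<le> e * norm (x' - x)"
      proof -
        have "e / (I + 1) * I \<le> e" using e I by (simp add: field_simps)
        from mult_right_mono[OF this norm_ge_zero[of "x' - x"]] show ?thesis by (simp add: mult_ac)
      qed
      ultimately show "norm (conv k u x' - conv k u x - (LINT y|lborel. u y *\<^sub>R g (x - y)) \<bullet> (x' - x))
          \<le> e * norm (x' - x)" by (smt (verit) real_norm_def)
    qed
  qed
qed

text \<open>Test fields have to be C^1, and the squared positive part is a simple C^1 function that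
  vanishes on a half line. Mollifiers and cutoffs are both built from it.\<close>

lemma pos_square_has_derivative:
  "((\<lambda>s::real. (max 0 s)\<^sup>2) has_real_derivative 2 * max 0 s) (at s)"
  unfolding has_field_derivative_def has_derivative_at_alt
proof (intro conjI allI impI bounded_linear_mult_right)
  fix e :: real assume e: "e > 0"
  have "\<bar>(max 0 t)\<^sup>2 - (max 0 s)\<^sup>2 - 2 * max 0 s * (t - s)\<bar> \<le> (t - s)\<^sup>2" for t
  proof -
    consider "0 \<le> s" "0 \<le> t" | "s < 0" "0 \<le> t" | "0 \<le> s" "t < 0" | "s < 0" "t < 0" by linarith
    then show ?thesis
    proof cases
      case 1
      then have "(max 0 t)\<^sup>2 - (max 0 s)\<^sup>2 - 2 * max 0 s * (t - s) = (t - s)\<^sup>2"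
        by (simp add: power2_eq_square algebra_simps)
      then show ?thesis by simp
    next
      case 2 
      then have "t\<^sup>2 \<le> (t - s)\<^sup>2" by (intro power_mono) auto
      with 2 show ?thesis by simp
    next
      case 3
      then have "s * t \<le> 0" by (simp add: mult_nonneg_nonpos)
      moreover have "(max 0 t)\<^sup>2 - (max 0 s)\<^sup>2 - 2 * max 0 s * (t - s) = s\<^sup>2 - 2 * (s * t)"
        using 3 by (simp add: power2_eq_square algebra_simps)
      moreover have "(t - s)\<^sup>2 = s\<^sup>2 - 2 * (s * t) + t\<^sup>2" by (simp add: power2_eq_square algebra_simps)
      ultimately show ?thesis by (smt (verit) zero_le_power2)
    next
      case 4 then show ?thesis by simp
    qed
  qed
  moreover have "(t - s)\<^sup>2 \<le> e * \<bar>t - s\<bar>" if "\<bar>t - s\<bar> < e" for t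
    using that mult_right_mono[of "\<bar>t - s\<bar>" e "\<bar>t - s\<bar>"]
    by (simp add: power2_eq_square flip: abs_mult)
  ultimately show "\<exists>d>0. \<forall>t. norm (t - s) < d \<longrightarrow>
      norm ((max 0 t)\<^sup>2 - (max 0 s)\<^sup>2 - 2 * max 0 s * (t - s)) \<le> e * norm (t - s)"
    using e by (intro exI[of _ e]) (auto intro: order_trans)
qed

text \<open>\<open>g\<close> is the gradient of \<open>k\<close>. Its oddness records the symmetry
  of a radial kernel and produces the sign when \<open>x\<close> and \<open>y\<close> exchange roles
  in \<open>gradient_conv_pairing\<close>.\<close>

locale mollifier =
  fixes e :: real and k :: "'a::euclidean_space \<Rightarrow> real" and g :: "'a \<Rightarrow> 'a"
  assumes k_deriv: "(k has_derivative (\<lambda>v. g x \<bullet> v)) (at x)" and g_cont: "continuous_on UNIV g"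
    and k_zero: "norm x > e \<Longrightarrow> k x = 0" and g_zero: "norm x > e \<Longrightarrow> g x = 0"
    and k_nonneg: "k x \<ge> 0" and g_odd: "g (- x) = - g x"
    and k_int: "integrable lborel k" and k_one: "(LINT x|lborel. k x) = 1" and e_pos: "e > 0"

lemma mollifier_exists:
  assumes "e > 0"
  shows "\<exists>(k :: 'a::euclidean_space \<Rightarrow> real) g. mollifier e k g"
proof -
  \<comment> \<open>The C^1 bump \<open>(e^2 - |x|^2)_+^2\<close>, normalized later by its integral
    \<open>Z\<close>. \<open>g0\<close> is its gradient; the factor -4 comes from the outer square
    and from differentiating \<open>- (x \<bullet> x)\<close>.\<close>
  define k0 :: "'a \<Rightarrow> real" where "k0 x = (max 0 (e\<^sup>2 - x \<bullet> x))\<^sup>2" for x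
  define g0 :: "'a \<Rightarrow> 'a" where "g0 x = (- 4 * max 0 (e\<^sup>2 - x \<bullet> x)) *\<^sub>R x" for x
  have d0: "(k0 has_derivative (\<lambda>v. g0 x \<bullet> v)) (at x)" for x
  proof -
    have "((\<lambda>x. e\<^sup>2 - x \<bullet> x) has_derivative (\<lambda>v. - 2 * (x \<bullet> v))) (at x)"
      by (auto intro!: derivative_eq_intros simp: inner_commute)
    from has_derivative_compose[OF this, of "\<lambda>s. (max 0 s)\<^sup>2" "(*) (2 * max 0 (e\<^sup>2 - x \<bullet> x))"]
    show ?thesis
      using pos_square_has_derivative[of "e\<^sup>2 - x \<bullet> x"]
      by (simp add: k0_def[abs_def] g0_def has_field_derivative_def mult_ac)
  qed
  have z: "max 0 (e\<^sup>2 - x \<bullet> x) = 0" if "norm x > e" for x :: 'a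
    using that assms by (simp add: dot_square_norm power_mono less_imp_le)
  have c0: "continuous_on UNIV g0" unfolding g0_def by (intro continuous_intros)
  have ck: "continuous_on UNIV k0" unfolding k0_def by (intro continuous_intros)
  then have [measurable]: "k0 \<in> borel_measurable borel" by (rule borel_measurable_continuous_onI)
  have zk: "k0 x = 0" if "norm x > e" for x using z[OF that] by (simp add: k0_def)
  have int: "integrable lborel k0" by (rule integrable_continuous_compact_support[OF ck zk])
  have "(LINT x|lborel. k0 x) \<noteq> 0"
  proof
    assume "(LINT x|lborel. k0 x) = 0"
    then have "AE x in lborel. k0 x = 0"
      by (subst (asm) integral_nonneg_eq_0_iff_AE[OF int]) (auto simp: k0_def)
    moreover have "k0 x \<noteq> 0" if "x \<in> ball 0 e" for x
    proof -
      have "(norm x)\<^sup>2 < e\<^sup>2" using that by (intro power_strict_mono) auto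
      then show ?thesis by (simp add: k0_def dot_square_norm)
    qed
    ultimately have "AE x in lborel. x \<notin> ball (0::'a) e" by (metis (mono_tags, lifting) eventually_mono)
    then have "emeasure lborel (ball (0::'a) e) = 0"
      by (subst (asm) AE_iff_measurable[OF _ refl]) (auto simp: ball_def)
    with content_ball_pos[OF assms, of "0::'a"] show False by (simp add: measure_def)
  qed
  moreover have "(LINT x|lborel. k0 x) \<ge> 0" by (intro integral_nonneg_AE) (simp add: k0_def)
  ultimately have Z: "(LINT x|lborel. k0 x) > 0" by simp
  define Z where "Z = (LINT x|lborel. k0 x)"
  show ?thesis
  proof (rule exI[of _ "\<lambda>x. k0 x / Z"], rule exI[of _ "\<lambda>x. (1/Z) *\<^sub>R g0 x"], rule mollifier.intro)
    show "((\<lambda>x. k0 x / Z) has_derivative (\<lambda>v. ((1/Z) *\<^sub>R g0 x) \<bullet> v)) (at x)" for x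
      using has_derivative_mult_right[OF d0[of x], of "1/Z"] by (simp add: divide_inverse mult.commute)
    show "continuous_on UNIV (\<lambda>x. (1/Z) *\<^sub>R g0 x)" using c0 by (intro continuous_intros)
    show "k0 x / Z = 0" "(1/Z) *\<^sub>R g0 x = 0" if "norm x > e" for x
      using z[OF that] by (simp_all add: k0_def g0_def)
    show "k0 x / Z \<ge> 0" "(1/Z) *\<^sub>R g0 (- x) = - ((1/Z) *\<^sub>R g0 x)" for x
      using Z by (simp_all add: k0_def g0_def Z_def)
    show "integrable lborel (\<lambda>x. k0 x / Z)" using int by simp
    show "(LINT x|lborel. k0 x / Z) = 1" using Z by (simp add: Z_def)
    show "e > 0" by fact
  qed
qed

subsection \<open>Test fields and integration by parts\<close>

lemma deriv_zero_outside:
  fixes F :: "'a::real_normed_vector \<Rightarrow> 'b::real_normed_vector"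
  assumes d: "(F has_derivative D) (at x)" and z: "\<And>x. norm x > r \<Longrightarrow> F x = 0" and x: "norm x > r"
  shows "D = (\<lambda>v. 0)"
proof -
  have "((\<lambda>x. 0) has_derivative D) (at x)"
  proof (rule has_derivative_transform_within_open[OF d])
    show "open {x. norm x > r}" by (intro open_Collect_less continuous_intros)
  qed (use x z in auto)
  from has_derivative_unique[OF this] show ?thesis by auto
qed

text \<open>Difference quotients in direction \<open>b\<close> have integral 0 by translation
  invariance. They converge to the partial derivative and, as the steps are at most 1, are dominated
  by \<open>M\<close> on the ball of radius \<open>r + 1\<close>.\<close>

lemma integral_partial_zero:
  fixes F :: "'a::euclidean_space \<Rightarrow> real"
  assumes d: "\<And>x. (F has_derivative D x) (at x)" and c: "continuous_on UNIV (\<lambda>x. D x b)"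
    and z: "\<And>x. norm x > r \<Longrightarrow> F x = 0" and b: "b \<in> Basis"
  shows "(LINT x|lborel. D x b) = 0"
proof -
  have zD: "D x b = 0" if "norm x > r" for x using deriv_zero_outside[OF d z that] by simp
  obtain M where M: "M > 0" "\<And>x. norm (D x b) \<le> M" using compact_support_bounded[OF c zD] by metis
  have Fc: "continuous_on UNIV F"
    using d has_derivative_continuous by (fastforce simp: continuous_on_eq_continuous_at)
  have [measurable]: "F \<in> borel_measurable borel" "(\<lambda>x. D x b) \<in> borel_measurable borel"
    using Fc c by (auto intro: borel_measurable_continuous_onI)
  have intF: "integrable lborel F" by (rule integrable_continuous_compact_support[OF Fc z])
  define h where "h n = inverse (real (Suc n))" for n
  have h: "h n > 0" "h n \<le> 1" for n by (auto simp: h_def field_simps)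
  have h0: "h \<longlonglongrightarrow> 0" unfolding h_def by (rule LIMSEQ_inverse_real_of_nat)
  have line: "((\<lambda>t. F (x + t *\<^sub>R b)) has_derivative (\<lambda>s. s * D (x + t *\<^sub>R b) b)) (at t)" for x t
  proof -
    have "((\<lambda>t. x + t *\<^sub>R b) has_derivative (\<lambda>s. s *\<^sub>R b)) (at t)"
      by (auto intro!: derivative_eq_intros)
    from has_derivative_compose[OF this d] 
    have "((\<lambda>t. F (x + t *\<^sub>R b)) has_derivative (\<lambda>s. D (x + t *\<^sub>R b) (s *\<^sub>R b))) (at t)" .
    moreover have "D (x + t *\<^sub>R b) (s *\<^sub>R b) = s * D (x + t *\<^sub>R b) b" for s
      using linear_cmul[OF has_derivative_linear[OF d], of "x + t *\<^sub>R b" s b] by simp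
    ultimately show ?thesis by simp
  qed
  define q where "q n x = (F (x + h n *\<^sub>R b) - F x) / h n" for n x
  have int0: "(LINT x|lborel. q n x) = 0" for n
  proof -
    have "integrable lborel (\<lambda>x. F (x + h n *\<^sub>R b))"
      using intF lborel_integral_translate(2)[of F] by simp
    then show ?thesis
      using intF lborel_integral_translate(1)[of F "h n *\<^sub>R b"] by (simp add: q_def)
  qed
  have "(\<lambda>n. LINT x|lborel. q n x) \<longlonglongrightarrow> (LINT x|lborel. D x b)"
  proof (rule integral_dominated_convergence[where w="\<lambda>x. M * indicator (cball 0 (r + 1)) x"])
    show "(\<lambda>x. D x b) \<in> borel_measurable lborel" "\<And>n. q n \<in> borel_measurable lborel"
      unfolding q_def by simp_all
    show "integrable lborel (\<lambda>x. M * indicator (cball (0::'a) (r + 1)) x)"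
      by (intro integrable_mult_right integrable_real_indicator)
        (auto intro!: emeasure_compact_finite simp: borel_compact simp flip: infinity_ennreal_def)
    show "AE x in lborel. (\<lambda>n. q n x) \<longlonglongrightarrow> D x b"
    proof (rule AE_I2)
      fix x
      have "((\<lambda>t. F (x + t *\<^sub>R b)) has_real_derivative D x b) (at 0)"
        using line[of x 0] by (simp add: has_field_derivative_def mult_commute_abs)
      then have "(\<lambda>t. (F (x + t *\<^sub>R b) - F x) / t) \<midarrow>0\<rightarrow> D x b"
        by (simp add: has_field_derivative_iff)
      from tendsto_compose_eventually[OF this h0] h show "(\<lambda>n. q n x) \<longlonglongrightarrow> D x b"
        by (simp add: q_def order_less_imp_not_eq2)
    qed
    show "AE x in lborel. norm (q n x) \<le> M * indicator (cball 0 (r + 1)) x" for n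
    proof (rule AE_I2)
      fix x
      show "norm (q n x) \<le> M * indicator (cball 0 (r + 1)) x"
      proof (cases "norm x \<le> r + 1")
        case True
        have "\<exists>t\<in>{0<..<h n}. norm (F (x + h n *\<^sub>R b) - F (x + 0 *\<^sub>R b)) \<le> norm ((h n - 0) * D (x + t *\<^sub>R b) b)"
        proof (rule mvt_general[where f="\<lambda>t. F (x + t *\<^sub>R b)" and f'="\<lambda>t s. s * D (x + t *\<^sub>R b) b"])
          show "continuous_on {0..h n} (\<lambda>t. F (x + t *\<^sub>R b))"
            by (rule has_derivative_continuous_on[OF has_derivative_at_withinI[OF line]])
        qed (use h line in auto)
        then obtain t where "norm (F (x + h n *\<^sub>R b) - F x) \<le> h n * norm (D (x + t *\<^sub>R b) b)"
          using h[of n] by (auto simp: abs_mult)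
        also have "\<dots> \<le> h n * M" using M h[of n] by (intro mult_left_mono) auto
        finally have "norm (q n x) \<le> M" using h[of n] by (simp add: q_def field_simps)
        then show ?thesis using True by simp
      next
        case False
        have "norm x \<le> norm (x + h n *\<^sub>R b) + h n"
          using norm_triangle_ineq[of "x + h n *\<^sub>R b" "- (h n *\<^sub>R b)"] b h[of n] by simp
        then have "norm (x + h n *\<^sub>R b) > r" using False h[of n] by simp
        then show ?thesis using False z by (simp add: q_def)
      qed
    qed
  qed
  with int0 show ?thesis by (simp add: LIMSEQ_const_iff)
qed

lemma test_fieldI:
  assumes d: "\<And>x. (\<phi> has_derivative D x) (at x)"
    and c: "\<And>b. b \<in> Basis \<Longrightarrow> continuous_on UNIV (\<lambda>x. D x b)"
    and z: "\<And>x. norm x > r \<Longrightarrow> \<phi> x = 0" and n: "\<And>x. norm (\<phi> x) \<le> 1"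
  shows "\<phi> \<in> test_fields" and "divergence \<phi> x = (\<Sum>b\<in>Basis. D x b \<bullet> b)"
proof -
  have fd: "frechet_derivative \<phi> (at x) = D x" for x
    using frechet_derivative_at[OF d[of x]] by simp
  have "{x. \<phi> x \<noteq> 0} \<subseteq> cball 0 r" using z by (force simp: not_less[symmetric])
  then have "compact (closure {x. \<phi> x \<noteq> 0})"
    using bounded_subset[OF bounded_cball] by (simp add: compact_closure)
  then show "\<phi> \<in> test_fields"
    unfolding test_fields_def using d c n by (auto simp: fd differentiable_def)
  show "divergence \<phi> x = (\<Sum>b\<in>Basis. D x b \<bullet> b)" by (simp add: divergence_def fd)
qed

lemma test_fieldE:
  assumes "\<phi> \<in> test_fields"
  obtains D r M where "r > 0" "M > 0" "\<And>x. (\<phi> has_derivative D x) (at x)"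
    "\<And>b. b \<in> Basis \<Longrightarrow> continuous_on UNIV (\<lambda>x. D x b)"
    "\<And>x. norm x > r \<Longrightarrow> \<phi> x = 0" "\<And>x. norm (\<phi> x) \<le> 1"
    "divergence \<phi> = (\<lambda>x. \<Sum>b\<in>Basis. D x b \<bullet> b)"
    "continuous_on UNIV (divergence \<phi>)" "\<And>x. norm x > r \<Longrightarrow> divergence \<phi> x = 0"
    "\<And>x. norm (divergence \<phi> x) \<le> M" "continuous_on UNIV \<phi>"
proof -
  define D where "D x = frechet_derivative \<phi> (at x)" for x
  have d: "(\<phi> has_derivative D x) (at x)" for x
    using assms by (simp add: test_fields_def D_def flip: frechet_derivative_works)
  have c: "continuous_on UNIV (\<lambda>x. D x b)" if "b \<in> Basis" for b
    using assms that by (simp add: test_fields_def D_def)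
  have "bounded (closure {x. \<phi> x \<noteq> 0})" using assms by (simp add: test_fields_def compact_imp_bounded)
  then obtain r where r: "r > 0" "\<And>x. x \<in> closure {x. \<phi> x \<noteq> 0} \<Longrightarrow> norm x \<le> r"
    by (meson bounded_pos)
  have z: "\<phi> x = 0" if "norm x > r" for x
    using r(2)[of x] that closure_subset[of "{x. \<phi> x \<noteq> 0}"] by force
  have dv: "divergence \<phi> = (\<lambda>x. \<Sum>b\<in>Basis. D x b \<bullet> b)" by (simp add: fun_eq_iff divergence_def D_def)
  have dc: "continuous_on UNIV (divergence \<phi>)" unfolding dv by (intro continuous_intros c)
  have dz: "divergence \<phi> x = 0" if "norm x > r" for x
    using deriv_zero_outside[OF d z that] by (simp add: dv)
  obtain M where "M > 0" "\<And>x. norm (divergence \<phi> x) \<le> M" using compact_support_bounded[OF dc dz] by metis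
  moreover have "continuous_on UNIV \<phi>"
    using d has_derivative_continuous by (fastforce simp: continuous_on_eq_continuous_at)
  ultimately show ?thesis
    using that[of r M D] r(1) d c z dv dc dz assms by (auto simp: test_fields_def)
qed

lemma test_field_integrable:
  assumes "loc_integrable u" "\<phi> \<in> test_fields"
  shows "integrable lborel (\<lambda>x. u x * divergence \<phi> x)"
proof -
  obtain r M where *: "continuous_on UNIV (divergence \<phi>)" "\<And>x. norm x > r \<Longrightarrow> divergence \<phi> x = 0"
    "\<And>x. norm (divergence \<phi> x) \<le> M" by (rule test_fieldE[OF assms(2)]) blast
  show ?thesis
    using loc_integrable_mult(1)[OF assms(1) borel_measurable_continuous_onI[OF *(1)], of M 0 r] * by auto
qed

text \<open>For each \<open>b\<close> the product \<open>w x * (\<phi> x \<bullet> b)\<close>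
  inherits compact support from \<open>\<phi>\<close>, so the integral of its
  \<open>b\<close>-derivative vanishes whatever the growth of \<open>w\<close>. Summing over
  \<open>Basis\<close> gives the formula.\<close>

lemma integration_by_parts:
  fixes w :: "'a::euclidean_space \<Rightarrow> real"
  assumes w: "\<And>x. (w has_derivative (\<lambda>v. gw x \<bullet> v)) (at x)" and gw: "continuous_on UNIV gw"
    and \<phi>: "\<phi> \<in> test_fields"
  shows "(LINT x|lborel. w x * divergence \<phi> x) = - (LINT x|lborel. gw x \<bullet> \<phi> x)"
    and "integrable lborel (\<lambda>x. gw x \<bullet> \<phi> x)"
proof -
  obtain D r where D: "\<And>x. (\<phi> has_derivative D x) (at x)"
    "\<And>b. b \<in> Basis \<Longrightarrow> continuous_on UNIV (\<lambda>x. D x b)"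
    "\<And>x. norm x > r \<Longrightarrow> \<phi> x = 0" "divergence \<phi> = (\<lambda>x. \<Sum>b\<in>Basis. D x b \<bullet> b)"
    "continuous_on UNIV \<phi>" by (rule test_fieldE[OF \<phi>]) blast
  have wc: "continuous_on UNIV w"
    using w has_derivative_continuous by (fastforce simp: continuous_on_eq_continuous_at)
  define E where "E b x v = w x * (D x v \<bullet> b) + (gw x \<bullet> v) * (\<phi> x \<bullet> b)" for b x v
  have dE: "((\<lambda>x. w x * (\<phi> x \<bullet> b)) has_derivative E b x) (at x)" for b x
    unfolding E_def using w[of x] has_derivative_inner_left[OF D(1)[of x], of b]
    by (rule has_derivative_mult)
  have cont: "continuous_on UNIV (\<lambda>x. w x * (D x b \<bullet> b))" "continuous_on UNIV (\<lambda>x. (gw x \<bullet> b) * (\<phi> x \<bullet> b))"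
    if "b \<in> Basis" for b
    by (intro continuous_intros D(2)[OF that] wc gw D(5))+
  have zero: "D x b \<bullet> b = 0" "\<phi> x \<bullet> b = 0" if "norm x > r" for x b
    using deriv_zero_outside[OF D(1) D(3) that] D(3)[OF that] by auto
  have i1: "integrable lborel (\<lambda>x. w x * (D x b \<bullet> b))" if "b \<in> Basis" for b
    using cont(1)[OF that] zero by (intro integrable_continuous_compact_support[where r=r]) auto
  have i2: "integrable lborel (\<lambda>x. (gw x \<bullet> b) * (\<phi> x \<bullet> b))" if "b \<in> Basis" for b
    using cont(2)[OF that] zero by (intro integrable_continuous_compact_support[where r=r]) auto
  have "(LINT x|lborel. w x * (D x b \<bullet> b)) + (LINT x|lborel. (gw x \<bullet> b) * (\<phi> x \<bullet> b)) = 0" if "b \<in> Basis" for b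
  proof -
    have "(LINT x|lborel. E b x b) = 0"
    proof (rule integral_partial_zero[OF dE])
      show "continuous_on UNIV (\<lambda>x. E b x b)" unfolding E_def using cont[OF that] by (rule continuous_on_add)
    qed (use zero that in auto)
    then show ?thesis using i1[OF that] i2[OF that] by (simp add: E_def)
  qed
  then have "(\<Sum>b\<in>Basis. (LINT x|lborel. w x * (D x b \<bullet> b)) + (LINT x|lborel. (gw x \<bullet> b) * (\<phi> x \<bullet> b))) = 0"
    by simp
  then have "(\<Sum>b\<in>Basis. LINT x|lborel. w x * (D x b \<bullet> b)) + (\<Sum>b\<in>Basis. LINT x|lborel. (gw x \<bullet> b) * (\<phi> x \<bullet> b)) = 0"
    by (simp add: sum.distrib)
  moreover have "(\<Sum>b\<in>Basis. LINT x|lborel. w x * (D x b \<bullet> b)) = (LINT x|lborel. w x * divergence \<phi> x)"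
    using i1 by (simp add: D(4) sum_distrib_left)
  moreover have "(\<Sum>b\<in>Basis. LINT x|lborel. (gw x \<bullet> b) * (\<phi> x \<bullet> b)) = (LINT x|lborel. gw x \<bullet> \<phi> x)"
  proof -
    have "(\<Sum>b\<in>Basis. LINT x|lborel. (gw x \<bullet> b) * (\<phi> x \<bullet> b)) = (LINT x|lborel. (\<Sum>b\<in>Basis. (gw x \<bullet> b) * (\<phi> x \<bullet> b)))"
      using i2 by simp
    also have "\<dots> = (LINT x|lborel. gw x \<bullet> \<phi> x)"
      by (rule Bochner_Integration.integral_cong[OF refl]) (rule euclidean_inner[symmetric])
    finally show ?thesis .
  qed
  ultimately show "(LINT x|lborel. w x * divergence \<phi> x) = - (LINT x|lborel. gw x \<bullet> \<phi> x)" by simp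
  show "integrable lborel (\<lambda>x. gw x \<bullet> \<phi> x)"
    using D(3,5) gw by (intro integrable_continuous_compact_support[where r=r] continuous_intros) auto
qed

context mollifier
begin

lemma k_cont: "continuous_on UNIV k"
  using k_deriv has_derivative_continuous by (fastforce simp: continuous_on_eq_continuous_at)

lemma measurable_k [measurable]: "k \<in> borel_measurable borel" and measurable_g [measurable]: "g \<in> borel_measurable borel"
  using k_cont g_cont by (auto intro: borel_measurable_continuous_onI)

lemma integral_k_shift: "(LINT y|lborel. k (x - y)) = 1" "integrable lborel (\<lambda>y. k (x - y))"
  using lborel_integral_reflect[of k x] k_int k_one by auto

text \<open>Turns a merely continuous field into a test field: each component is a convolution with
  \<open>k\<close>, so the derivative falls on the kernel, and the norm bound survives because
  \<open>k\<close> is a probability density. The last claim controls how far the support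
  spreads.\<close>

lemma mollified_field:
  fixes \<Phi> :: "'a \<Rightarrow> 'a"
  assumes c: "continuous_on UNIV \<Phi>" and z: "\<And>x. norm x > r \<Longrightarrow> \<Phi> x = 0" and n: "\<And>x. norm (\<Phi> x) \<le> 1"
  defines "\<psi> \<equiv> \<lambda>x. LINT y|lborel. k (x - y) *\<^sub>R \<Phi> y"
  shows "\<psi> \<in> test_fields"
    and "divergence \<psi> x = (LINT y|lborel. \<Phi> y \<bullet> g (x - y))"
    and "(\<And>y. norm (x - y) \<le> e \<Longrightarrow> \<Phi> y = 0) \<Longrightarrow> \<psi> x = 0"
proof -
  have [measurable]: "\<Phi> \<in> borel_measurable borel" using c by (rule borel_measurable_continuous_onI)
  have int: "integrable lborel (\<lambda>y. k (x - y) *\<^sub>R \<Phi> y)" for x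
  proof (rule Bochner_Integration.integrable_bound[OF integral_k_shift(2)[of x]])
    show "AE y in lborel. norm (k (x - y) *\<^sub>R \<Phi> y) \<le> norm (k (x - y))"
      using n by (intro AE_I2) (simp add: mult_left_le)
  qed measurable
  have loc: "loc_integrable (\<lambda>y. \<Phi> y \<bullet> b)" if "b \<in> Basis" for b
    by (rule loc_integrable_bounded[of _ 1])
      (use n Basis_le_norm[OF that] in \<open>auto intro: order_trans\<close>)
  define G where "G b x = (LINT y|lborel. (\<Phi> y \<bullet> b) *\<^sub>R g (x - y))" for b x
  have comp: "\<psi> x \<bullet> b = conv k (\<lambda>y. \<Phi> y \<bullet> b) x" for x b
    unfolding \<psi>_def conv_def using int[of x] by (simp flip: integral_inner_left)
  have dcomp: "((\<lambda>x. \<psi> x \<bullet> b) has_derivative (\<lambda>v. G b x \<bullet> v)) (at x)" if "b \<in> Basis" for x b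
    unfolding comp G_def
    by (rule has_derivative_conv[OF loc[OF that] k_deriv g_cont k_zero g_zero])
  have d: "(\<psi> has_derivative (\<lambda>v. \<Sum>b\<in>Basis. (G b x \<bullet> v) *\<^sub>R b)) (at x)" for x
    using dcomp by (subst has_derivative_componentwise_within) (simp add: inner_sum_left inner_Basis if_distrib cong: if_cong)
  have Gc: "continuous_on UNIV (G b)" and Gi: "integrable lborel (\<lambda>y. (\<Phi> y \<bullet> b) *\<^sub>R g (x - y))"
    if "b \<in> Basis" for b x
    using continuous_conv[OF loc[OF that] g_cont g_zero] by (simp_all add: G_def[abs_def])
  have zr: "\<psi> x = 0" if "norm x > r + e" for x
  proof -
    have "k (x - y) *\<^sub>R \<Phi> y = 0" for y
    proof (cases "norm y > r")
      case False
      have "norm x \<le> norm (x - y) + norm y" using norm_triangle_ineq[of "x - y" y] by simp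
      then have "norm (x - y) > e" using False that by simp
      then show ?thesis by (simp add: k_zero)
    qed (simp add: z)
    then have "(\<lambda>y. k (x - y) *\<^sub>R \<Phi> y) = (\<lambda>_. 0)" by (simp only:)
    then show ?thesis by (simp add: \<psi>_def)
  qed
  have nn: "norm (\<psi> x) \<le> 1" for x
  proof -
    have "norm (\<psi> x) \<le> (LINT y|lborel. norm (k (x - y) *\<^sub>R \<Phi> y))"
      unfolding \<psi>_def by (rule integral_norm_bound)
    also have "\<dots> \<le> (LINT y|lborel. k (x - y))"
      using int[of x] integral_k_shift(2) n k_nonneg
      by (intro integral_mono integrable_norm) (simp_all add: mult_left_le)
    finally show ?thesis by (simp add: integral_k_shift)
  qed
  have cc: "continuous_on UNIV (\<lambda>x. \<Sum>b\<in>Basis. (G b x \<bullet> v) *\<^sub>R b)" for v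
    using Gc by (intro continuous_intros) auto
  show "\<psi> \<in> test_fields" by (rule test_fieldI(1)[OF d cc zr nn])
  have "divergence \<psi> x = (\<Sum>c\<in>Basis. (\<Sum>b\<in>Basis. (G b x \<bullet> c) *\<^sub>R b) \<bullet> c)"
    by (rule test_fieldI(2)[OF d cc zr nn])
  also have "\<dots> = (\<Sum>b\<in>Basis. G b x \<bullet> b)"
    by (simp add: inner_sum_left inner_Basis if_distrib cong: if_cong)
  also have "\<dots> = (\<Sum>b\<in>Basis. LINT y|lborel. (\<Phi> y \<bullet> b) * (g (x - y) \<bullet> b))"
    unfolding G_def using Gi by (simp flip: integral_inner_left)
  also have "\<dots> = (LINT y|lborel. (\<Sum>b\<in>Basis. (\<Phi> y \<bullet> b) * (g (x - y) \<bullet> b)))"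
    using Gi integrable_inner_left[of _ lborel] by (subst Bochner_Integration.integral_sum) (force simp flip: inner_scaleR_left)+
  also have "\<dots> = (LINT y|lborel. \<Phi> y \<bullet> g (x - y))"
    by (rule Bochner_Integration.integral_cong[OF refl]) (rule euclidean_inner[symmetric])
  finally show "divergence \<psi> x = (LINT y|lborel. \<Phi> y \<bullet> g (x - y))" .
  show "\<psi> x = 0" if "\<And>y. norm (x - y) \<le> e \<Longrightarrow> \<Phi> y = 0"
  proof -
    have "k (x - y) *\<^sub>R \<Phi> y = 0" for y
      using that[of y] k_zero[of "x - y"] by (cases "norm (x - y) \<le> e") auto
    then have "(\<lambda>y. k (x - y) *\<^sub>R \<Phi> y) = (\<lambda>_. 0)" by (simp only:)
    then show ?thesis by (simp add: \<psi>_def)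
  qed
qed

end

lemma loc_integrable_continuous:
  fixes f :: "'a::euclidean_space \<Rightarrow> real"
  assumes "continuous_on UNIV f" shows "loc_integrable f"
  unfolding loc_integrable_def set_integrable_def
  using assms by (auto intro!: borel_integrable_compact borel_measurable_continuous_onI
      intro: continuous_on_subset simp del: real_scaleR_def)

lemma loc_integrable_add: "loc_integrable u \<Longrightarrow> loc_integrable v \<Longrightarrow> loc_integrable (\<lambda>x. u x + v x)"
  by (auto simp: loc_integrable_def intro!: set_integral_add)

lemma loc_integrable_cmult: "loc_integrable u \<Longrightarrow> loc_integrable (\<lambda>x. c * u x)"
  by (auto simp: loc_integrable_def)

lemma loc_integrable_diff: "loc_integrable u \<Longrightarrow> loc_integrable v \<Longrightarrow> loc_integrable (\<lambda>x. u x - v x)"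
  by (auto simp: loc_integrable_def intro!: set_integral_diff)

lemma loc_integrable_bound:
  fixes u v :: "'a::euclidean_space \<Rightarrow> real"
  assumes "loc_integrable u" "v \<in> borel_measurable borel" "\<And>x. \<bar>v x\<bar> \<le> \<bar>u x\<bar>"
  shows "loc_integrable v"
  unfolding loc_integrable_def
proof (intro conjI allI impI)
  fix C :: "'a set" assume C: "compact C"
  then have [measurable]: "C \<in> sets borel" by (rule borel_compact)
  have [measurable]: "v \<in> borel_measurable borel" by fact
  show "set_integrable lborel C v"
  proof (rule set_integrable_bound)
    show "set_integrable lborel C u" using assms(1) C by (simp add: loc_integrable_def)
    show "set_borel_measurable lborel C v" unfolding set_borel_measurable_def by measurable
  qed (use assms(3) in auto)
qed (use assms(2) in simp)

lemma loc_integrable_abs: "loc_integrable u \<Longrightarrow> loc_integrable (\<lambda>x. \<bar>u x\<bar>)"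
  by (rule loc_integrable_bound) (auto dest: loc_integrable_measurable)

lemma loc_integrable_const: "loc_integrable (\<lambda>x. c)"
  by (rule loc_integrable_continuous) simp

text \<open>The two monotonicity conditions together say that \<open>\<phi>\<close> is increasing
  and 1-Lipschitz, hence \<open>\<bar>\<phi> s\<bar> \<le> \<bar>s\<bar> + \<bar>\<phi>
  0\<bar>\<close>.\<close>

lemma loc_integrable_compose:
  fixes \<phi> :: "real \<Rightarrow> real"
  assumes u: "loc_integrable u" and m: "mono \<phi>" "mono (\<lambda>s. s - \<phi> s)"
  shows "loc_integrable (\<lambda>x. \<phi> (u x))"
proof (rule loc_integrable_bound)
  show "loc_integrable (\<lambda>x. \<bar>u x\<bar> + \<bar>\<phi> 0\<bar>)"
    using u by (intro loc_integrable_add loc_integrable_abs loc_integrable_const)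
  have [measurable]: "\<phi> \<in> borel_measurable borel" using m(1) by (rule borel_measurable_mono)
  show "(\<lambda>x. \<phi> (u x)) \<in> borel_measurable borel"
    using loc_integrable_measurable[OF u] by measurable
  show "\<bar>\<phi> (u x)\<bar> \<le> \<bar>\<bar>u x\<bar> + \<bar>\<phi> 0\<bar>\<bar>" for x
    using monoD[OF m(1), of "u x" 0] monoD[OF m(1), of 0 "u x"] monoD[OF m(2), of "u x" 0] monoD[OF m(2), of 0 "u x"]
    by (cases "u x \<le> 0") auto
qed

text \<open>As \<open>k\<close> is a probability density, the error at \<open>x\<close> is at most
  the average of \<open>\<bar>f (x - z) - f x\<bar>\<close> over \<open>z\<close> with weight
  \<open>k z\<close>. Tonelli's theorem exchanges the integrals, and only shifts with
  \<open>norm z \<le> e\<close> carry weight.\<close>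

lemma (in mollifier) L1_conv_le:
  fixes f :: "'a \<Rightarrow> real"
  assumes f: "integrable lborel f" and T: "\<And>h. norm h \<le> e \<Longrightarrow> (LINT x|lborel. \<bar>f (x + h) - f x\<bar>) \<le> \<kappa>"
    and \<kappa>: "\<kappa> \<ge> 0"
  shows "(\<integral>\<^sup>+x. ennreal (\<bar>conv k f x - f x\<bar>) \<partial>lborel) \<le> ennreal \<kappa>"
proof -
  have [measurable]: "f \<in> borel_measurable borel" using f by (simp add: borel_measurable_integrable)
  have lf: "loc_integrable f"
    using f unfolding loc_integrable_def set_integrable_def
    by (auto intro!: integrable_mult_indicator simp: borel_compact simp del: real_scaleR_def)
  have i1: "integrable lborel (\<lambda>z. k z * f (x - z))" for x
  proof -
    have "integrable lborel (\<lambda>y. f y * k (x - y))"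
      using continuous_conv(2)[OF lf k_cont, where r=e and x=x] k_zero by simp
    then have "integrable lborel ((\<lambda>z. k z * f (x - z)) \<circ> (\<lambda>y. x - y))" by (simp add: o_def mult.commute)
    then show ?thesis using lborel_integral_reflect(2)[of "\<lambda>z. k z * f (x - z)" x] by (simp add: o_def)
  qed
  have conv: "conv k f x = (LINT z|lborel. k z * f (x - z))" for x
    using lborel_integral_reflect(1)[of "\<lambda>z. k z * f (x - z)" x] by (simp add: conv_def)
  have pt: "ennreal \<bar>conv k f x - f x\<bar> \<le> (\<integral>\<^sup>+z. ennreal (k z * \<bar>f (x - z) - f x\<bar>) \<partial>lborel)" for x
  proof -
    have "conv k f x - f x = (LINT z|lborel. k z * f (x - z) - k z * f x)"
      using i1[of x] k_int by (simp add: conv k_one)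
    then have "ennreal \<bar>conv k f x - f x\<bar> = ennreal (norm (LINT z|lborel. k z * f (x - z) - k z * f x))" by simp
    also have "\<dots> \<le> (\<integral>\<^sup>+z. ennreal (norm (k z * f (x - z) - k z * f x)) \<partial>lborel)"
      using i1[of x] k_int by (intro integral_norm_bound_ennreal) simp
    also have "\<dots> = (\<integral>\<^sup>+z. ennreal (k z * \<bar>f (x - z) - f x\<bar>) \<partial>lborel)"
      using k_nonneg by (simp add: abs_mult flip: right_diff_distrib)
    finally show ?thesis .
  qed
  have tr: "integrable lborel (\<lambda>x. f (x + h))" for h
    using f lborel_integral_translate(2)[of f h] by auto
  have "(\<integral>\<^sup>+x. ennreal (\<bar>conv k f x - f x\<bar>) \<partial>lborel)
      \<le> (\<integral>\<^sup>+x. (\<integral>\<^sup>+z. ennreal (k z * \<bar>f (x - z) - f x\<bar>) \<partial>lborel) \<partial>lborel)"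
    using pt by (intro nn_integral_mono) auto
  also have "\<dots> = (\<integral>\<^sup>+z. (\<integral>\<^sup>+x. ennreal (k z * \<bar>f (x - z) - f x\<bar>) \<partial>lborel) \<partial>lborel)"
    by (rule lborel_pair.Fubini'[symmetric]) measurable
  also have "\<dots> \<le> (\<integral>\<^sup>+z. ennreal (\<kappa> * k z) \<partial>lborel)"
  proof (rule nn_integral_mono)
    fix z
    show "(\<integral>\<^sup>+x. ennreal (k z * \<bar>f (x - z) - f x\<bar>) \<partial>lborel) \<le> ennreal (\<kappa> * k z)"
    proof (cases "norm z \<le> e")
      case True
      have "(\<integral>\<^sup>+x. ennreal (k z * \<bar>f (x - z) - f x\<bar>) \<partial>lborel) = ennreal (LINT x|lborel. k z * \<bar>f (x - z) - f x\<bar>)"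
        using f tr[of "- z"] k_nonneg by (intro nn_integral_eq_integral) auto
      also have "(LINT x|lborel. k z * \<bar>f (x - z) - f x\<bar>) = k z * (LINT x|lborel. \<bar>f (x - z) - f x\<bar>)" by simp
      also have "\<dots> \<le> \<kappa> * k z"
        using mult_left_mono[OF T[of "- z"] k_nonneg[of z]] True by (simp add: mult.commute)
      finally show ?thesis by (simp add: ennreal_leI)
    qed (simp add: k_zero)
  qed
  also have "\<dots> = ennreal (LINT z|lborel. \<kappa> * k z)"
    using k_int k_nonneg \<kappa> by (intro nn_integral_eq_integral) auto
  also have "\<dots> = ennreal \<kappa>" using k_one by simp
  finally show ?thesis .
qed

text \<open>On \<open>cball 0 r\<close> a kernel of radius at most 1 sees only the values of
  \<open>u\<close> on \<open>cball 0 (r + 1)\<close>, so \<open>u\<close> may be cut to an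
  integrable function. The threshold \<open>e0\<close> is uniform over all mollifiers, which leaves
  room to shrink \<open>e\<close> further for another purpose.\<close>

lemma L1_loc_mollify:
  fixes u :: "'a::euclidean_space \<Rightarrow> real"
  assumes u: "loc_integrable u" and \<kappa>: "\<kappa> > 0"
  shows "\<exists>e0>0. \<forall>e k g. mollifier e k g \<longrightarrow> e \<le> e0 \<longrightarrow> (LINT x:cball 0 r|lborel. \<bar>conv k u x - u x\<bar>) \<le> \<kappa>"
proof -
  define f where "f x = indicator (cball 0 (r + 1)) x * u x" for x
  have f: "integrable lborel f"
    using loc_integrable_cball[OF u, of 0 "r + 1"] by (simp add: f_def[abs_def] set_integrable_def)
  obtain d where d: "d > 0" "\<And>h. norm h < d \<Longrightarrow> (LINT x|lborel. \<bar>f (x + h) - f x\<bar>) < \<kappa>"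
    using L1_translation[OF f] \<kappa> by blast
  show ?thesis
  proof (intro exI[of _ "min 1 (d / 2)"] conjI allI impI)
    show "0 < min 1 (d / 2)" using d(1) by simp
    fix e and k :: "'a \<Rightarrow> real" and g assume m: "mollifier e k g" and e: "e \<le> min 1 (d / 2)"
    interpret mollifier e k g by (rule m)
    have eq: "conv k u x = conv k f x" "u x = f x" if "x \<in> cball 0 r" for x :: 'a
    proof -
      show "u x = f x" using that by (simp add: f_def)
      have "k (x - y) * u y = k (x - y) * f y" for y
      proof (cases "norm y \<le> r + 1")
        case False
        have "norm y \<le> norm x + norm (x - y)" using norm_triangle_ineq4[of x "x - y"] by simp
        then have "norm (x - y) > e" using False that e by auto
        then show ?thesis by (simp add: k_zero)
      qed (simp add: f_def)
      then have "(\<lambda>y. k (x - y) * u y) = (\<lambda>y. k (x - y) * f y)" by (simp only:)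
      then show "conv k u x = conv k f x" by (simp add: conv_def)
    qed
    have "(\<integral>\<^sup>+x. ennreal (indicator (cball 0 r) x * \<bar>conv k u x - u x\<bar>) \<partial>lborel)
        \<le> (\<integral>\<^sup>+x. ennreal \<bar>conv k f x - f x\<bar> \<partial>lborel)"
      using eq by (intro nn_integral_mono) (auto simp: indicator_def)
    also have "\<dots> \<le> ennreal \<kappa>"
    proof (rule L1_conv_le[OF f])
      fix h :: 'a assume "norm h \<le> e"
      then have "norm h < d" using e d(1) by auto
      then show "(LINT x|lborel. \<bar>f (x + h) - f x\<bar>) \<le> \<kappa>" using d(2) by (simp add: less_imp_le)
    qed (use \<kappa> in auto)
    finally show "(LINT x:cball 0 r|lborel. \<bar>conv k u x - u x\<bar>) \<le> \<kappa>"
      unfolding set_lebesgue_integral_def using \<kappa> by (intro integral_real_bounded) auto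
  qed
qed

subsection \<open>Variation outside a ball\<close>

text \<open>The strict inequality \<open>r > R\<close> leaves room for mollifying a field. For \<open>R = -1\<close> there is no
  condition on the field, since \<open>ball 0 0\<close> is empty.\<close>

definition fields_outside :: "real \<Rightarrow> ('a::euclidean_space \<Rightarrow> 'a) set" where
  "fields_outside R = {\<phi>\<in>test_fields. \<exists>r>R. \<forall>x\<in>ball 0 r. \<phi> x = 0}"

definition var_outside :: "real \<Rightarrow> ('a::euclidean_space \<Rightarrow> real) \<Rightarrow> ereal" where
  "var_outside R u = (SUP \<phi>\<in>fields_outside R. ereal (LINT x|lborel. u x * divergence \<phi> x))"

lemma bv_seminorm_eq: "bv_seminorm u = var_outside (-1) u"
proof -
  have "fields_outside (-1) = (test_fields :: ('a \<Rightarrow> 'a) set)"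
    unfolding fields_outside_def by (auto intro!: exI[of _ 0])
  then show ?thesis by (simp add: bv_seminorm_def var_outside_def)
qed

lemma fields_outside_test: "\<phi> \<in> fields_outside R \<Longrightarrow> \<phi> \<in> test_fields"
  by (simp add: fields_outside_def)

lemma zero_field:
  "(\<lambda>x::'a::euclidean_space. 0) \<in> fields_outside R" "divergence (\<lambda>x::'a::euclidean_space. 0) = (\<lambda>x. 0)"
proof -
  have "(\<lambda>x::'a. 0::'a) \<in> test_fields"
    by (rule test_fieldI(1)[where D="\<lambda>x v. 0" and r=0]) auto
  then show "(\<lambda>x::'a. 0) \<in> fields_outside R" by (auto simp: fields_outside_def intro: exI[of _ "R + 1"])
  show "divergence (\<lambda>x::'a. 0) = (\<lambda>x. 0)"
    by (simp add: divergence_def fun_eq_iff)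
qed

lemma var_outside_nonneg: "0 \<le> var_outside R u"
  unfolding var_outside_def by (rule SUP_upper2[OF zero_field(1)]) (simp add: zero_field(2) zero_ereal_def)

lemma var_outside_upper:
  "\<phi> \<in> fields_outside R \<Longrightarrow> ereal (LINT x|lborel. u x * divergence \<phi> x) \<le> var_outside R u"
  unfolding var_outside_def by (rule SUP_upper)

lemma var_outside_leI:
  "(\<And>\<phi>. \<phi> \<in> fields_outside R \<Longrightarrow> ereal (LINT x|lborel. u x * divergence \<phi> x) \<le> c) \<Longrightarrow> var_outside R u \<le> c"
  unfolding var_outside_def by (rule SUP_least)

lemma var_outside_antimono: "R \<le> R' \<Longrightarrow> var_outside R' u \<le> var_outside R u"
  unfolding var_outside_def by (rule SUP_subset_mono) (auto simp: fields_outside_def dest: le_less_trans)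

lemma var_outside_add:
  assumes "loc_integrable u" "loc_integrable v"
  shows "var_outside R (\<lambda>x. u x + v x) \<le> var_outside R u + var_outside R v"
proof (rule var_outside_leI)
  fix \<phi> :: "'a \<Rightarrow> 'a" assume \<phi>: "\<phi> \<in> fields_outside R"
  have "(LINT x|lborel. (u x + v x) * divergence \<phi> x)
      = (LINT x|lborel. u x * divergence \<phi> x) + (LINT x|lborel. v x * divergence \<phi> x)"
    using test_field_integrable[OF _ fields_outside_test[OF \<phi>]] assms by (simp add: distrib_right)
  then show "ereal (LINT x|lborel. (u x + v x) * divergence \<phi> x) \<le> var_outside R u + var_outside R v"
    using add_mono[OF var_outside_upper[OF \<phi>, of u] var_outside_upper[OF \<phi>, of v]] by simp
qed

lemma uminus_field:
  assumes "\<phi> \<in> fields_outside R"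
  shows "(\<lambda>x. - \<phi> x) \<in> fields_outside R" "divergence (\<lambda>x. - \<phi> x) x = - divergence \<phi> x"
proof -
  obtain D r where D: "\<And>x. (\<phi> has_derivative D x) (at x)"
    "\<And>b. b \<in> Basis \<Longrightarrow> continuous_on UNIV (\<lambda>x. D x b)" "\<And>x. norm x > r \<Longrightarrow> \<phi> x = 0"
    "\<And>x. norm (\<phi> x) \<le> 1" "divergence \<phi> = (\<lambda>x. \<Sum>b\<in>Basis. D x b \<bullet> b)"
    by (rule test_fieldE[OF fields_outside_test[OF assms]]) blast
  have *: "((\<lambda>x. - \<phi> x) has_derivative (\<lambda>v. - D x v)) (at x)" for x
    using D(1) by (rule has_derivative_minus)
  have **: "continuous_on UNIV (\<lambda>x. - D x b)" if "b \<in> Basis" for b using D(2)[OF that] by (rule continuous_on_minus)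
  have "(\<lambda>x. - \<phi> x) \<in> test_fields"
    using D by (intro test_fieldI(1)[OF * **, of r]) auto
  then show "(\<lambda>x. - \<phi> x) \<in> fields_outside R" using assms by (auto simp: fields_outside_def)
  have "divergence (\<lambda>x. - \<phi> x) x = (\<Sum>b\<in>Basis. - D x b \<bullet> b)"
    using D by (intro test_fieldI(2)[OF * **, of r]) auto
  then show "divergence (\<lambda>x. - \<phi> x) x = - divergence \<phi> x" by (simp add: D(5) sum_negf)
qed

lemma var_outside_uminus: "var_outside R (\<lambda>x. - u x) \<le> var_outside R u"
proof (rule var_outside_leI)
  fix \<phi> :: "'a \<Rightarrow> 'a" assume \<phi>: "\<phi> \<in> fields_outside R"
  from var_outside_upper[OF uminus_field(1)[OF this], of u]
  show "ereal (LINT x|lborel. - u x * divergence \<phi> x) \<le> var_outside R u"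
    by (simp add: uminus_field(2)[OF \<phi>])
qed

lemma var_outside_cmult_nonneg:
  assumes "c \<ge> 0" shows "var_outside R (\<lambda>x. c * u x) \<le> ereal c * var_outside R u"
proof (rule var_outside_leI)
  fix \<phi> :: "'a \<Rightarrow> 'a" assume \<phi>: "\<phi> \<in> fields_outside R"
  from ereal_mult_left_mono[OF var_outside_upper[OF \<phi>, of u], of "ereal c"] assms
  show "ereal (LINT x|lborel. c * u x * divergence \<phi> x) \<le> ereal c * var_outside R u"
    by (simp add: mult.assoc)
qed

text \<open>A field sees \<open>u\<close> only on a ball and with bounded weight, so closeness in
  L^1 there suffices. The approximant may depend on \<open>\<kappa>\<close> and \<open>r\<close>,
  which suits indices that are found only infinitely often.\<close>

lemma var_outside_lsc:
  assumes u: "loc_integrable u"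
    and v: "\<And>\<kappa> r. \<kappa> > 0 \<Longrightarrow> \<exists>v. loc_integrable v \<and> var_outside R v \<le> ereal c \<and> (LINT x:cball 0 r|lborel. \<bar>v x - u x\<bar>) \<le> \<kappa>"
  shows "var_outside R u \<le> ereal c"
proof (rule var_outside_leI)
  fix \<phi> :: "'a \<Rightarrow> 'a" assume \<phi>: "\<phi> \<in> fields_outside R"
  obtain r M where D: "M > 0" "continuous_on UNIV (divergence \<phi>)" "\<And>x. norm x > r \<Longrightarrow> divergence \<phi> x = 0"
    "\<And>x. norm (divergence \<phi> x) \<le> M"
    by (rule test_fieldE[OF fields_outside_test[OF \<phi>]]) blast
  have "(LINT x|lborel. u x * divergence \<phi> x) \<le> c + \<epsilon>" if \<epsilon>: "\<epsilon> > 0" for \<epsilon>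
  proof -
    obtain v where v: "loc_integrable v" "var_outside R v \<le> ereal c" "(LINT x:cball 0 r|lborel. \<bar>v x - u x\<bar>) \<le> \<epsilon> / M"
      using v[of "\<epsilon> / M" r] \<epsilon> D(1) by auto
    have "norm (LINT x|lborel. (v x - u x) * divergence \<phi> x) \<le> M * (LINT x:cball 0 r|lborel. \<bar>v x - u x\<bar>)"
      using D by (intro loc_integrable_mult(2) loc_integrable_diff v u borel_measurable_continuous_onI) auto
    also have "\<dots> \<le> \<epsilon>" using v(3) D(1) by (simp add: field_simps)
    finally have "\<bar>LINT x|lborel. (v x - u x) * divergence \<phi> x\<bar> \<le> \<epsilon>" by simp
    moreover have "(LINT x|lborel. (v x - u x) * divergence \<phi> x)
        = (LINT x|lborel. v x * divergence \<phi> x) - (LINT x|lborel. u x * divergence \<phi> x)"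
      using test_field_integrable[OF _ fields_outside_test[OF \<phi>]] u v(1) by (simp add: left_diff_distrib)
    moreover have "(LINT x|lborel. v x * divergence \<phi> x) \<le> c"
      using order_trans[OF var_outside_upper[OF \<phi>] v(2)] by simp
    ultimately show ?thesis by linarith
  qed
  then show "ereal (LINT x|lborel. u x * divergence \<phi> x) \<le> ereal c"
    by (simp add: field_le_epsilon)
qed

subsection \<open>Splitting the variation by monotone functions\<close>

context mollifier
begin

text \<open>Moves the mollification from \<open>u\<close> to the field: after Fubini and the oddness
  of \<open>g\<close>, the inner integral on the right is the divergence of the mollified
  \<open>\<Phi>\<close>. The compact supports of \<open>\<Phi>\<close> and \<open>g\<close> confine
  the double integral to a bounded region, where \<open>u\<close> is integrable.\<close>

lemma gradient_conv_pairing: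
  fixes u :: "'a \<Rightarrow> real" and \<Phi> :: "'a \<Rightarrow> 'a"
  assumes u: "loc_integrable u" and c: "continuous_on UNIV \<Phi>" and z: "\<And>x. norm x > r \<Longrightarrow> \<Phi> x = 0"
    and n: "\<And>x. norm (\<Phi> x) \<le> 1"
  shows "(LINT x|lborel. (LINT y|lborel. u y *\<^sub>R g (x - y)) \<bullet> \<Phi> x)
       = - (LINT y|lborel. u y * (LINT x|lborel. \<Phi> x \<bullet> g (y - x)))"
proof -
  have [measurable]: "\<Phi> \<in> borel_measurable borel" using c by (rule borel_measurable_continuous_onI)
  have [measurable]: "u \<in> borel_measurable borel" using u by (rule loc_integrable_measurable)
  obtain M where M: "M > 0" "\<And>x. norm (g x) \<le> M" using compact_support_bounded[OF g_cont g_zero] by metis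
  define F where "F x y = u y * (g (x - y) \<bullet> \<Phi> x)" for x y
  define w where "w y = indicator (cball 0 (r + e)) y * \<bar>u y\<bar>" for y
  have wi: "integrable lborel w"
    using set_integrable_abs[OF loc_integrable_cball[OF u, of 0 "r + e"]]
    by (simp add: w_def[abs_def] set_integrable_def)
  have Fb: "norm (F x y) \<le> indicator (cball 0 r) x * (M * w y)" for x y
  proof (cases "norm x \<le> r \<and> norm (x - y) \<le> e")
    case True
    have "norm y \<le> norm x + norm (x - y)" using norm_triangle_ineq4[of x "x - y"] by simp
    then have "norm y \<le> r + e" using True by simp
    moreover have "\<bar>g (x - y) \<bullet> \<Phi> x\<bar> \<le> M * 1"
      using Cauchy_Schwarz_ineq2[of "g (x - y)" "\<Phi> x"] mult_mono[OF M(2)[of "x - y"] n[of x]] M(1) by force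
    from mult_left_mono[OF this abs_ge_zero[of "u y"]] have "norm (F x y) \<le> M * \<bar>u y\<bar>"
      by (simp add: F_def abs_mult mult.commute)
    ultimately show ?thesis using True by (simp add: w_def)
  next
    case False
    then have "F x y = 0" using z[of x] g_zero[of "x - y"] by (force simp: F_def)
    then show ?thesis using M(1) by (simp add: w_def)
  qed
  have Fm[measurable]: "case_prod F \<in> borel_measurable (lborel \<Otimes>\<^sub>M lborel)"
    unfolding F_def by measurable
  have Fi: "integrable lborel (F x)" for x
  proof (rule Bochner_Integration.integrable_bound)
    show "integrable lborel (\<lambda>y. indicator (cball 0 r) x * (M * w y))" using wi by simp
    show "AE y in lborel. norm (F x y) \<le> norm (indicator (cball 0 r) x * (M * w y))"
      using Fb[of x] by (intro AE_I2) (smt (verit) real_norm_def)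
  qed (simp add: F_def)
  have int: "integrable (lborel \<Otimes>\<^sub>M lborel) (case_prod F)"
  proof (rule lborel_pair.Fubini_integrable[OF Fm])
    show "AE x in lborel. integrable lborel (\<lambda>y. case_prod F (x, y))" using Fi by simp
    show "integrable lborel (\<lambda>x. LINT y|lborel. norm (case_prod F (x, y)))"
    proof (rule Bochner_Integration.integrable_bound)
      show "integrable lborel (\<lambda>x. indicator (cball (0::'a) r) x * (M * (LINT y|lborel. w y)))"
        using integrable_indicator_compact[of "cball (0::'a) r"] by simp
      show "AE x in lborel. norm (LINT y|lborel. norm (case_prod F (x, y)))
          \<le> norm (indicator (cball 0 r) x * (M * (LINT y|lborel. w y)))"
      proof (rule AE_I2)
        fix x
        have "(LINT y|lborel. norm (F x y)) \<le> (LINT y|lborel. indicator (cball 0 r) x * (M * w y))"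
          using Fb wi Fi by (intro integral_mono integrable_norm) auto
        also have "\<dots> = indicator (cball 0 r) x * (M * (LINT y|lborel. w y))" by simp
        finally show "norm (LINT y|lborel. norm (case_prod F (x, y)))
            \<le> norm (indicator (cball 0 r) x * (M * (LINT y|lborel. w y)))" by simp
      qed
      show "(\<lambda>x. LINT y|lborel. norm (case_prod F (x, y))) \<in> borel_measurable lborel" by measurable
    qed
  qed
  have "(LINT x|lborel. (LINT y|lborel. u y *\<^sub>R g (x - y)) \<bullet> \<Phi> x) = (LINT x|lborel. (LINT y|lborel. F x y))"
    using continuous_conv(2)[OF u g_cont, where r=e] g_zero by (simp add: F_def flip: integral_inner_left)
  also have "\<dots> = (LINT y|lborel. (LINT x|lborel. F x y))"
    by (rule lborel_pair.Fubini_integral[OF int, symmetric])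
  also have "\<dots> = (LINT y|lborel. - (u y * (LINT x|lborel. \<Phi> x \<bullet> g (y - x))))"
  proof (rule Bochner_Integration.integral_cong[OF refl])
    fix y
    have "F x y = - u y * (\<Phi> x \<bullet> g (y - x))" for x
      using g_odd[of "y - x"] by (simp add: F_def inner_commute)
    then show "(LINT x|lborel. F x y) = - (u y * (LINT x|lborel. \<Phi> x \<bullet> g (y - x)))" by simp
  qed
  finally show ?thesis by simp
qed

text \<open>By the chain rule the gradients of \<open>\<alpha> (conv k u x)\<close> and of the
  remainder are the fractions \<open>\<alpha>'\<close> and \<open>1 - \<alpha>'\<close> of one
  gradient, so the two tests merge into a single test of \<open>u\<close>. Mollification spreads
  supports by \<open>e\<close>; the condition \<open>e < r - R\<close> keeps the merged field zero
  on a ball of radius larger than \<open>R\<close>.\<close>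

lemma var_outside_superadditive_smooth:
  fixes u :: "'a \<Rightarrow> real" and \<alpha> :: "real \<Rightarrow> real"
  assumes u: "loc_integrable u"
    and \<alpha>: "\<And>s. (\<alpha> has_real_derivative \<alpha>' s) (at s)" "continuous_on UNIV \<alpha>'" "\<And>s. 0 \<le> \<alpha>' s" "\<And>s. \<alpha>' s \<le> 1"
    and \<phi>: "\<phi>1 \<in> test_fields" "\<phi>2 \<in> test_fields" "\<And>x. x \<in> ball 0 r \<Longrightarrow> \<phi>1 x = 0" "\<And>x. x \<in> ball 0 r \<Longrightarrow> \<phi>2 x = 0"
    and e: "e < r - R"
  shows "ereal ((LINT x|lborel. \<alpha> (conv k u x) * divergence \<phi>1 x)
       + (LINT x|lborel. (conv k u x - \<alpha> (conv k u x)) * divergence \<phi>2 x)) \<le> var_outside R u"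
proof -
  let ?v = "conv k u"
  define G where "G x = (LINT y|lborel. u y *\<^sub>R g (x - y))" for x
  have Gc: "continuous_on UNIV G" unfolding G_def using continuous_conv(1)[OF u g_cont, where r=e] g_zero by blast
  have v: "(?v has_derivative (\<lambda>h. G x \<bullet> h)) (at x)" for x
    unfolding G_def by (rule has_derivative_conv[OF u k_deriv g_cont k_zero g_zero])
  have vc: "continuous_on UNIV ?v"
    using v has_derivative_continuous by (fastforce simp: continuous_on_eq_continuous_at)
  have av: "((\<lambda>x. \<alpha> (?v x)) has_derivative (\<lambda>h. (\<alpha>' (?v x) *\<^sub>R G x) \<bullet> h)) (at x)" for x
    using has_derivative_compose[OF v[of x], of \<alpha> "(*) (\<alpha>' (?v x))"] \<alpha>(1)
    by (simp add: has_field_derivative_def)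
  have bv: "((\<lambda>x. ?v x - \<alpha> (?v x)) has_derivative (\<lambda>h. ((1 - \<alpha>' (?v x)) *\<^sub>R G x) \<bullet> h)) (at x)" for x
    using has_derivative_diff[OF v av, of x] by (simp add: algebra_simps)
  have ac: "continuous_on UNIV (\<lambda>x. \<alpha>' (?v x))"
    using continuous_on_compose2[OF \<alpha>(2) vc] by simp
  \<comment> \<open>A convex combination of \<open>\<phi>1\<close> and \<open>\<phi>2\<close>; its mollification tests \<open>u\<close> itself.\<close>
  define \<Phi> where "\<Phi> x = \<alpha>' (?v x) *\<^sub>R \<phi>1 x + (1 - \<alpha>' (?v x)) *\<^sub>R \<phi>2 x" for x
  obtain r1 where r1: "continuous_on UNIV \<phi>1" "\<And>x. norm x > r1 \<Longrightarrow> \<phi>1 x = 0" "\<And>x. norm (\<phi>1 x) \<le> 1"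
    by (rule test_fieldE[OF \<phi>(1)]) blast
  obtain r2 where r2: "continuous_on UNIV \<phi>2" "\<And>x. norm x > r2 \<Longrightarrow> \<phi>2 x = 0" "\<And>x. norm (\<phi>2 x) \<le> 1"
    by (rule test_fieldE[OF \<phi>(2)]) blast
  have \<Phi>c: "continuous_on UNIV \<Phi>" unfolding \<Phi>_def by (intro continuous_intros ac r1 r2)
  have \<Phi>z: "\<Phi> x = 0" if "norm x > max r1 r2" for x using that r1(2) r2(2) by (simp add: \<Phi>_def)
  have \<Phi>n: "norm (\<Phi> x) \<le> 1" for x
  proof -
    let ?a = "\<alpha>' (?v x)"
    have "norm (\<Phi> x) \<le> \<bar>?a\<bar> * norm (\<phi>1 x) + \<bar>1 - ?a\<bar> * norm (\<phi>2 x)"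
      unfolding \<Phi>_def by (rule norm_triangle_le) simp
    also have "\<dots> \<le> ?a * 1 + (1 - ?a) * 1"
      using \<alpha>(3,4)[of "?v x"] r1(3)[of x] r2(3)[of x] by (intro add_mono mult_mono) auto
    finally show ?thesis by simp
  qed
  define \<psi> where "\<psi> x = (LINT y|lborel. k (x - y) *\<^sub>R \<Phi> y)" for x
  have \<psi>t: "\<psi> \<in> test_fields" unfolding \<psi>_def by (rule mollified_field(1)[OF \<Phi>c \<Phi>z \<Phi>n])
  have \<psi>d: "divergence \<psi> x = (LINT y|lborel. \<Phi> y \<bullet> g (x - y))" for x
    unfolding \<psi>_def by (rule mollified_field(2)[OF \<Phi>c \<Phi>z \<Phi>n])
  have \<psi>z: "\<psi> x = 0" if "x \<in> ball 0 (r - e)" for x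
    unfolding \<psi>_def
  proof (rule mollified_field(3)[OF \<Phi>c \<Phi>z \<Phi>n])
    fix y assume "norm (x - y) \<le> e"
    then have "norm y < r" using that norm_triangle_ineq4[of x "x - y"] by simp
    then show "\<Phi> y = 0" using \<phi>(3)[of y] \<phi>(4)[of y] by (simp add: \<Phi>_def)
  qed
  have \<psi>f: "\<psi> \<in> fields_outside R"
    using \<psi>t \<psi>z e by (auto simp: fields_outside_def intro!: exI[of _ "r - e"])
  have c1: "continuous_on UNIV (\<lambda>x. \<alpha>' (?v x) *\<^sub>R G x)" and c2: "continuous_on UNIV (\<lambda>x. (1 - \<alpha>' (?v x)) *\<^sub>R G x)"
    by (intro continuous_intros ac Gc)+
  note p1 = integration_by_parts[OF av c1 \<phi>(1)]
  note p2 = integration_by_parts[OF bv c2 \<phi>(2)]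
  have "(LINT x|lborel. \<alpha> (?v x) * divergence \<phi>1 x) + (LINT x|lborel. (?v x - \<alpha> (?v x)) * divergence \<phi>2 x)
      = - (LINT x|lborel. (\<alpha>' (?v x) *\<^sub>R G x) \<bullet> \<phi>1 x + ((1 - \<alpha>' (?v x)) *\<^sub>R G x) \<bullet> \<phi>2 x)"
    using p1 p2 by (subst Bochner_Integration.integral_add) simp_all
  also have "\<dots> = - (LINT x|lborel. G x \<bullet> \<Phi> x)"
    by (simp add: \<Phi>_def inner_add_right)
  also have "\<dots> = (LINT y|lborel. u y * divergence \<psi> y)"
    unfolding G_def \<psi>d by (subst gradient_conv_pairing[OF u \<Phi>c, of "max r1 r2"]) (use \<Phi>z \<Phi>n in simp_all)
  finally show ?thesis using var_outside_upper[OF \<psi>f, of u] by simp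
qed

end

text \<open>\<open>\<alpha>\<close> is the mean of \<open>\<phi>\<close> over the interval from
  \<open>s\<close> to \<open>s + \<kappa>\<close>, expressed by a primitive \<open>P\<close>. Its
  derivative is a difference quotient of \<open>\<phi>\<close>, which lies in [0,1] because
  \<open>\<phi>\<close> is increasing and 1-Lipschitz.\<close>

lemma smooth_approx_monotone:
  fixes \<phi> :: "real \<Rightarrow> real"
  assumes m: "mono \<phi>" "mono (\<lambda>s. s - \<phi> s)" and \<kappa>: "\<kappa> > 0"
  obtains \<alpha> \<alpha>' where "\<And>s. (\<alpha> has_real_derivative \<alpha>' s) (at s)" "continuous_on UNIV \<alpha>'"
    "\<And>s. 0 \<le> \<alpha>' s" "\<And>s. \<alpha>' s \<le> 1" "\<And>s. \<bar>\<alpha> s - \<phi> s\<bar> \<le> \<kappa>"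
proof -
  have lip: "0 \<le> \<phi> t - \<phi> s" "\<phi> t - \<phi> s \<le> t - s" if "s \<le> t" for s t
    using monoD[OF m(1) that] monoD[OF m(2) that] by auto
  have "\<bar>\<phi> t - \<phi> s\<bar> \<le> \<bar>t - s\<bar>" for s t
    using lip[of s t] lip[of t s] by (cases "s \<le> t") auto
  then have cont: "continuous_on UNIV \<phi>"
    unfolding continuous_on_iff dist_real_def by (metis le_less_trans)
  have "\<exists>P. \<forall>x::real. - \<infinity> < ereal x \<longrightarrow> ereal x < \<infinity> \<longrightarrow> (P has_vector_derivative \<phi> x) (at x)"
    using cont by (intro einterval_antiderivative) (auto simp: continuous_on_eq_continuous_at)
  then obtain P where P: "\<And>x. (P has_real_derivative \<phi> x) (at x)"
    by (auto simp: has_real_derivative_iff_has_vector_derivative)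
  define \<alpha> where "\<alpha> s = (P (s + \<kappa>) - P s) / \<kappa>" for s
  define \<alpha>' where "\<alpha>' s = (\<phi> (s + \<kappa>) - \<phi> s) / \<kappa>" for s
  show ?thesis
  proof (rule that[of \<alpha> \<alpha>'])
    show "(\<alpha> has_real_derivative \<alpha>' s) (at s)" for s
    proof -
      have "((\<lambda>s. P (s + \<kappa>)) has_real_derivative \<phi> (s + \<kappa>)) (at s)"
        using P[of "s + \<kappa>"] by (simp add: DERIV_shift)
      from DERIV_cdivide[OF DERIV_diff[OF this P[of s]], of \<kappa>] show ?thesis
        by (simp add: \<alpha>_def[abs_def] \<alpha>'_def)
    qed
    show "continuous_on UNIV \<alpha>'"
      unfolding \<alpha>'_def using cont \<kappa> by (intro continuous_intros continuous_on_compose2[OF cont]) auto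
    show "0 \<le> \<alpha>' s" "\<alpha>' s \<le> 1" for s
      using lip[of s "s + \<kappa>"] \<kappa> by (auto simp: \<alpha>'_def)
    show "\<bar>\<alpha> s - \<phi> s\<bar> \<le> \<kappa>" for s
    proof -
      obtain z where z: "s < z" "z < s + \<kappa>" "P (s + \<kappa>) - P s = (s + \<kappa> - s) * \<phi> z"
        using MVT2[of s "s + \<kappa>" P \<phi>] P \<kappa> by auto
      then have "\<alpha> s = \<phi> z" using \<kappa> by (simp add: \<alpha>_def)
      then show ?thesis using lip[of s z] z by auto
    qed
  qed
qed

text \<open>Together with \<open>var_outside_add\<close> this is an equality: splitting along the
  values of \<open>u\<close> neither loses nor creates variation. For a given pair of fields,
  \<open>u\<close> is replaced by a mollification and \<open>\<phi>\<close> by a C^1 function, both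
  close enough on the ball that carries the fields.\<close>

lemma var_outside_superadditive:
  fixes u :: "'a::euclidean_space \<Rightarrow> real" and \<phi> :: "real \<Rightarrow> real"
  assumes u: "loc_integrable u" and m: "mono \<phi>" "mono (\<lambda>s. s - \<phi> s)"
  shows "var_outside R (\<lambda>x. \<phi> (u x)) + var_outside R (\<lambda>x. u x - \<phi> (u x)) \<le> var_outside R u"
proof (cases "var_outside R u")
  case (real V)
  have lip: "\<bar>\<phi> t - \<phi> s\<bar> \<le> \<bar>t - s\<bar>" "\<bar>(t - \<phi> t) - (s - \<phi> s)\<bar> \<le> \<bar>t - s\<bar>" for s t
    using monoD[OF m(1), of s t] monoD[OF m(2), of s t] monoD[OF m(1), of t s] monoD[OF m(2), of t s]
    by (cases "s \<le> t"; auto)+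
  have l1: "loc_integrable (\<lambda>x. \<phi> (u x))" by (rule loc_integrable_compose[OF u m])
  have l2: "loc_integrable (\<lambda>x. u x - \<phi> (u x))" by (rule loc_integrable_diff[OF u l1])
  have key: "(LINT x|lborel. \<phi> (u x) * divergence \<phi>1 x) + (LINT x|lborel. (u x - \<phi> (u x)) * divergence \<phi>2 x) \<le> V"
    if f: "\<phi>1 \<in> fields_outside R" "\<phi>2 \<in> fields_outside R" for \<phi>1 \<phi>2
  proof (rule field_le_epsilon)
    fix \<epsilon> :: real assume \<epsilon>: "\<epsilon> > 0"
    have t: "\<phi>1 \<in> test_fields" "\<phi>2 \<in> test_fields" using f by (simp_all add: fields_outside_test)
    obtain s1 s2 where s12: "s1 > R" "s2 > R" "\<forall>x\<in>ball 0 s1. \<phi>1 x = 0" "\<forall>x\<in>ball 0 s2. \<phi>2 x = 0"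
      using f by (auto simp: fields_outside_def)
    define s where "s = min s1 s2"
    have s: "s > R" "\<And>x. x \<in> ball 0 s \<Longrightarrow> \<phi>1 x = 0" "\<And>x. x \<in> ball 0 s \<Longrightarrow> \<phi>2 x = 0"
      using s12 by (auto simp: s_def)
    obtain r1 M1 where D1: "M1 > 0" "continuous_on UNIV (divergence \<phi>1)" "\<And>x. norm x > r1 \<Longrightarrow> divergence \<phi>1 x = 0"
      "\<And>x. norm (divergence \<phi>1 x) \<le> M1" by (rule test_fieldE[OF t(1)]) blast
    obtain r2 M2 where D2: "M2 > 0" "continuous_on UNIV (divergence \<phi>2)" "\<And>x. norm x > r2 \<Longrightarrow> divergence \<phi>2 x = 0"
      "\<And>x. norm (divergence \<phi>2 x) \<le> M2" by (rule test_fieldE[OF t(2)]) blast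
    define r where "r = max r1 r2"
    define B where "B = (LINT x:cball (0::'a) r|lborel. (1::real))"
    have B: "B \<ge> 0" unfolding B_def set_lebesgue_integral_def by (intro integral_nonneg_AE) auto
    \<comment> \<open>Replacing \<open>u\<close> by \<open>conv k u\<close> costs at most
      \<open>\<kappa>\<close> in L^1 of the ball, replacing \<open>\<phi>\<close> by
      \<open>\<alpha>\<close> at most \<open>\<kappa> * B\<close>. The fields weigh this with
      \<open>M1\<close> and \<open>M2\<close>, and the total is to be
      \<open>\<epsilon>\<close>.\<close>
    define \<kappa> where "\<kappa> = \<epsilon> / ((M1 + M2) * (1 + B))"
    have \<kappa>: "\<kappa> > 0" using \<epsilon> D1(1) D2(1) B by (simp add: \<kappa>_def)
    have \<kappa>e: "(M1 + M2) * (\<kappa> + \<kappa> * B) = \<epsilon>"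
    proof -
      have "(M1 + M2) * (1 + B) \<noteq> 0" using D1(1) D2(1) B by simp
      moreover have "(M1 + M2) * (\<kappa> + \<kappa> * B) = \<kappa> * ((M1 + M2) * (1 + B))" by (simp add: algebra_simps)
      ultimately show ?thesis by (simp add: \<kappa>_def)
    qed
    obtain \<alpha> \<alpha>' where \<alpha>: "\<And>s. (\<alpha> has_real_derivative \<alpha>' s) (at s)" "continuous_on UNIV \<alpha>'"
      "\<And>s. 0 \<le> \<alpha>' s" "\<And>s. \<alpha>' s \<le> 1" "\<And>s. \<bar>\<alpha> s - \<phi> s\<bar> \<le> \<kappa>"
      by (rule smooth_approx_monotone[OF m \<kappa>]) blast
    obtain e0 where e0: "e0 > 0" "\<And>e (k :: 'a \<Rightarrow> real) g. mollifier e k g \<Longrightarrow> e \<le> e0 \<Longrightarrow>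
        (LINT x:cball 0 r|lborel. \<bar>conv k u x - u x\<bar>) \<le> \<kappa>"
      using L1_loc_mollify[OF u \<kappa>, of r] by blast
    define e where "e = min e0 ((s - R) / 2)"
    have e: "e > 0" "e \<le> e0" "e < s - R" using e0(1) s(1) by (auto simp: e_def min_def)
    obtain k :: "'a \<Rightarrow> real" and g where kg: "mollifier e k g" using mollifier_exists[OF e(1)] by blast
    interpret mollifier e k g by (rule kg)
    let ?v = "conv k u"
    have vc: "continuous_on UNIV ?v"
      using has_derivative_conv[OF u k_deriv g_cont k_zero g_zero] has_derivative_continuous
      by (fastforce simp: continuous_on_eq_continuous_at)
    have \<alpha>c: "continuous_on UNIV \<alpha>" using \<alpha>(1) by (auto intro!: DERIV_continuous_on)
    have lv: "loc_integrable ?v" by (rule loc_integrable_continuous[OF vc])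
    have lav: "loc_integrable (\<lambda>x. \<alpha> (?v x))"
      using continuous_on_compose2[OF \<alpha>c vc] by (intro loc_integrable_continuous) simp
    have lbv: "loc_integrable (\<lambda>x. ?v x - \<alpha> (?v x))" by (rule loc_integrable_diff[OF lv lav])
    have est: "(LINT x|lborel. a x * divergence \<psi> x) \<le> (LINT x|lborel. b x * divergence \<psi> x) + M * (\<kappa> + \<kappa> * B)"
      if ab: "loc_integrable a" "loc_integrable b" "\<And>x. \<bar>a x - b x\<bar> \<le> \<bar>?v x - u x\<bar> + \<kappa>"
        and \<psi>: "\<psi> \<in> test_fields" "M > 0" "continuous_on UNIV (divergence \<psi>)"
          "\<And>x. norm x > r \<Longrightarrow> divergence \<psi> x = 0" "\<And>x. norm (divergence \<psi> x) \<le> M" for a b \<psi> M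
    proof -
      have "norm (LINT x|lborel. (a x - b x) * divergence \<psi> x) \<le> M * (LINT x:cball 0 r|lborel. \<bar>a x - b x\<bar>)"
        using \<psi> by (intro loc_integrable_mult(2) loc_integrable_diff ab borel_measurable_continuous_onI) auto
      also have "\<dots> \<le> M * (LINT x:cball 0 r|lborel. \<bar>?v x - u x\<bar> + \<kappa>)"
        using ab \<psi>(2) lv u by (intro mult_left_mono set_integral_mono set_integral_add
            loc_integrable_cball loc_integrable_abs loc_integrable_diff loc_integrable_const) auto
      also have "(LINT x:cball 0 r|lborel. \<bar>?v x - u x\<bar> + \<kappa>)
          = (LINT x:cball 0 r|lborel. \<bar>?v x - u x\<bar>) + (LINT x:cball (0::'a) r|lborel. \<kappa>)"
        using lv u by (intro set_integral_add
            loc_integrable_cball loc_integrable_abs loc_integrable_diff loc_integrable_const)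
      also have "(LINT x:cball (0::'a) r|lborel. \<kappa>) = \<kappa> * B"
        by (simp add: B_def set_lebesgue_integral_def mult.commute)
      finally have "norm (LINT x|lborel. (a x - b x) * divergence \<psi> x) \<le> M * (\<kappa> + \<kappa> * B)"
        using e0(2)[OF kg e(2)] mult_left_mono[of "(LINT x:cball 0 r|lborel. \<bar>?v x - u x\<bar>) + \<kappa> * B" "\<kappa> + \<kappa> * B" M] \<psi>(2)
        by (simp only: order_trans add_right_mono less_imp_le)
      moreover have "(LINT x|lborel. (a x - b x) * divergence \<psi> x)
          = (LINT x|lborel. a x * divergence \<psi> x) - (LINT x|lborel. b x * divergence \<psi> x)"
        using test_field_integrable[OF _ \<psi>(1)] ab by (simp add: left_diff_distrib)
      ultimately show ?thesis by simp
    qed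
    have b1: "\<bar>\<phi> (u x) - \<alpha> (?v x)\<bar> \<le> \<bar>?v x - u x\<bar> + \<kappa>" for x
      using lip(1)[of "?v x" "u x"] \<alpha>(5)[of "?v x"] by linarith
    have b2: "\<bar>u x - \<phi> (u x) - (?v x - \<alpha> (?v x))\<bar> \<le> \<bar>?v x - u x\<bar> + \<kappa>" for x
      using lip(2)[of "?v x" "u x"] \<alpha>(5)[of "?v x"] by linarith
    have "(LINT x|lborel. \<phi> (u x) * divergence \<phi>1 x)
        \<le> (LINT x|lborel. \<alpha> (?v x) * divergence \<phi>1 x) + M1 * (\<kappa> + \<kappa> * B)"
      using D1 by (intro est l1 lav b1 t) (auto simp: r_def)
    moreover have "(LINT x|lborel. (u x - \<phi> (u x)) * divergence \<phi>2 x)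
        \<le> (LINT x|lborel. (?v x - \<alpha> (?v x)) * divergence \<phi>2 x) + M2 * (\<kappa> + \<kappa> * B)"
      using D2 by (intro est l2 lbv b2 t) (auto simp: r_def)
    moreover have "(LINT x|lborel. \<alpha> (?v x) * divergence \<phi>1 x)
       + (LINT x|lborel. (?v x - \<alpha> (?v x)) * divergence \<phi>2 x) \<le> V"
      using var_outside_superadditive_smooth[OF u \<alpha>(1-4) t s(2,3) e(3)] real by simp
    moreover have "M1 * (\<kappa> + \<kappa> * B) + M2 * (\<kappa> + \<kappa> * B) = \<epsilon>" using \<kappa>e by (simp add: distrib_right)
    ultimately show "(LINT x|lborel. \<phi> (u x) * divergence \<phi>1 x) + (LINT x|lborel. (u x - \<phi> (u x)) * divergence \<phi>2 x) \<le> V + \<epsilon>"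
      by linarith
  qed
  \<comment> \<open>The suprema over the two fields are taken one after the other; the first must be
    known to be finite before it can be subtracted in \<open>ereal\<close>.\<close>
  have "var_outside R (\<lambda>x. \<phi> (u x)) \<le> ereal V - ereal (LINT x|lborel. (u x - \<phi> (u x)) * divergence \<phi>2 x)"
    if "\<phi>2 \<in> fields_outside R" for \<phi>2
  proof (rule var_outside_leI)
    fix \<phi>1 :: "'a \<Rightarrow> 'a" assume "\<phi>1 \<in> fields_outside R"
    from key[OF this that]
    show "ereal (LINT x|lborel. \<phi> (u x) * divergence \<phi>1 x) \<le> ereal V - ereal (LINT x|lborel. (u x - \<phi> (u x)) * divergence \<phi>2 x)"
      by simp
  qed
  note A = this
  have "var_outside R (\<lambda>x. \<phi> (u x)) \<le> ereal V" using A[OF zero_field(1)] by (simp add: zero_field(2))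
  then obtain W where W: "var_outside R (\<lambda>x. \<phi> (u x)) = ereal W"
    using var_outside_nonneg[of R "\<lambda>x. \<phi> (u x)"] by (cases "var_outside R (\<lambda>x. \<phi> (u x))") auto
  have "var_outside R (\<lambda>x. u x - \<phi> (u x)) \<le> ereal (V - W)"
  proof (rule var_outside_leI)
    fix \<phi>2 :: "'a \<Rightarrow> 'a" assume "\<phi>2 \<in> fields_outside R"
    from A[OF this] show "ereal (LINT x|lborel. (u x - \<phi> (u x)) * divergence \<phi>2 x) \<le> ereal (V - W)"
      by (simp add: W)
  qed
  then have "ereal W + var_outside R (\<lambda>x. u x - \<phi> (u x)) \<le> ereal W + ereal (V - W)" by (rule add_left_mono)
  then show ?thesis by (simp add: W real)
next
  case PInf then show ?thesis by simp
next
  case MInf then show ?thesis using var_outside_nonneg[of R u] by simp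
qed

subsection \<open>The fidelity term\<close>

text \<open>When one point is 0 the inequality reduces to \<open>c powr p \<le> c\<close> for
  \<open>c\<close> in [0,1]; otherwise both points lie in the open half line, where the power is
  convex.\<close>

lemma powr_convex_nonneg:
  fixes s t w p :: real
  assumes p: "1 \<le> p" and st: "0 \<le> s" "0 \<le> t" and w: "0 \<le> w" "w \<le> 1"
  shows "(w * s + (1 - w) * t) powr p \<le> w * s powr p + (1 - w) * t powr p"
proof -
  have c: "(c * r) powr p \<le> c * r powr p" if "0 \<le> c" "c \<le> 1" "0 \<le> r" for c r :: real
  proof -
    have "c powr p \<le> c"
    proof (cases "c = 0")
      case False
      with that have "c powr p \<le> c powr 1" using p by (intro powr_mono') auto
      with that False show ?thesis by simp
    qed simp
    then have "c powr p * r powr p \<le> c * r powr p" by (intro mult_right_mono) auto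
    with that show ?thesis by (simp add: powr_mult)
  qed
  consider "s = 0" | "t = 0" | "s > 0" "t > 0" using st by linarith
  then show ?thesis
  proof cases
    case 1 with c[of "1 - w" t] w st p show ?thesis by simp
  next
    case 2 with c[of w s] w st p show ?thesis by simp
  next
    case 3
    with convex_onD[OF powr_convex[OF p], of "1 - w" s t] w show ?thesis by simp
  qed
qed

text \<open>The real-valued counterpart of \<open>lp_norm\<close>, meaningful only together with
  \<open>in_Lp\<close>: a divergent integral counts as 0 here.\<close>

definition Lp_size :: "real \<Rightarrow> ('a::euclidean_space \<Rightarrow> real) \<Rightarrow> real" where
  "Lp_size p h = (LINT x|lborel. \<bar>h x\<bar> powr p) powr (1 / p)"

lemma Lp_size_nonneg: "0 \<le> Lp_size p h"
  by (simp add: Lp_size_def)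

lemma Lp_size_powr:
  assumes "1 \<le> p" shows "Lp_size p h powr p = (LINT x|lborel. \<bar>h x\<bar> powr p)"
proof -
  have "(LINT x|lborel. \<bar>h x\<bar> powr p) \<ge> 0" by (intro integral_nonneg_AE) simp
  with assms show ?thesis by (simp add: Lp_size_def powr_powr)
qed

lemma Lp_size_le:
  assumes "1 \<le> p" "0 \<le> c" "(LINT x|lborel. \<bar>h x\<bar> powr p) \<le> c powr p"
  shows "Lp_size p h \<le> c"
proof -
  have "(LINT x|lborel. \<bar>h x\<bar> powr p) powr (1 / p) \<le> (c powr p) powr (1 / p)"
    using assms by (intro powr_mono2 integral_nonneg_AE) auto
  with assms show ?thesis by (simp add: Lp_size_def powr_powr)
qed

text \<open>With \<open>w = a / (a + b)\<close>, the quotient of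
  \<open>\<bar>f x + g x\<bar>\<close> by \<open>a + b\<close> is at most a convex combination of
  \<open>\<bar>f x\<bar> / a\<close> and \<open>\<bar>g x\<bar> / b\<close>; convexity of the power
  and integration give the bound \<open>a + b\<close>. Since a size may be 0, \<open>a\<close> and
  \<open>b\<close> are taken slightly larger.\<close>

lemma Minkowski:
  assumes p: "1 \<le> p" and f: "in_Lp p f" and g: "in_Lp p g"
  shows "in_Lp p (\<lambda>x. f x + g x)" and "Lp_size p (\<lambda>x. f x + g x) \<le> Lp_size p f + Lp_size p g"
proof -
  have [measurable]: "f \<in> borel_measurable borel" "g \<in> borel_measurable borel"
    using f g by (simp_all add: in_Lp_def)
  have if': "integrable lborel (\<lambda>x. \<bar>f x\<bar> powr p)" and ig: "integrable lborel (\<lambda>x. \<bar>g x\<bar> powr p)"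
    using f g by (simp_all add: in_Lp_def)
  have main: "in_Lp p (\<lambda>x. f x + g x) \<and> Lp_size p (\<lambda>x. f x + g x) \<le> a + b"
    if a: "a > 0" "Lp_size p f \<le> a" and b: "b > 0" "Lp_size p g \<le> b" for a b
  proof -
    define w where "w = a / (a + b)"
    have w: "0 \<le> w" "w \<le> 1" "1 - w = b / (a + b)" using a b by (auto simp: w_def field_simps)
    have pt: "\<bar>f x + g x\<bar> powr p \<le> (a + b) powr p * (w * (\<bar>f x\<bar> powr p / a powr p) + (1 - w) * (\<bar>g x\<bar> powr p / b powr p))" for x
    proof -
      have "\<bar>f x + g x\<bar> \<le> (a + b) * (w * (\<bar>f x\<bar> / a) + (1 - w) * (\<bar>g x\<bar> / b))"
      proof -
        have "(a + b) * (w * (\<bar>f x\<bar> / a) + (1 - w) * (\<bar>g x\<bar> / b)) = \<bar>f x\<bar> + \<bar>g x\<bar>"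
          using a b unfolding w(3) by (simp add: w_def distrib_left)
        then show ?thesis using abs_triangle_ineq by simp
      qed
      then have "\<bar>f x + g x\<bar> powr p \<le> ((a + b) * (w * (\<bar>f x\<bar> / a) + (1 - w) * (\<bar>g x\<bar> / b))) powr p"
        using p by (intro powr_mono2) auto
      also have "\<dots> = (a + b) powr p * (w * (\<bar>f x\<bar> / a) + (1 - w) * (\<bar>g x\<bar> / b)) powr p"
        by (rule powr_mult)
      also have "\<dots> \<le> (a + b) powr p * (w * (\<bar>f x\<bar> / a) powr p + (1 - w) * (\<bar>g x\<bar> / b) powr p)"
        using a b w p by (intro mult_left_mono powr_convex_nonneg) auto
      finally show ?thesis using a b by (simp add: powr_divide)
    qed
    let ?r = "\<lambda>x. (a + b) powr p * (w * (\<bar>f x\<bar> powr p / a powr p) + (1 - w) * (\<bar>g x\<bar> powr p / b powr p))"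
    have ir: "integrable lborel ?r" using if' ig by simp
    have int: "integrable lborel (\<lambda>x. \<bar>f x + g x\<bar> powr p)"
      by (rule Bochner_Integration.integrable_bound[OF ir]) (use pt in \<open>auto intro: order_trans[OF _ abs_ge_self]\<close>)
    have "(LINT x|lborel. \<bar>f x\<bar> powr p) \<le> a powr p" "(LINT x|lborel. \<bar>g x\<bar> powr p) \<le> b powr p"
      using a b p powr_mono2[of p "Lp_size p f" a] powr_mono2[of p "Lp_size p g" b]
      by (simp_all add: Lp_size_powr Lp_size_nonneg)
    then have fg: "(LINT x|lborel. \<bar>f x\<bar> powr p) / a powr p \<le> 1" "(LINT x|lborel. \<bar>g x\<bar> powr p) / b powr p \<le> 1"
      using a b by simp_all
    have "(LINT x|lborel. \<bar>f x + g x\<bar> powr p) \<le> (LINT x|lborel. ?r x)"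
      using int ir pt by (rule integral_mono)
    also have "\<dots> = (a + b) powr p * (w * ((LINT x|lborel. \<bar>f x\<bar> powr p) / a powr p)
        + (1 - w) * ((LINT x|lborel. \<bar>g x\<bar> powr p) / b powr p))"
      using if' ig by simp
    also have "\<dots> \<le> (a + b) powr p * (w * 1 + (1 - w) * 1)"
      using fg w by (intro mult_left_mono add_mono) auto
    also have "\<dots> = (a + b) powr p" by simp
    finally have "Lp_size p (\<lambda>x. f x + g x) \<le> a + b" using a b p by (intro Lp_size_le) auto
    with int show ?thesis by (simp add: in_Lp_def)
  qed
  from main[of "Lp_size p f + 1" "Lp_size p g + 1"] show "in_Lp p (\<lambda>x. f x + g x)"
    using Lp_size_nonneg[of p f] Lp_size_nonneg[of p g] by simp
  show "Lp_size p (\<lambda>x. f x + g x) \<le> Lp_size p f + Lp_size p g"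
  proof (rule field_le_epsilon)
    fix e :: real assume "e > 0"
    with main[of "Lp_size p f + e / 2" "Lp_size p g + e / 2"] Lp_size_nonneg[of p f] Lp_size_nonneg[of p g]
    show "Lp_size p (\<lambda>x. f x + g x) \<le> Lp_size p f + Lp_size p g + e" by simp
  qed
qed

lemma Lp_size_cmult:
  assumes p: "1 \<le> p" and f: "in_Lp p f"
  shows "in_Lp p (\<lambda>x. c * f x)" and "Lp_size p (\<lambda>x. c * f x) = \<bar>c\<bar> * Lp_size p f"
proof -
  have eq: "\<bar>c * f x\<bar> powr p = \<bar>c\<bar> powr p * \<bar>f x\<bar> powr p" for x by (simp add: abs_mult powr_mult)
  show "in_Lp p (\<lambda>x. c * f x)" using f by (auto simp: in_Lp_def eq)
  have "(LINT x|lborel. \<bar>f x\<bar> powr p) \<ge> 0" by (intro integral_nonneg_AE) simp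
  then show "Lp_size p (\<lambda>x. c * f x) = \<bar>c\<bar> * Lp_size p f"
    using p by (simp add: Lp_size_def eq powr_mult powr_powr)
qed

text \<open>Exactly the residuals for which \<open>energy\<close> has a finite fidelity term. The
  condition excludes the default value 0 of divergent integrals, so that \<open>fidelity\<close> can
  be real-valued.\<close>

definition admissible :: "('a::euclidean_space \<Rightarrow> real) \<Rightarrow> real \<Rightarrow> ('a \<Rightarrow> real) \<Rightarrow> bool" where
  "admissible K p g \<longleftrightarrow> (\<forall>x. integrable lborel (\<lambda>y. K (x - y) * g y)) \<and> in_Lp p (conv K g)"

definition fidelity :: "('a::euclidean_space \<Rightarrow> real) \<Rightarrow> real \<Rightarrow> ('a \<Rightarrow> real) \<Rightarrow> real" where
  "fidelity K p g = Lp_size p (conv K g)"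

lemma fidelity_add:
  assumes p: "1 \<le> p" and g: "admissible K p g" "admissible K p h"
  shows "admissible K p (\<lambda>x. g x + h x)" and "fidelity K p (\<lambda>x. g x + h x) \<le> fidelity K p g + fidelity K p h"
proof -
  have "conv K (\<lambda>x. g x + h x) = (\<lambda>x. conv K g x + conv K h x)"
    using g by (simp add: admissible_def conv_def fun_eq_iff distrib_left)
  then show "admissible K p (\<lambda>x. g x + h x)" "fidelity K p (\<lambda>x. g x + h x) \<le> fidelity K p g + fidelity K p h"
    using Minkowski[OF p, of "conv K g" "conv K h"] g by (simp_all add: admissible_def fidelity_def distrib_left)
qed

lemma fidelity_cmult:
  assumes p: "1 \<le> p" and g: "admissible K p g"
  shows "admissible K p (\<lambda>x. c * g x)" and "fidelity K p (\<lambda>x. c * g x) = \<bar>c\<bar> * fidelity K p g"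
proof -
  have "conv K (\<lambda>x. c * g x) = (\<lambda>x. c * conv K g x)"
    by (simp add: conv_def fun_eq_iff mult.left_commute)
  then show "admissible K p (\<lambda>x. c * g x)" "fidelity K p (\<lambda>x. c * g x) = \<bar>c\<bar> * fidelity K p g"
    using Lp_size_cmult[OF p, of "conv K g" c] g by (simp_all add: admissible_def fidelity_def mult.left_commute)
qed

text \<open>Interpolation: \<open>conv K a\<close> is at most \<open>C\<close> in absolute value, so
  its \<open>p\<close>-th power is at most \<open>C powr (p - 1)\<close> times the convolution of
  \<open>K\<close> with the absolute value of \<open>a\<close>, and Tonelli's theorem gives that
  convolution the same integral as the absolute value of \<open>a\<close>. A bounded function that
  is small in L^1 thus has small fidelity.\<close>

lemma fidelity_bounded:
  fixes K a :: "'a::euclidean_space \<Rightarrow> real"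
  assumes K: "admissible_kernel p K" and p: "1 \<le> p" and a: "integrable lborel a" "\<And>x. \<bar>a x\<bar> \<le> C"
    and I: "(LINT x|lborel. \<bar>a x\<bar>) \<le> I" "0 \<le> I"
  shows "admissible K p a" and "fidelity K p a \<le> (C powr (p - 1) * I) powr (1 / p)"
proof -
  have Kpos: "K x > 0" for x using K by (simp add: admissible_kernel_def)
  have Ki: "integrable lborel K" "(LINT x|lborel. K x) = 1" using K by (simp_all add: admissible_kernel_def)
  obtain B where B: "\<And>x. norm (K x) \<le> B" using K by (auto simp: admissible_kernel_def bounded_iff)
  have [measurable]: "K \<in> borel_measurable borel" "a \<in> borel_measurable borel"
    using Ki a by (simp_all add: borel_measurable_integrable)
  have C: "C \<ge> 0" using a(2)[of 0] by linarith
  have Kx: "integrable lborel (\<lambda>y. K (x - y))" "(LINT y|lborel. K (x - y)) = 1" for x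
    using lborel_integral_reflect[of K x] Ki by auto
  have int: "integrable lborel (\<lambda>y. K (x - y) * a y)" for x
  proof (rule Bochner_Integration.integrable_bound)
    show "integrable lborel (\<lambda>y. C * K (x - y))" using Kx by simp
    show "AE y in lborel. norm (K (x - y) * a y) \<le> norm (C * K (x - y))"
      using a(2) Kpos C by (intro AE_I2) (simp add: abs_mult mult.commute mult_right_mono)
  qed measurable
  have cm[measurable]: "conv K a \<in> borel_measurable borel" unfolding conv_def[abs_def] by measurable
  have le1: "\<bar>conv K a x\<bar> \<le> (LINT y|lborel. K (x - y) * \<bar>a y\<bar>)" for x
    using integral_norm_bound[of lborel "\<lambda>y. K (x - y) * a y"] Kpos[THEN less_imp_le]
    by (simp add: conv_def abs_mult)
  have int': "integrable lborel (\<lambda>y. K (x - y) * \<bar>a y\<bar>)" for x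
    using integrable_norm[OF int[of x]] Kpos[THEN less_imp_le] by (simp add: abs_mult)
  have le2: "(LINT y|lborel. K (x - y) * \<bar>a y\<bar>) \<le> C" for x
  proof -
    have "(LINT y|lborel. K (x - y) * \<bar>a y\<bar>) \<le> (LINT y|lborel. K (x - y) * C)"
      using a(2) Kpos Kx int' by (intro integral_mono mult_left_mono) (auto intro: less_imp_le)
    then show ?thesis using Kx by simp
  qed
  have "(\<integral>\<^sup>+x. ennreal (\<bar>conv K a x\<bar> powr p) \<partial>lborel)
      \<le> (\<integral>\<^sup>+x. (\<integral>\<^sup>+y. ennreal (C powr (p - 1) * (K (x - y) * \<bar>a y\<bar>)) \<partial>lborel) \<partial>lborel)"
  proof (rule nn_integral_mono)
    fix x
    have "\<bar>conv K a x\<bar> powr p = \<bar>conv K a x\<bar> powr (p - 1) * \<bar>conv K a x\<bar>"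
      using powr_add[of "\<bar>conv K a x\<bar>" "p - 1" 1] by (cases "conv K a x = 0") auto
    also have "\<dots> \<le> C powr (p - 1) * (LINT y|lborel. K (x - y) * \<bar>a y\<bar>)"
      using le1[of x] le2[of x] p by (intro mult_mono powr_mono2) auto
    also have "\<dots> = (LINT y|lborel. C powr (p - 1) * (K (x - y) * \<bar>a y\<bar>))" by simp
    finally have "ennreal (\<bar>conv K a x\<bar> powr p) \<le> ennreal (LINT y|lborel. C powr (p - 1) * (K (x - y) * \<bar>a y\<bar>))"
      by (rule ennreal_leI)
    also have "\<dots> = (\<integral>\<^sup>+y. ennreal (C powr (p - 1) * (K (x - y) * \<bar>a y\<bar>)) \<partial>lborel)"
      using int'[of x] Kpos[THEN less_imp_le] by (intro nn_integral_eq_integral[symmetric]) auto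
    finally show "ennreal (\<bar>conv K a x\<bar> powr p) \<le> (\<integral>\<^sup>+y. ennreal (C powr (p - 1) * (K (x - y) * \<bar>a y\<bar>)) \<partial>lborel)" .
  qed
  also have "\<dots> = (\<integral>\<^sup>+y. (\<integral>\<^sup>+x. ennreal (C powr (p - 1) * (K (x - y) * \<bar>a y\<bar>)) \<partial>lborel) \<partial>lborel)"
    by (rule lborel_pair.Fubini'[symmetric]) measurable
  also have "\<dots> = (\<integral>\<^sup>+y. ennreal (C powr (p - 1) * \<bar>a y\<bar>) \<partial>lborel)"
  proof (rule nn_integral_cong)
    fix y
    have Ky: "integrable lborel (\<lambda>x. K (x - y))" "(LINT x|lborel. K (x - y)) = 1"
      using lborel_integral_translate[of K "- y"] Ki by auto
    have "(\<integral>\<^sup>+x. ennreal (C powr (p - 1) * (K (x - y) * \<bar>a y\<bar>)) \<partial>lborel)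
        = ennreal (LINT x|lborel. C powr (p - 1) * (K (x - y) * \<bar>a y\<bar>))"
      using Ky Kpos[THEN less_imp_le] by (intro nn_integral_eq_integral) auto
    also have "(LINT x|lborel. C powr (p - 1) * (K (x - y) * \<bar>a y\<bar>)) = C powr (p - 1) * \<bar>a y\<bar>" using Ky by simp
    finally show "(\<integral>\<^sup>+x. ennreal (C powr (p - 1) * (K (x - y) * \<bar>a y\<bar>)) \<partial>lborel) = ennreal (C powr (p - 1) * \<bar>a y\<bar>)" .
  qed
  also have "\<dots> = ennreal (LINT y|lborel. C powr (p - 1) * \<bar>a y\<bar>)"
    using a by (intro nn_integral_eq_integral) auto
  also have "\<dots> \<le> ennreal (C powr (p - 1) * I)" using I by (intro ennreal_leI) (simp add: mult_left_mono)
  finally have bd: "(\<integral>\<^sup>+x. ennreal (\<bar>conv K a x\<bar> powr p) \<partial>lborel) \<le> ennreal (C powr (p - 1) * I)" .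
  have "integrable lborel (\<lambda>x. \<bar>conv K a x\<bar> powr p)"
    using bd by (intro integrableI_bounded) (auto intro: le_less_trans)
  then show "admissible K p a" using int by (simp add: admissible_def in_Lp_def)
  have "(LINT x|lborel. \<bar>conv K a x\<bar> powr p) \<le> C powr (p - 1) * I"
    using bd I by (intro integral_real_bounded) auto
  then show "fidelity K p a \<le> (C powr (p - 1) * I) powr (1 / p)"
    unfolding fidelity_def Lp_size_def using p by (intro powr_mono2 integral_nonneg_AE) auto
qed

subsection \<open>Minimality in terms of the residual\<close>

lemma smooth_cutoff_exists:
  fixes \<rho> :: real
  assumes \<rho>: "\<rho> \<ge> 0"
  obtains \<eta> :: "'a::euclidean_space \<Rightarrow> real" and g M where
    "\<And>x. (\<eta> has_derivative (\<lambda>v. g x \<bullet> v)) (at x)" "continuous_on UNIV g"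
    "\<And>x. 0 \<le> \<eta> x" "\<And>x. \<eta> x \<le> 1" "\<And>x. norm x \<le> \<rho> \<Longrightarrow> \<eta> x = 1" "\<And>x. norm x > \<rho> + 1 \<Longrightarrow> \<eta> x = 0"
    "\<And>x. norm x > \<rho> + 1 \<Longrightarrow> g x = 0" "\<And>x. norm (g x) \<le> M" "M > 0"
proof -
  \<comment> \<open>The cutoff is \<open>(s x)^2\<close> with \<open>s = (1 - q^2)_+\<close> and
    \<open>q = (|x|^2 - \<rho>^2)_+\<close>. It is 1 where \<open>q = 0\<close>, that is for
    \<open>norm x \<le> \<rho>\<close>, and 0 where \<open>q \<ge> 1\<close>; the latter covers
    \<open>norm x > \<rho> + 1\<close>, since then \<open>|x|^2 - \<rho>^2 > 2 * \<rho> + 1\<close>.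
    The factor -8 in \<open>g\<close> collects the two squares, \<open>x \<bullet> x\<close> and the
    sign of \<open>q^2\<close>.\<close>
  define q :: "'a \<Rightarrow> real" where "q x = max 0 (x \<bullet> x - \<rho>\<^sup>2)" for x
  define s :: "'a \<Rightarrow> real" where "s x = max 0 (1 - (q x)\<^sup>2)" for x
  define g :: "'a \<Rightarrow> 'a" where "g x = (- 8 * s x * q x) *\<^sub>R x" for x
  have dq: "((\<lambda>x. 1 - (q x)\<^sup>2) has_derivative (\<lambda>v. - (4 * q x * (x \<bullet> v)))) (at x)" for x
  proof -
    have "((\<lambda>x. x \<bullet> x - \<rho>\<^sup>2) has_derivative (\<lambda>v. 2 * (x \<bullet> v))) (at x)"
      by (auto intro!: derivative_eq_intros simp: inner_commute)
    from has_derivative_compose[OF this, of "\<lambda>s. (max 0 s)\<^sup>2" "(*) (2 * max 0 (x \<bullet> x - \<rho>\<^sup>2))"]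
    have "((\<lambda>x. (q x)\<^sup>2) has_derivative (\<lambda>v. 4 * q x * (x \<bullet> v))) (at x)"
      using pos_square_has_derivative[of "x \<bullet> x - \<rho>\<^sup>2"]
      by (simp add: q_def[abs_def] has_field_derivative_def mult_ac)
    from has_derivative_diff[OF has_derivative_const[of 1] this] show ?thesis by simp
  qed
  have d: "((\<lambda>x. (s x)\<^sup>2) has_derivative (\<lambda>v. g x \<bullet> v)) (at x)" for x
    using has_derivative_compose[OF dq, of "\<lambda>s. (max 0 s)\<^sup>2" "(*) (2 * max 0 (1 - (q x)\<^sup>2))" x]
      pos_square_has_derivative[of "1 - (q x)\<^sup>2"]
    by (simp add: s_def[abs_def] g_def has_field_derivative_def mult_ac)
  have c: "continuous_on UNIV g" unfolding g_def s_def q_def by (intro continuous_intros)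
  have s1: "0 \<le> s x" "s x \<le> 1" for x by (auto simp: s_def)
  have out: "s x = 0" if "norm x > \<rho> + 1" for x
  proof -
    have "(\<rho> + 1)\<^sup>2 \<le> x \<bullet> x" using that \<rho> by (simp add: dot_square_norm power_mono)
    then have "1 \<le> x \<bullet> x - \<rho>\<^sup>2" using \<rho> by (simp add: power2_sum)
    then have "1 \<le> (q x)\<^sup>2" by (simp add: q_def)
    then show ?thesis by (simp add: s_def)
  qed
  have gz: "g x = 0" if "norm x > \<rho> + 1" for x using out[OF that] by (simp add: g_def)
  obtain M where M: "M > 0" "\<And>x. norm (g x) \<le> M" using compact_support_bounded[OF c gz] by metis
  show ?thesis
  proof (rule that[OF d c _ _ _ _ gz M(2,1)])
    show "0 \<le> (s x)\<^sup>2" "(s x)\<^sup>2 \<le> 1" for x using s1[of x] by (simp_all add: power_le_one)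
    show "(s x)\<^sup>2 = 1" if "norm x \<le> \<rho>" for x
      using that by (simp add: s_def q_def dot_square_norm power_mono)
    show "(s x)\<^sup>2 = 0" if "norm x > \<rho> + 1" for x using out[OF that] by simp
  qed
qed

text \<open>Product rule: testing \<open>\<zeta> x * v x\<close> with \<open>\<phi>\<close> is
  testing \<open>v\<close> with \<open>\<zeta> x *\<^sub>R \<phi> x\<close>, up to the term with the
  gradient of \<open>\<zeta>\<close>, which costs an L^1 norm on a ball. Since
  \<open>\<zeta>\<close> vanishes on a ball of radius larger than \<open>R\<close>, only the
  variation of \<open>v\<close> outside enters although \<open>\<phi>\<close> is an arbitrary test
  field.\<close>

lemma var_outside_mult:
  fixes v \<zeta> :: "'a::euclidean_space \<Rightarrow> real"
  assumes v: "loc_integrable v"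
    and \<zeta>: "\<And>x. (\<zeta> has_derivative (\<lambda>h. g x \<bullet> h)) (at x)" "continuous_on UNIV g" "\<And>x. 0 \<le> \<zeta> x" "\<And>x. \<zeta> x \<le> 1"
      "\<And>x. x \<in> ball 0 s \<Longrightarrow> \<zeta> x = 0" and s: "s > R"
    and g: "\<And>x. norm x > r \<Longrightarrow> g x = 0" "\<And>x. norm (g x) \<le> M"
  shows "var_outside (-1) (\<lambda>x. \<zeta> x * v x) \<le> var_outside R v + ereal (M * (LINT x:cball 0 r|lborel. \<bar>v x\<bar>))"
proof (rule var_outside_leI)
  fix \<phi> :: "'a \<Rightarrow> 'a" assume "\<phi> \<in> fields_outside (-1)"
  then have \<phi>: "\<phi> \<in> test_fields" by (rule fields_outside_test)
  obtain D t where D: "\<And>x. (\<phi> has_derivative D x) (at x)"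
    "\<And>b. b \<in> Basis \<Longrightarrow> continuous_on UNIV (\<lambda>x. D x b)" "\<And>x. norm x > t \<Longrightarrow> \<phi> x = 0"
    "\<And>x. norm (\<phi> x) \<le> 1" "divergence \<phi> = (\<lambda>x. \<Sum>b\<in>Basis. D x b \<bullet> b)" "continuous_on UNIV \<phi>"
    by (rule test_fieldE[OF \<phi>]) blast
  have \<zeta>c: "continuous_on UNIV \<zeta>"
    using \<zeta>(1) has_derivative_continuous by (fastforce simp: continuous_on_eq_continuous_at)
  define E where "E x h = \<zeta> x *\<^sub>R D x h + (g x \<bullet> h) *\<^sub>R \<phi> x" for x h
  have dE: "((\<lambda>x. \<zeta> x *\<^sub>R \<phi> x) has_derivative E x) (at x)" for x
    unfolding E_def by (rule has_derivative_scaleR[OF \<zeta>(1) D(1)])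
  have cE: "continuous_on UNIV (\<lambda>x. E x b)" if "b \<in> Basis" for b
    unfolding E_def by (intro continuous_intros \<zeta>c \<zeta>(2) D(2)[OF that] D(6))
  have zE: "\<zeta> x *\<^sub>R \<phi> x = 0" if "norm x > t" for x using D(3)[OF that] by simp
  have nE: "norm (\<zeta> x *\<^sub>R \<phi> x) \<le> 1" for x
    using mult_mono[OF \<zeta>(4)[of x] D(4)[of x]] \<zeta>(3)[of x] by simp
  have tE: "(\<lambda>x. \<zeta> x *\<^sub>R \<phi> x) \<in> test_fields" by (rule test_fieldI(1)[OF dE cE zE nE])
  have fE: "(\<lambda>x. \<zeta> x *\<^sub>R \<phi> x) \<in> fields_outside R"
    using tE s \<zeta>(5) by (auto simp: fields_outside_def intro!: exI[of _ s])
  have div: "divergence (\<lambda>x. \<zeta> x *\<^sub>R \<phi> x) x = \<zeta> x * divergence \<phi> x + g x \<bullet> \<phi> x" for x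
  proof -
    have "divergence (\<lambda>x. \<zeta> x *\<^sub>R \<phi> x) x = (\<Sum>b\<in>Basis. E x b \<bullet> b)" by (rule test_fieldI(2)[OF dE cE zE nE])
    also have "\<dots> = \<zeta> x * (\<Sum>b\<in>Basis. D x b \<bullet> b) + (\<Sum>b\<in>Basis. (g x \<bullet> b) * (\<phi> x \<bullet> b))"
      by (simp add: E_def inner_add_left sum.distrib sum_distrib_left)
    finally show ?thesis by (simp only: D(5) euclidean_inner[of "g x" "\<phi> x"])
  qed
  have gm[measurable]: "(\<lambda>x. g x \<bullet> \<phi> x) \<in> borel_measurable borel"
    using \<zeta>(2) D(6) by (intro borel_measurable_continuous_onI continuous_intros)
  have gb: "norm (g x \<bullet> \<phi> x) \<le> M" for x
  proof -
    have "\<bar>g x \<bullet> \<phi> x\<bar> \<le> norm (g x) * norm (\<phi> x)" by (rule Cauchy_Schwarz_ineq2)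
    also have "\<dots> \<le> M * 1" using g(2)[of x] D(4)[of x] norm_ge_zero[of "g x"] norm_ge_zero[of "\<phi> x"]
      by (intro mult_mono) linarith+
    finally show ?thesis by simp
  qed
  have gz: "g x \<bullet> \<phi> x = 0" if "x \<notin> cball 0 r" for x using that g(1)[of x] by simp
  note i = loc_integrable_mult[where a=0 and r=r, OF v gm gb gz]
  have i2: "integrable lborel (\<lambda>x. v x * divergence (\<lambda>x. \<zeta> x *\<^sub>R \<phi> x) x)" by (rule test_field_integrable[OF v tE])
  have "(LINT x|lborel. \<zeta> x * v x * divergence \<phi> x)
      = (LINT x|lborel. v x * divergence (\<lambda>x. \<zeta> x *\<^sub>R \<phi> x) x - v x * (g x \<bullet> \<phi> x))"
    by (intro Bochner_Integration.integral_cong refl) (simp add: div algebra_simps)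
  also have "\<dots> = (LINT x|lborel. v x * divergence (\<lambda>x. \<zeta> x *\<^sub>R \<phi> x) x) - (LINT x|lborel. v x * (g x \<bullet> \<phi> x))"
    using i(1) i2 by simp
  also have "\<dots> \<le> (LINT x|lborel. v x * divergence (\<lambda>x. \<zeta> x *\<^sub>R \<phi> x) x) + M * (LINT x:cball 0 r|lborel. \<bar>v x\<bar>)"
    using i(2) by simp
  finally have "ereal (LINT x|lborel. \<zeta> x * v x * divergence \<phi> x)
      \<le> ereal (LINT x|lborel. v x * divergence (\<lambda>x. \<zeta> x *\<^sub>R \<phi> x) x) + ereal (M * (LINT x:cball 0 r|lborel. \<bar>v x\<bar>))"
    by simp
  also have "\<dots> \<le> var_outside R v + ereal (M * (LINT x:cball 0 r|lborel. \<bar>v x\<bar>))"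
    by (intro add_right_mono var_outside_upper fE)
  finally show "ereal (LINT x|lborel. \<zeta> x * v x * divergence \<phi> x)
      \<le> var_outside R v + ereal (M * (LINT x:cball 0 r|lborel. \<bar>v x\<bar>))" .
qed

text \<open>The value is the junk \<open>0\<close> when the seminorm is infinite.\<close>

definition tv :: "('a::euclidean_space \<Rightarrow> real) \<Rightarrow> real" where
  "tv u = real_of_ereal (bv_seminorm u)"

section \<open>The space \<open>BV\<close> with a real-valued seminorm\<close>

lemma BV_loc_integrable: "u \<in> BV \<Longrightarrow> loc_integrable u"
  by (simp add: BV_def)

lemma BV_iff: "u \<in> BV \<longleftrightarrow> loc_integrable u \<and> var_outside (-1) u < \<infinity>"
  by (simp add: BV_def bv_seminorm_eq)

lemma BV_I: "loc_integrable u \<Longrightarrow> var_outside (-1) u \<le> ereal c \<Longrightarrow> u \<in> BV"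
  by (auto simp: BV_iff)

lemma bv_seminorm_BV: "u \<in> BV \<Longrightarrow> bv_seminorm u = ereal (tv u)"
  using var_outside_nonneg[of "-1" u] by (cases "bv_seminorm u") (auto simp: BV_def tv_def bv_seminorm_eq)

lemma var_outside_BV: "u \<in> BV \<Longrightarrow> var_outside (-1) u = ereal (tv u)"
  using bv_seminorm_BV by (simp add: bv_seminorm_eq)

lemma tv_nonneg: "0 \<le> tv u"
  using var_outside_nonneg[of "-1" u] by (simp add: tv_def bv_seminorm_eq real_of_ereal_pos)

lemma tv_leI: "var_outside (-1) u \<le> ereal c \<Longrightarrow> tv u \<le> c"
  using var_outside_nonneg[of "-1" u] by (cases "var_outside (-1) u") (auto simp: tv_def bv_seminorm_eq)

lemma BV_add:
  assumes "u \<in> BV" "v \<in> BV"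
  shows "(\<lambda>x. u x + v x) \<in> BV" and "tv (\<lambda>x. u x + v x) \<le> tv u + tv v"
proof -
  have le: "var_outside (-1) (\<lambda>x. u x + v x) \<le> ereal (tv u + tv v)"
    using var_outside_add[of u v "-1"] assms by (simp add: var_outside_BV BV_loc_integrable)
  show "(\<lambda>x. u x + v x) \<in> BV"
    using assms by (intro BV_I[OF _ le] loc_integrable_add BV_loc_integrable)
  show "tv (\<lambda>x. u x + v x) \<le> tv u + tv v" using le by (rule tv_leI)
qed

lemma BV_cmult_nonneg:
  assumes u: "u \<in> BV" and c: "0 \<le> c"
  shows "(\<lambda>x. c * u x) \<in> BV" and "tv (\<lambda>x. c * u x) = c * tv u"
proof -
  have le: "var_outside (-1) (\<lambda>x. c * u x) \<le> ereal (c * tv u)" if "u \<in> BV" "0 \<le> c" for u :: "'a \<Rightarrow> real" and c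
    using var_outside_cmult_nonneg[OF that(2), of "-1" u] that(1) by (simp add: var_outside_BV)
  have b: "(\<lambda>x. c * u x) \<in> BV" if "0 \<le> c" for c
    using u that by (intro BV_I[OF _ le[OF u that]] loc_integrable_cmult BV_loc_integrable)
  show "(\<lambda>x. c * u x) \<in> BV" using b[OF c] .
  show "tv (\<lambda>x. c * u x) = c * tv u"
  proof (cases "c = 0")
    case True then show ?thesis using tv_leI[OF le[OF u c]] tv_nonneg[of "\<lambda>x. c * u x"] by simp
  next
    case False
    have "tv (\<lambda>x. inverse c * (c * u x)) \<le> inverse c * tv (\<lambda>x. c * u x)"
      using c by (intro tv_leI le b) auto
    then have "tv u \<le> inverse c * tv (\<lambda>x. c * u x)" using False by (simp flip: mult.assoc)
    then have "c * tv u \<le> tv (\<lambda>x. c * u x)" using False c by (simp add: field_simps)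
    with tv_leI[OF le[OF u c]] show ?thesis by simp
  qed
qed

lemma BV_uminus: "u \<in> BV \<Longrightarrow> (\<lambda>x. - u x) \<in> BV"
  using var_outside_uminus[of "-1" u] loc_integrable_cmult[of u "-1"]
  by (auto intro!: BV_I[of _ "tv u"] simp: var_outside_BV BV_loc_integrable)

lemma BV_diff: "u \<in> BV \<Longrightarrow> v \<in> BV \<Longrightarrow> (\<lambda>x. u x - v x) \<in> BV"
  using BV_add(1)[of u "\<lambda>x. - v x"] BV_uminus[of v] by simp

lemma BV_zero: "(\<lambda>x. 0) \<in> BV"
  by (rule BV_I[of _ 0]) (auto intro!: loc_integrable_const var_outside_leI)

lemma BV_compose:
  assumes u: "u \<in> BV" and m: "mono \<phi>" "mono (\<lambda>s. s - \<phi> s)"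
  shows "(\<lambda>x. \<phi> (u x)) \<in> BV" and "tv (\<lambda>x. \<phi> (u x)) + tv (\<lambda>x. u x - \<phi> (u x)) \<le> tv u"
proof -
  have le: "var_outside (-1) (\<lambda>x. \<phi> (u x)) + var_outside (-1) (\<lambda>x. u x - \<phi> (u x)) \<le> ereal (tv u)"
    using var_outside_superadditive[OF BV_loc_integrable[OF u] m, of "-1"] u by (simp add: var_outside_BV)
  have "var_outside (-1) (\<lambda>x. \<phi> (u x)) \<le> ereal (tv u)"
    using order_trans[OF add_left_mono[OF var_outside_nonneg, of "var_outside (-1) (\<lambda>x. \<phi> (u x))"] le] by simp
  then show b: "(\<lambda>x. \<phi> (u x)) \<in> BV"
    by (rule BV_I[OF loc_integrable_compose[OF BV_loc_integrable[OF u] m]])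
  show "tv (\<lambda>x. \<phi> (u x)) + tv (\<lambda>x. u x - \<phi> (u x)) \<le> tv u"
    using le b BV_diff[OF u b] by (simp add: var_outside_BV)
qed

text \<open>Minimality of \<open>v\<close> for the datum \<open>v + h\<close>, with competitor \<open>v + w\<close>.\<close>

definition optimal_residual :: "('a::euclidean_space \<Rightarrow> real) \<Rightarrow> real \<Rightarrow> real \<Rightarrow> ('a \<Rightarrow> real) \<Rightarrow> ('a \<Rightarrow> real) \<Rightarrow> bool" where
  "optimal_residual K p lam h v \<longleftrightarrow> v \<in> BV \<and>
     (\<forall>w\<in>BV. admissible K p (\<lambda>y. h y - w y) \<longrightarrow>
        tv v + lam * fidelity K p h \<le> tv (\<lambda>x. v x + w x) + lam * fidelity K p (\<lambda>y. h y - w y))"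

text \<open>The remainder \<open>u x - \<phi> (u x)\<close> is added to the competitor. It raises
  the seminorm there by at most its own variation, while in \<open>u\<close> it accounts for the
  full amount, so it cancels from the minimality of \<open>u\<close>.\<close>

lemma optimal_residual_compose:
  assumes u: "optimal_residual K p lam h u" and m: "mono \<phi>" "mono (\<lambda>s. s - \<phi> s)"
  shows "optimal_residual K p lam h (\<lambda>x. \<phi> (u x))"
  unfolding optimal_residual_def
proof (intro conjI ballI impI)
  have uB: "u \<in> BV" using u by (simp add: optimal_residual_def)
  show b: "(\<lambda>x. \<phi> (u x)) \<in> BV" by (rule BV_compose(1)[OF uB m])
  fix w :: "'a \<Rightarrow> real" assume w: "w \<in> BV" "admissible K p (\<lambda>y. h y - w y)"
  have "tv (\<lambda>x. u x + w x) = tv (\<lambda>x. (\<phi> (u x) + w x) + (u x - \<phi> (u x)))" by (simp add: algebra_simps)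
  also have "\<dots> \<le> tv (\<lambda>x. \<phi> (u x) + w x) + tv (\<lambda>x. u x - \<phi> (u x))"
    using b w uB by (intro BV_add BV_diff)
  finally have "tv (\<lambda>x. u x + w x) \<le> tv (\<lambda>x. \<phi> (u x) + w x) + tv (\<lambda>x. u x - \<phi> (u x))" .
  moreover have "tv u + lam * fidelity K p h \<le> tv (\<lambda>x. u x + w x) + lam * fidelity K p (\<lambda>y. h y - w y)"
    using u w by (simp add: optimal_residual_def)
  ultimately show "tv (\<lambda>x. \<phi> (u x)) + lam * fidelity K p h
      \<le> tv (\<lambda>x. \<phi> (u x) + w x) + lam * fidelity K p (\<lambda>y. h y - w y)"
    using BV_compose(2)[OF uB m] by linarith
qed

text \<open>For \<open>s \<le> 1\<close> the missing part \<open>(1 - s) * v x\<close> is added to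
  the competitor and cancels. For \<open>s > 1\<close> the perturbation \<open>w\<close> is shrunk
  by \<open>t = 1 / s\<close>; convexity of the fidelity along the segment from \<open>h\<close> to
  \<open>h - w\<close> bounds the price, and multiplication by \<open>s\<close> restores the
  original size.\<close>

lemma optimal_residual_scale:
  assumes p: "1 \<le> p" and lam: "lam > 0" and h: "admissible K p h"
    and v: "optimal_residual K p lam h v" and s: "0 \<le> s"
  shows "optimal_residual K p lam h (\<lambda>x. s * v x)"
  unfolding optimal_residual_def
proof (intro conjI ballI impI)
  have vB: "v \<in> BV" using v by (simp add: optimal_residual_def)
  show sB: "(\<lambda>x. s * v x) \<in> BV" by (rule BV_cmult_nonneg(1)[OF vB s])
  fix w :: "'a \<Rightarrow> real" assume w: "w \<in> BV" "admissible K p (\<lambda>y. h y - w y)"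
  show "tv (\<lambda>x. s * v x) + lam * fidelity K p h
      \<le> tv (\<lambda>x. s * v x + w x) + lam * fidelity K p (\<lambda>y. h y - w y)"
  proof (cases "s \<le> 1")
    case True
    have "tv (\<lambda>x. v x + w x) = tv (\<lambda>x. (s * v x + w x) + (1 - s) * v x)" by (simp add: algebra_simps)
    also have "\<dots> \<le> tv (\<lambda>x. s * v x + w x) + tv (\<lambda>x. (1 - s) * v x)"
      using True s sB w vB by (intro BV_add BV_cmult_nonneg) auto
    also have "tv (\<lambda>x. (1 - s) * v x) = (1 - s) * tv v" using True vB by (intro BV_cmult_nonneg) auto
    finally have "tv (\<lambda>x. v x + w x) \<le> tv (\<lambda>x. s * v x + w x) + (1 - s) * tv v" .
    moreover have "tv v + lam * fidelity K p h \<le> tv (\<lambda>x. v x + w x) + lam * fidelity K p (\<lambda>y. h y - w y)"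
      using v w by (simp add: optimal_residual_def)
    ultimately show ?thesis using BV_cmult_nonneg(2)[OF vB s] by (simp add: algebra_simps)
  next
    case False
    define t where "t = 1 / s"
    have t: "0 < t" "t < 1" "s * t = 1" using False by (auto simp: t_def)
    have tw: "(\<lambda>x. t * w x) \<in> BV" using w t by (intro BV_cmult_nonneg) auto
    have split: "(\<lambda>y. h y - t * w y) = (\<lambda>y. (1 - t) * h y + t * (h y - w y))"
      by (simp add: fun_eq_iff algebra_simps)
    note c1 = fidelity_cmult[OF p h, of "1 - t"] and c2 = fidelity_cmult[OF p w(2), of t]
    have ad: "admissible K p (\<lambda>y. h y - t * w y)"
      unfolding split by (rule fidelity_add(1)[OF p c1(1) c2(1)])
    have fi: "fidelity K p (\<lambda>y. h y - t * w y) \<le> (1 - t) * fidelity K p h + t * fidelity K p (\<lambda>y. h y - w y)"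
      unfolding split using fidelity_add(2)[OF p c1(1) c2(1)] c1(2) c2(2) t by simp
    have "tv v + lam * fidelity K p h \<le> tv (\<lambda>x. v x + t * w x) + lam * fidelity K p (\<lambda>y. h y - t * w y)"
      using v tw ad by (simp add: optimal_residual_def)
    also have "\<dots> \<le> tv (\<lambda>x. v x + t * w x) + lam * ((1 - t) * fidelity K p h + t * fidelity K p (\<lambda>y. h y - w y))"
      using fi lam by simp
    finally have "s * (tv v + lam * fidelity K p h)
        \<le> s * (tv (\<lambda>x. v x + t * w x) + lam * ((1 - t) * fidelity K p h + t * fidelity K p (\<lambda>y. h y - w y)))"
      using s by (rule mult_left_mono)
    also have "\<dots> = s * tv (\<lambda>x. v x + t * w x)
        + lam * ((s - s * t) * fidelity K p h + (s * t) * fidelity K p (\<lambda>y. h y - w y))"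
      by (simp add: algebra_simps)
    also have "s * tv (\<lambda>x. v x + t * w x) = tv (\<lambda>x. s * (v x + t * w x))"
      using BV_cmult_nonneg(2)[OF BV_add(1)[OF vB tw] s] by simp
    also have "(\<lambda>x. s * (v x + t * w x)) = (\<lambda>x. s * v x + w x)"
      using t(3) by (simp add: distrib_left flip: mult.assoc)
    finally show ?thesis using BV_cmult_nonneg(2)[OF vB s] t(3) by (simp add: algebra_simps)
  qed
qed

text \<open>A perturbation \<open>w\<close> of \<open>\<xi>\<close> becomes the perturbation
  \<open>a + w\<close> of \<open>v\<close>, and \<open>v + (a + w)\<close> equals
  \<open>\<xi> + w - b\<close>. Thus \<open>a\<close> is paid for in the fidelity and
  \<open>b\<close> in the seminorm: each part of the error need be small in only one of the two
  senses.\<close>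

lemma optimal_residual_limit:
  assumes p: "1 \<le> p" and lam: "lam > 0" and \<xi>: "\<xi> \<in> BV"
    and approx: "\<And>\<delta>. \<delta> > 0 \<Longrightarrow> \<exists>v a b. optimal_residual K p lam h v \<and> (\<forall>x. \<xi> x = v x + a x + b x) \<and>
      a \<in> BV \<and> b \<in> BV \<and> admissible K p a \<and> fidelity K p a \<le> \<delta> \<and> tv b \<le> \<delta> \<and> tv \<xi> - \<delta> \<le> tv v"
  shows "optimal_residual K p lam h \<xi>"
  unfolding optimal_residual_def
proof (intro conjI ballI impI \<xi>)
  fix w :: "'a \<Rightarrow> real" assume w: "w \<in> BV" "admissible K p (\<lambda>y. h y - w y)"
  show "tv \<xi> + lam * fidelity K p h \<le> tv (\<lambda>x. \<xi> x + w x) + lam * fidelity K p (\<lambda>y. h y - w y)"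
  proof (rule field_le_epsilon)
    fix \<epsilon> :: real assume \<epsilon>: "\<epsilon> > 0"
    \<comment> \<open>Three losses: \<open>\<delta>\<close> for \<open>tv b\<close>,
      \<open>\<delta>\<close> for the gap between \<open>tv \<xi>\<close> and \<open>tv v\<close>,
      and \<open>lam * \<delta>\<close> for the fidelity of \<open>a\<close>.\<close>
    define \<delta> where "\<delta> = \<epsilon> / (2 + lam)"
    have \<delta>: "\<delta> > 0" "(2 + lam) * \<delta> = \<epsilon>" using \<epsilon> lam by (auto simp: \<delta>_def)
    obtain v a b where v: "optimal_residual K p lam h v" "\<And>x. \<xi> x = v x + a x + b x"
      and ab: "a \<in> BV" "b \<in> BV" "admissible K p a" "fidelity K p a \<le> \<delta>" "tv b \<le> \<delta>" "tv \<xi> - \<delta> \<le> tv v"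
      using approx[OF \<delta>(1)] by blast
    have aw: "(\<lambda>x. a x + w x) \<in> BV" using ab w by (intro BV_add)
    have na: "admissible K p (\<lambda>x. - a x)" "fidelity K p (\<lambda>x. - a x) = fidelity K p a"
      using fidelity_cmult[OF p ab(3), of "-1"] by simp_all
    have eq: "(\<lambda>y. h y - (a y + w y)) = (\<lambda>y. (h y - w y) + - a y)" by (simp add: fun_eq_iff)
    have ad: "admissible K p (\<lambda>y. h y - (a y + w y))"
      unfolding eq by (rule fidelity_add(1)[OF p w(2) na(1)])
    have fi: "fidelity K p (\<lambda>y. h y - (a y + w y)) \<le> fidelity K p (\<lambda>y. h y - w y) + \<delta>"
      unfolding eq using fidelity_add(2)[OF p w(2) na(1)] na(2) ab(4) by simp
    have "tv v + lam * fidelity K p h \<le> tv (\<lambda>x. v x + (a x + w x)) + lam * fidelity K p (\<lambda>y. h y - (a y + w y))"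
      using v(1) aw ad by (simp add: optimal_residual_def)
    also have "(\<lambda>x. v x + (a x + w x)) = (\<lambda>x. (\<xi> x + w x) + - b x)" using v(2) by (simp add: fun_eq_iff)
    also have "tv (\<lambda>x. (\<xi> x + w x) + - b x) \<le> tv (\<lambda>x. \<xi> x + w x) + tv (\<lambda>x. - b x)"
      using \<xi> w ab by (intro BV_add BV_uminus)
    also have "tv (\<lambda>x. - b x) \<le> tv b"
      using var_outside_uminus[of "-1" b] ab(2) by (intro tv_leI) (simp add: var_outside_BV)
    finally have "tv v + lam * fidelity K p h \<le> tv (\<lambda>x. \<xi> x + w x) + \<delta> + lam * (fidelity K p (\<lambda>y. h y - w y) + \<delta>)"
      using ab(5) mult_left_mono[OF fi, of lam] lam by linarith
    then show "tv \<xi> + lam * fidelity K p h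
        \<le> tv (\<lambda>x. \<xi> x + w x) + lam * fidelity K p (\<lambda>y. h y - w y) + \<epsilon>"
      using ab(6) \<delta>(2) by (simp add: algebra_simps)
  qed
qed

lemma energy_eq:
  assumes p: "1 \<le> p" and lam: "lam > 0" and u: "u \<in> BV"
  shows "energy K p lam f u = (if admissible K p (\<lambda>y. f y - u y)
    then ereal (tv u + lam * fidelity K p (\<lambda>y. f y - u y)) else \<infinity>)"
  using lam u by (auto simp: energy_def admissible_def fidelity_def lp_norm_def Lp_size_def bv_seminorm_BV)

lemma Mset_iff:
  assumes p: "1 \<le> p" and lam: "lam > 0"
  shows "u \<in> Mset K p lam \<longleftrightarrow> (\<exists>h. admissible K p h \<and> optimal_residual K p lam h u)"
proof
  assume "u \<in> Mset K p lam"
  then obtain f where f: "u \<in> BV" "energy K p lam f u < \<infinity>" "\<And>v. v \<in> BV \<Longrightarrow> energy K p lam f u \<le> energy K p lam f v"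
    by (auto simp: Mset_def minimizers_def)
  have h: "admissible K p (\<lambda>y. f y - u y)"
    using f(2) by (auto simp: energy_eq[OF p lam f(1)] split: if_splits)
  have "optimal_residual K p lam (\<lambda>y. f y - u y) u"
    unfolding optimal_residual_def
  proof (intro conjI ballI impI f(1))
    fix w :: "'a \<Rightarrow> real" assume w: "w \<in> BV" "admissible K p (\<lambda>y. f y - u y - w y)"
    have uw: "(\<lambda>x. u x + w x) \<in> BV" using f(1) w(1) by (rule BV_add)
    from f(3)[OF uw] show "tv u + lam * fidelity K p (\<lambda>y. f y - u y)
        \<le> tv (\<lambda>x. u x + w x) + lam * fidelity K p (\<lambda>y. f y - u y - w y)"
      using h w(2) by (simp add: energy_eq[OF p lam f(1)] energy_eq[OF p lam uw] diff_diff_eq)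
  qed
  with h show "\<exists>h. admissible K p h \<and> optimal_residual K p lam h u" by blast
next
  assume "\<exists>h. admissible K p h \<and> optimal_residual K p lam h u"
  then obtain h where h: "admissible K p h" "optimal_residual K p lam h u" by blast
  then have u: "u \<in> BV" by (simp add: optimal_residual_def)
  define f where "f y = u y + h y" for y
  have fu: "(\<lambda>y. f y - u y) = h" by (simp add: f_def)
  have E: "energy K p lam f u = ereal (tv u + lam * fidelity K p h)"
    using h(1) by (simp add: energy_eq[OF p lam u] fu)
  have "energy K p lam f u \<le> energy K p lam f v" if v: "v \<in> BV" for v
  proof (cases "admissible K p (\<lambda>y. f y - v y)")
    case True
    have w: "(\<lambda>x. v x - u x) \<in> BV" using v u by (rule BV_diff)
    have eq: "(\<lambda>y. h y - (v y - u y)) = (\<lambda>y. f y - v y)" by (simp add: f_def fun_eq_iff)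
    have "tv u + lam * fidelity K p h \<le> tv (\<lambda>x. u x + (v x - u x)) + lam * fidelity K p (\<lambda>y. h y - (v y - u y))"
      using conjunct2[OF h(2)[unfolded optimal_residual_def], rule_format, OF w] True by (simp only: eq)
    then show ?thesis using True by (simp add: E energy_eq[OF p lam v] eq)
  qed (simp add: energy_eq[OF p lam v])
  then have "u \<in> minimizers K p lam f" using u E by (simp add: minimizers_def)
  then show "u \<in> Mset K p lam" by (auto simp: Mset_def)
qed

subsection \<open>Approximation of superlevel sets\<close>

text \<open>A field that almost attains the seminorm has compact support. A field vanishing on a
  larger ball can be added to it without exceeding norm 1, because the supports do not overlap, so
  it can gain at most the deficit \<open>\<delta>\<close>.\<close>

lemma var_outside_tendsto_zero:
  fixes u :: "'a::euclidean_space \<Rightarrow> real"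
  assumes u: "u \<in> BV" and \<delta>: "\<delta> > 0"
  shows "\<exists>r. \<forall>R\<ge>r. var_outside R u \<le> ereal \<delta>"
proof -
  have "ereal (tv u - \<delta>) < (SUP \<phi>\<in>fields_outside (-1). ereal (LINT x|lborel. u x * divergence \<phi> x))"
    using var_outside_BV[OF u] \<delta> by (simp add: var_outside_def)
  then obtain \<phi>1 where \<phi>1: "\<phi>1 \<in> fields_outside (-1)" "tv u - \<delta> < (LINT x|lborel. u x * divergence \<phi>1 x)"
    by (auto simp: less_SUP_iff)
  obtain D1 r where D1: "\<And>x. (\<phi>1 has_derivative D1 x) (at x)"
    "\<And>b. b \<in> Basis \<Longrightarrow> continuous_on UNIV (\<lambda>x. D1 x b)" "\<And>x. norm x > r \<Longrightarrow> \<phi>1 x = 0"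
    "\<And>x. norm (\<phi>1 x) \<le> 1" "divergence \<phi>1 = (\<lambda>x. \<Sum>b\<in>Basis. D1 x b \<bullet> b)"
    by (rule test_fieldE[OF fields_outside_test[OF \<phi>1(1)]]) blast
  have "var_outside R u \<le> ereal \<delta>" if R: "R \<ge> r" for R
  proof (rule var_outside_leI)
    fix \<phi>2 :: "'a \<Rightarrow> 'a" assume \<phi>2: "\<phi>2 \<in> fields_outside R"
    then obtain s where s: "s > R" "\<And>x. x \<in> ball 0 s \<Longrightarrow> \<phi>2 x = 0" by (auto simp: fields_outside_def)
    obtain D2 t where D2: "\<And>x. (\<phi>2 has_derivative D2 x) (at x)"
      "\<And>b. b \<in> Basis \<Longrightarrow> continuous_on UNIV (\<lambda>x. D2 x b)" "\<And>x. norm x > t \<Longrightarrow> \<phi>2 x = 0"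
      "\<And>x. norm (\<phi>2 x) \<le> 1" "divergence \<phi>2 = (\<lambda>x. \<Sum>b\<in>Basis. D2 x b \<bullet> b)"
      by (rule test_fieldE[OF fields_outside_test[OF \<phi>2]]) blast
    have d: "((\<lambda>x. \<phi>1 x + \<phi>2 x) has_derivative (\<lambda>v. D1 x v + D2 x v)) (at x)" for x
      by (rule has_derivative_add[OF D1(1) D2(1)])
    have c: "continuous_on UNIV (\<lambda>x. D1 x b + D2 x b)" if "b \<in> Basis" for b
      by (rule continuous_on_add[OF D1(2)[OF that] D2(2)[OF that]])
    have z: "\<phi>1 x + \<phi>2 x = 0" if "norm x > max r t" for x using that D1(3) D2(3) by simp
    have n: "norm (\<phi>1 x + \<phi>2 x) \<le> 1" for x
      using D1(3)[of x] D1(4)[of x] D2(4)[of x] s(2)[of x] s(1) R by (cases "norm x > r") auto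
    have f: "(\<lambda>x. \<phi>1 x + \<phi>2 x) \<in> fields_outside (-1)"
      using test_fieldI(1)[where r="max r t", OF d c z n] by (auto simp: fields_outside_def intro!: exI[of _ 0])
    have "divergence (\<lambda>x. \<phi>1 x + \<phi>2 x) x = divergence \<phi>1 x + divergence \<phi>2 x" for x
      using test_fieldI(2)[where r="max r t", OF d c z n] by (simp add: D1(5) D2(5) inner_add_left sum.distrib)
    then have "(LINT x|lborel. u x * divergence (\<lambda>x. \<phi>1 x + \<phi>2 x) x)
        = (LINT x|lborel. u x * divergence \<phi>1 x) + (LINT x|lborel. u x * divergence \<phi>2 x)"
      using test_field_integrable[OF BV_loc_integrable[OF u]] fields_outside_test[OF \<phi>1(1)] fields_outside_test[OF \<phi>2]
      by (simp add: distrib_left)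
    moreover have "(LINT x|lborel. u x * divergence (\<lambda>x. \<phi>1 x + \<phi>2 x) x) \<le> tv u"
      using var_outside_upper[OF f, of u] var_outside_BV[OF u] by simp
    ultimately show "ereal (LINT x|lborel. u x * divergence \<phi>2 x) \<le> ereal \<delta>" using \<phi>1(2) by simp
  qed
  then show ?thesis by blast
qed

text \<open>After a shift by \<open>h\<close> the bulk of the two integrals cancels, and what
  remains is an interval of length \<open>h\<close> at the right end, where
  \<open>G \<le> V\<close>. The bound depends neither on \<open>h\<close>, as Fatou's lemma wants,
  nor on \<open>m\<close>.\<close>

lemma difference_quotient_integral_le:
  fixes G :: "real \<Rightarrow> real"
  assumes G: "mono G" "\<And>t. 0 \<le> G t" "\<And>t. G t \<le> V" and h: "h > 0"
  shows "(\<integral>\<^sup>+t. ennreal ((G (t + h) - G t) / h) * indicator {-m..m} t \<partial>lborel) \<le> ennreal V"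
proof -
  have [measurable]: "G \<in> borel_measurable borel" using G(1) by (rule borel_measurable_mono)
  have lG: "loc_integrable G" using G(2,3) by (intro loc_integrable_bounded[of _ V]) auto
  have V: "V \<ge> 0" using G(2,3)[of 0] by linarith
  have ii: "integrable lborel (\<lambda>t. indicator {a..b} t * G t)" for a b
    using lG by (simp add: loc_integrable_def set_integrable_def)
  have ic: "integrable lborel (\<lambda>t. indicator {a..b} t * c)" for a b c :: real
    using integrable_indicator_compact[of "{a..b}"] by simp
  define F where "F s = indicator {-m + h..m + h} s * G s" for s
  have Feq: "F (t + h) = indicator {-m..m} t * G (t + h)" for t
    by (auto simp: F_def indicator_def)
  have Fm: "F \<in> borel_measurable borel" unfolding F_def[abs_def] by measurable
  have "integrable lborel F" unfolding F_def[abs_def] by (rule ii)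
  then have iF: "integrable lborel (\<lambda>t. indicator {-m..m} t * G (t + h))"
    using lborel_integral_translate(2)[OF Fm, of h] by (simp only: Feq)
  have "(LINT t|lborel. indicator {-m..m} t * G (t + h)) = (LINT t|lborel. F t)"
    using lborel_integral_translate(1)[OF Fm, of h] by (simp only: Feq)
  also have "\<dots> \<le> (LINT t|lborel. indicator {-m..m} t * G t + indicator {m..m + h} t * V)"
    using ii ic G(2,3) V h by (intro integral_mono) (auto simp: F_def indicator_def)
  also have "\<dots> = (LINT t|lborel. indicator {-m..m} t * G t) + h * V"
    using ii ic h by simp
  finally have *: "(LINT t|lborel. indicator {-m..m} t * G (t + h)) \<le> (LINT t|lborel. indicator {-m..m} t * G t) + h * V" .
  have "(\<integral>\<^sup>+t. ennreal ((G (t + h) - G t) / h) * indicator {-m..m} t \<partial>lborel)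
      = (\<integral>\<^sup>+t. ennreal ((indicator {-m..m} t * G (t + h) - indicator {-m..m} t * G t) / h) \<partial>lborel)"
    by (intro nn_integral_cong) (auto simp: indicator_def)
  also have "\<dots> = ennreal (LINT t|lborel. (indicator {-m..m} t * G (t + h) - indicator {-m..m} t * G t) / h)"
    using iF ii h monoD[OF G(1)] by (intro nn_integral_eq_integral) (auto simp: indicator_def)
  also have "\<dots> \<le> ennreal V"
    using * iF ii h by (intro ennreal_leI) (simp add: field_simps)
  finally show ?thesis .
qed

text \<open>The clamp of \<open>real (Suc n) * (u x - t)\<close> to [0,1], a ramp in place of the
  jump of the indicator. It is written as a difference of truncations because the splitting of the
  variation applies to these.\<close>

definition band :: "('a \<Rightarrow> real) \<Rightarrow> real \<Rightarrow> nat \<Rightarrow> 'a \<Rightarrow> real" where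
  "band u t n x = real (Suc n) * (min (u x) (t + 1 / real (Suc n)) - min (u x) t)"

lemma band_bounds: "0 \<le> band u t n x" "band u t n x \<le> 1"
proof -
  have "min (u x) t \<le> min (u x) (t + 1 / real (Suc n))" by (intro min.mono) simp_all
  then show "0 \<le> band u t n x" unfolding band_def by (intro mult_nonneg_nonneg) simp_all
  have "min a (t + h) - min a t \<le> h" if "0 < h" for a h :: real using that by (simp add: min_def)
  then have "min (u x) (t + 1 / real (Suc n)) - min (u x) t \<le> 1 / real (Suc n)" by simp
  from mult_left_mono[OF this, of "real (Suc n)"] show "band u t n x \<le> 1" by (simp add: band_def)
qed

lemma band_tendsto: "(\<lambda>n. band u t n x) \<longlonglongrightarrow> indicator (superlevel u t) x"
proof (cases "u x > t")
  case True
  then obtain N where N: "1 / real (Suc N) < u x - t" using nat_approx_posE[of "u x - t"] by auto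
  have "band u t n x = 1" if "n \<ge> N" for n
  proof -
    have "1 / real (Suc n) \<le> 1 / real (Suc N)" using that by (intro divide_left_mono) auto
    then have "t + 1 / real (Suc n) < u x" using N by linarith
    then show ?thesis using True by (simp add: band_def min_def)
  qed
  then have "\<forall>\<^sub>F n in sequentially. band u t n x = 1" by (auto simp: eventually_sequentially)
  then show ?thesis using True by (simp add: superlevel_def tendsto_eventually)
next
  case False
  have "band u t n x = 0" for n using False by (simp add: band_def min_def add_increasing2)
  then show ?thesis using False by (simp add: superlevel_def)
qed

lemma measurable_band:
  assumes [measurable]: "u \<in> borel_measurable borel" shows "band u t n \<in> borel_measurable borel"
  unfolding band_def[abs_def] by measurable

lemma measurable_superlevel:
  assumes [measurable]: "u \<in> borel_measurable borel" shows "superlevel u t \<in> sets borel"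
  unfolding superlevel_def by measurable

lemma loc_integrable_band: "u \<in> borel_measurable borel \<Longrightarrow> loc_integrable (band u t n)"
  using band_bounds[of u t n] by (intro loc_integrable_bounded[of _ 1] measurable_band) auto

lemma loc_integrable_superlevel:
  "u \<in> borel_measurable borel \<Longrightarrow> loc_integrable (indicator (superlevel u t))"
  using measurable_superlevel[of u t] by (intro loc_integrable_bounded[of _ 1]) (auto simp: indicator_def)

lemma band_L1_loc:
  fixes u :: "'a::euclidean_space \<Rightarrow> real"
  assumes u: "u \<in> borel_measurable borel" and \<kappa>: "\<kappa> > 0"
  shows "\<forall>\<^sub>F n in sequentially. (LINT x:cball 0 r|lborel. \<bar>indicator (superlevel u t) x - band u t n x\<bar>) \<le> \<kappa>"
proof -
  let ?f = "\<lambda>n x. indicator (cball 0 r) x * \<bar>indicator (superlevel u t) x - band u t n x\<bar>"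
  have "(\<lambda>n. LINT x|lborel. ?f n x) \<longlonglongrightarrow> (LINT x|(lborel :: 'a measure). 0)"
  proof (rule integral_dominated_convergence[where w="indicator (cball 0 r)"])
    show "integrable lborel (indicator (cball 0 r) :: 'a \<Rightarrow> real)" by (rule integrable_indicator_compact) simp
    show "AE x in lborel. (\<lambda>n. ?f n x) \<longlonglongrightarrow> 0"
    proof (rule AE_I2)
      fix x
      have "(\<lambda>n. ?f n x) \<longlonglongrightarrow> indicator (cball 0 r) x * \<bar>indicator (superlevel u t) x - indicator (superlevel u t) x\<bar>"
        by (intro tendsto_intros band_tendsto)
      then show "(\<lambda>n. ?f n x) \<longlonglongrightarrow> 0" by simp
    qed
    show "AE x in lborel. norm (?f n x) \<le> indicator (cball 0 r) x" for n
    proof (rule AE_I2)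
      fix x
      have "\<bar>indicator (superlevel u t) x - band u t n x\<bar> \<le> 1"
        using band_bounds[of u t n x] by (auto simp: indicator_def)
      then show "norm (?f n x) \<le> indicator (cball 0 r) x" by (simp add: indicator_def)
    qed
    show "?f n \<in> borel_measurable lborel" for n
      using measurable_band[OF u, of t n] measurable_superlevel[OF u, of t]
      by (intro borel_measurable_times borel_measurable_abs borel_measurable_diff borel_measurable_indicator) auto
  qed simp
  then have "(\<lambda>n. LINT x|lborel. ?f n x) \<longlonglongrightarrow> 0" by simp
  from order_tendstoD(2)[OF this \<kappa>] show ?thesis
    by (rule eventually_mono) (simp add: set_lebesgue_integral_def)
qed

text \<open>Corresponds to the integral, over the levels below \<open>t\<close>, of the perimeters
  of the superlevel sets outside the ball; its difference quotients stand in for the perimeter at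
  level \<open>t\<close>.\<close>

definition trunc_var :: "real \<Rightarrow> ('a::euclidean_space \<Rightarrow> real) \<Rightarrow> real \<Rightarrow> real" where
  "trunc_var R u t = real_of_ereal (var_outside R (\<lambda>x. min (u x) t))"

lemma mono_min: "mono (\<lambda>s::real. min s t)" "mono (\<lambda>s::real. s - min s t)"
  by (auto simp: mono_def min_def)

text \<open>Truncating at \<open>t\<close> and then at a lower \<open>s\<close> is truncating at
  \<open>s\<close>, so splitting \<open>min (u x) t\<close> at \<open>s\<close> leaves the slab
  between the two levels. The variation of a slab is therefore at most an increment of
  \<open>trunc_var\<close>, and monotonicity follows since it is nonnegative.\<close>

lemma trunc_var:
  fixes u :: "'a::euclidean_space \<Rightarrow> real"
  assumes u: "loc_integrable u" and V: "var_outside R u = ereal V"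
  shows "var_outside R (\<lambda>x. min (u x) t) = ereal (trunc_var R u t)"
    and "0 \<le> trunc_var R u t" and "trunc_var R u t \<le> V"
    and "s \<le> t \<Longrightarrow> var_outside R (\<lambda>x. min (u x) t - min (u x) s) \<le> ereal (trunc_var R u t - trunc_var R u s)"
    and "mono (trunc_var R u)"
proof -
  have le: "var_outside R (\<lambda>x. min (u x) t) \<le> ereal V" for t
  proof -
    have "var_outside R (\<lambda>x. min (u x) t) + 0 \<le> var_outside R (\<lambda>x. min (u x) t) + var_outside R (\<lambda>x. u x - min (u x) t)"
      by (intro add_left_mono var_outside_nonneg)
    with var_outside_superadditive[OF u mono_min[of t], of R] V show ?thesis by simp
  qed
  show eq: "var_outside R (\<lambda>x. min (u x) t) = ereal (trunc_var R u t)" for t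
    using le[of t] var_outside_nonneg[of R "\<lambda>x. min (u x) t"] unfolding trunc_var_def
    by (cases "var_outside R (\<lambda>x. min (u x) t)") auto
  show "0 \<le> trunc_var R u t" "trunc_var R u t \<le> V"
    using le[of t] var_outside_nonneg[of R "\<lambda>x. min (u x) t"] by (simp_all add: eq)
  have diff: "var_outside R (\<lambda>x. min (u x) t - min (u x) s) \<le> ereal (trunc_var R u t - trunc_var R u s)"
    if "s \<le> t" for s t
  proof -
    have "var_outside R (\<lambda>x. min (min (u x) t) s) + var_outside R (\<lambda>x. min (u x) t - min (min (u x) t) s)
        \<le> var_outside R (\<lambda>x. min (u x) t)"
      by (rule var_outside_superadditive[OF loc_integrable_compose[OF u mono_min] mono_min])
    moreover have "min (min (u x) t) s = min (u x) s" for x using that by auto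
    ultimately have "ereal (trunc_var R u s) + var_outside R (\<lambda>x. min (u x) t - min (u x) s) \<le> ereal (trunc_var R u t)"
      by (simp add: eq)
    then show ?thesis by (cases "var_outside R (\<lambda>x. min (u x) t - min (u x) s)") auto
  qed
  then show "s \<le> t \<Longrightarrow> var_outside R (\<lambda>x. min (u x) t - min (u x) s) \<le> ereal (trunc_var R u t - trunc_var R u s)" .
  show "mono (trunc_var R u)"
    using order_trans[OF var_outside_nonneg diff] by (auto intro!: monoI)
qed

lemma var_outside_band_le:
  fixes u :: "'a::euclidean_space \<Rightarrow> real"
  assumes u: "loc_integrable u" and V: "var_outside R u = ereal V"
  shows "var_outside R (band u t n)
    \<le> ereal ((trunc_var R u (t + 1 / real (Suc n)) - trunc_var R u t) / (1 / real (Suc n)))"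
proof -
  have "var_outside R (band u t n)
      \<le> ereal (real (Suc n)) * var_outside R (\<lambda>x. min (u x) (t + 1 / real (Suc n)) - min (u x) t)"
    unfolding band_def[abs_def] by (rule var_outside_cmult_nonneg) simp
  also have "\<dots> \<le> ereal (real (Suc n)) * ereal (trunc_var R u (t + 1 / real (Suc n)) - trunc_var R u t)"
    by (intro ereal_mult_left_mono trunc_var(4)[OF u V]) auto
  finally show ?thesis by (simp add: mult.commute)
qed

text \<open>Fatou's lemma bounds only a lower limit, whence infinitely many indices rather than all
  large ones.\<close>

lemma frequently_band_var:
  fixes u :: "'a::euclidean_space \<Rightarrow> real"
  assumes u: "loc_integrable u" and V: "var_outside R u = ereal V" and c: "0 < c"
    and lim: "liminf (\<lambda>n. ennreal ((trunc_var R u (t + 1 / real (Suc n)) - trunc_var R u t) / (1 / real (Suc n)))) < ennreal c"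
  shows "\<exists>\<^sub>F n in sequentially. var_outside R (band u t n) \<le> ereal c"
proof (rule ccontr)
  assume "\<not> (\<exists>\<^sub>F n in sequentially. var_outside R (band u t n) \<le> ereal c)"
  then have ev: "\<forall>\<^sub>F n in sequentially. \<not> var_outside R (band u t n) \<le> ereal c" by (simp add: not_frequently)
  have "ennreal c \<le> liminf (\<lambda>n. ennreal ((trunc_var R u (t + 1 / real (Suc n)) - trunc_var R u t) / (1 / real (Suc n))))"
  proof (rule Liminf_bounded, rule eventually_mono[OF ev])
    fix n assume "\<not> var_outside R (band u t n) \<le> ereal c"
    then have "ereal c < ereal ((trunc_var R u (t + 1 / real (Suc n)) - trunc_var R u t) / (1 / real (Suc n)))"
      using var_outside_band_le[OF u V, of t n] by (meson not_le order.strict_trans2)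
    then show "ennreal c \<le> ennreal ((trunc_var R u (t + 1 / real (Suc n)) - trunc_var R u t) / (1 / real (Suc n)))"
      by (intro ennreal_leI) simp
  qed
  with lim show False by simp
qed

text \<open>The bound on the variation holds infinitely often and closeness on a given ball
  eventually, so some index has both; lower semicontinuity does the rest.\<close>

lemma frequently_band_lsc:
  fixes u :: "'a::euclidean_space \<Rightarrow> real"
  assumes u: "u \<in> borel_measurable borel"
    and f: "\<exists>\<^sub>F n in sequentially. var_outside R (band u t n) \<le> ereal c"
  shows "var_outside R (indicator (superlevel u t)) \<le> ereal c"
proof (rule var_outside_lsc[OF loc_integrable_superlevel[OF u]])
  fix \<kappa> r :: real assume \<kappa>: "\<kappa> > 0"
  obtain n where "var_outside R (band u t n) \<le> ereal c"
    "(LINT x:cball 0 r|lborel. \<bar>indicator (superlevel u t) x - band u t n x\<bar>) \<le> \<kappa>"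
    using frequently_eventually_conj[OF f band_L1_loc[OF u \<kappa>, of r t]] by (auto dest!: frequently_ex)
  then show "\<exists>v. loc_integrable v \<and> var_outside R v \<le> ereal c \<and>
      (LINT x:cball 0 r|lborel. \<bar>v x - indicator (superlevel u t) x\<bar>) \<le> \<kappa>"
    by (intro exI[of _ "band u t n"]) (simp add: loc_integrable_band[OF u] abs_minus_commute)
qed

text \<open>The index \<open>n\<close> exists only infinitely often and depends on the level, so combinations of several
  levels use a different \<open>n\<close> for each; the radius \<open>R\<close> can be enlarged to a common one.\<close>

definition good_level :: "('a::euclidean_space \<Rightarrow> real) \<Rightarrow> real \<Rightarrow> bool" where
  "good_level u t \<longleftrightarrow> (indicator (superlevel u t) :: 'a \<Rightarrow> real) \<in> BV \<and>
     (\<forall>\<delta>>0. \<exists>R\<ge>0. \<forall>\<kappa>>0. \<forall>r. \<exists>n.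
        var_outside R (\<lambda>x. indicator (superlevel u t) x - band u t n x) \<le> ereal \<delta> \<and>
        (LINT x:cball 0 r|lborel. \<bar>indicator (superlevel u t) x - band u t n x\<bar>) \<le> \<kappa>)"

text \<open>Two exceptional null sets suffice. Where \<open>L (-1) t\<close> is finite, lower
  semicontinuity puts the indicator of the superlevel set into \<open>BV\<close>; where the infimum
  of \<open>L\<close> over integer radii is 0, every \<open>\<delta>\<close> finds a radius, without
  a null set of its own.\<close>

lemma AE_good_level:
  fixes u :: "'a::euclidean_space \<Rightarrow> real"
  assumes uB: "u \<in> BV"
  shows "AE t in lborel. good_level u t"
proof -
  have u: "loc_integrable u" using uB by (rule BV_loc_integrable)
  have um: "u \<in> borel_measurable borel" using u by (rule loc_integrable_measurable)
  define V where "V R = real_of_ereal (var_outside R u)" for R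
  have V: "var_outside R u = ereal (V R)" if "R \<ge> -1" for R
    using var_outside_antimono[OF that, of u] var_outside_BV[OF uB] var_outside_nonneg[of R u]
    unfolding V_def by (cases "var_outside R u") auto
  define Q where "Q R n t = ennreal ((trunc_var R u (t + 1 / real (Suc n)) - trunc_var R u t) / (1 / real (Suc n)))" for R n t
  define L where "L R t = liminf (\<lambda>n. Q R n t)" for R t
  have Qm: "Q R n \<in> borel_measurable lborel" if "R \<ge> -1" for R n
  proof -
    have [measurable]: "trunc_var R u \<in> borel_measurable borel"
      using trunc_var(5)[OF u V[OF that]] by (rule borel_measurable_mono)
    show ?thesis unfolding Q_def[abs_def] by measurable
  qed
  have Lm: "L R \<in> borel_measurable lborel" if "R \<ge> -1" for R
    unfolding L_def[abs_def] by (intro borel_measurable_liminf Qm[OF that])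
  have LV: "(\<integral>\<^sup>+t. L R t * indicator {-m..m} t \<partial>lborel) \<le> ennreal (V R)" if R: "R \<ge> -1" for R m
  proof -
    have "L R t * indicator {-m..m} t = liminf (\<lambda>n. Q R n t * indicator {-m..m} t)" for t
      by (simp add: L_def indicator_def Liminf_const)
    then have "(\<integral>\<^sup>+t. L R t * indicator {-m..m} t \<partial>lborel) = (\<integral>\<^sup>+t. liminf (\<lambda>n. Q R n t * indicator {-m..m} t) \<partial>lborel)"
      by simp
    also have "\<dots> \<le> liminf (\<lambda>n. \<integral>\<^sup>+t. Q R n t * indicator {-m..m} t \<partial>lborel)"
      by (intro nn_integral_liminf borel_measurable_times_ennreal Qm[OF R] borel_measurable_indicator) auto
    also have "\<dots> \<le> ennreal (V R)"
    proof (rule order_trans[OF Liminf_le_Limsup Limsup_bounded])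
      show "\<forall>\<^sub>F n in sequentially. (\<integral>\<^sup>+t. Q R n t * indicator {-m..m} t \<partial>lborel) \<le> ennreal (V R)"
        unfolding Q_def using trunc_var[OF u V[OF R]]
        by (intro always_eventually allI difference_quotient_integral_le) auto
    qed simp
    finally show ?thesis .
  qed
  have fin: "AE t in lborel. L (-1) t < \<infinity>"
  proof -
    have "AE t in lborel. L (-1) t * indicator {-real m..real m} t \<noteq> \<infinity>" for m
      using LV[of "-1" "real m"] Lm[of "-1"] by (intro nn_integral_noteq_infinite) (auto simp: top_unique)
    then have "AE t in lborel. \<forall>m. L (-1) t * indicator {-real m..real m} t \<noteq> \<infinity>" unfolding AE_all_countable by blast
    then show ?thesis
    proof (rule eventually_mono)
      fix t assume *: "\<forall>m. L (-1) t * indicator {-real m..real m} t \<noteq> \<infinity>"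
      obtain m where "\<bar>t\<bar> \<le> real m" using real_arch_simple by blast
      then have "t \<in> {-real m..real m}" by auto
      with *[rule_format, of m] show "L (-1) t < \<infinity>" by (simp add: less_top)
    qed
  qed
  have zero: "AE t in lborel. (INF k::nat. L (real k) t) = 0"
  proof -
    \<comment> \<open>The integral of the infimum is at most \<open>V (real k)\<close> for every
      \<open>k\<close>, and these bounds become arbitrarily small by
      \<open>var_outside_tendsto_zero\<close>.\<close>
    have "AE t in lborel. (INF k::nat. L (real k) t) * indicator {-real m..real m} t = 0" for m
    proof -
      have "(\<integral>\<^sup>+t. (INF k::nat. L (real k) t) * indicator {-real m..real m} t \<partial>lborel) \<le> 0"
      proof (rule ennreal_le_epsilon)
        fix \<delta> :: real assume "\<delta> > 0"
        from var_outside_tendsto_zero[OF uB this] obtain r where r: "\<And>R. R \<ge> r \<Longrightarrow> var_outside R u \<le> ereal \<delta>" by blast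
        obtain k where k: "r \<le> real k" using real_arch_simple by blast
        have "(\<integral>\<^sup>+t. (INF k::nat. L (real k) t) * indicator {-real m..real m} t \<partial>lborel)
            \<le> (\<integral>\<^sup>+t. L (real k) t * indicator {-real m..real m} t \<partial>lborel)"
          by (intro nn_integral_mono mult_right_mono INF_lower) auto
        also have "\<dots> \<le> ennreal (V (real k))" by (rule LV) simp
        also have "\<dots> \<le> ennreal \<delta>" using r[OF k] V[of "real k"] by (intro ennreal_leI) simp
        finally show "(\<integral>\<^sup>+t. (INF k::nat. L (real k) t) * indicator {-real m..real m} t \<partial>lborel) \<le> 0 + ennreal \<delta>"
          by simp
      qed
      moreover have "(\<lambda>t. (INF k::nat. L (real k) t) * indicator {-real m..real m} t) \<in> borel_measurable lborel"
        using Lm by (intro borel_measurable_times_ennreal borel_measurable_INF) auto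
      ultimately show ?thesis by (subst (asm) le_zero_eq, subst (asm) nn_integral_0_iff_AE) auto
    qed
    then have "AE t in lborel. \<forall>m. (INF k::nat. L (real k) t) * indicator {-real m..real m} t = 0" unfolding AE_all_countable by blast
    then show ?thesis
    proof (rule eventually_mono)
      fix t assume *: "\<forall>m. (INF k::nat. L (real k) t) * indicator {-real m..real m} t = 0"
      obtain m where "\<bar>t\<bar> \<le> real m" using real_arch_simple by blast
      then have "t \<in> {-real m..real m}" by auto
      with *[rule_format, of m] show "(INF k::nat. L (real k) t) = 0" by simp
    qed
  qed
  from fin zero show ?thesis
  proof eventually_elim
    case (elim t)
    let ?X = "indicator (superlevel u t) :: 'a \<Rightarrow> real"
    obtain c0 where "L (-1) t = ennreal c0" "c0 \<ge> 0" using elim(1) by (cases "L (-1) t") auto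
    then have "L (-1) t < ennreal (c0 + 1)" by (simp add: ennreal_lessI)
    then have "\<exists>\<^sub>F n in sequentially. var_outside (-1) (band u t n) \<le> ereal (c0 + 1)"
      using \<open>c0 \<ge> 0\<close> unfolding L_def Q_def by (intro frequently_band_var[OF u V]) auto
    from frequently_band_lsc[OF um this] have XB: "?X \<in> BV"
      by (rule BV_I[OF loc_integrable_superlevel[OF um]])
    have "\<exists>R\<ge>0. \<forall>\<kappa>>0. \<forall>r. \<exists>n. var_outside R (\<lambda>x. ?X x - band u t n x) \<le> ereal \<delta> \<and>
        (LINT x:cball 0 r|lborel. \<bar>?X x - band u t n x\<bar>) \<le> \<kappa>" if \<delta>: "\<delta> > 0" for \<delta>
    proof -
      \<comment> \<open>One half of \<open>\<delta>\<close> is for the band, the other for the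
        indicator, which inherits the bound of the bands by lower semicontinuity.\<close>
      have "(INF k::nat. L (real k) t) < ennreal (\<delta> / 2)" using elim(2) \<delta> by simp
      then obtain k :: nat where "L (real k) t < ennreal (\<delta> / 2)" by (auto simp: INF_less_iff)
      then have fr: "\<exists>\<^sub>F n in sequentially. var_outside (real k) (band u t n) \<le> ereal (\<delta> / 2)"
        using \<delta> unfolding L_def Q_def by (intro frequently_band_var[OF u V]) auto
      note X = frequently_band_lsc[OF um fr]
      show ?thesis
      proof (intro exI[of _ "real k"] conjI allI impI)
        fix \<kappa> r :: real assume \<kappa>: "\<kappa> > 0"
        obtain n where n: "var_outside (real k) (band u t n) \<le> ereal (\<delta> / 2)"
          "(LINT x:cball 0 r|lborel. \<bar>?X x - band u t n x\<bar>) \<le> \<kappa>"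
          using frequently_eventually_conj[OF fr band_L1_loc[OF um \<kappa>, of r t]] by (auto dest!: frequently_ex)
        have lb: "loc_integrable (\<lambda>x. - band u t n x)"
          using loc_integrable_cmult[OF loc_integrable_band[OF um, of t n], of "-1"] by simp
        have "var_outside (real k) (\<lambda>x. ?X x + - band u t n x)
            \<le> var_outside (real k) ?X + var_outside (real k) (\<lambda>x. - band u t n x)"
          by (rule var_outside_add[OF loc_integrable_superlevel[OF um] lb])
        also have "\<dots> \<le> ereal (\<delta> / 2) + ereal (\<delta> / 2)"
          using X order_trans[OF var_outside_uminus n(1)] by (rule add_mono)
        finally have "var_outside (real k) (\<lambda>x. ?X x - band u t n x) \<le> ereal \<delta>" by simp
        with n(2) show "\<exists>n. var_outside (real k) (\<lambda>x. ?X x - band u t n x) \<le> ereal \<delta> \<and>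
            (LINT x:cball 0 r|lborel. \<bar>?X x - band u t n x\<bar>) \<le> \<kappa>" by blast
      qed simp
    qed
    with XB show "good_level u t" by (simp add: good_level_def)
  qed
qed

subsection \<open>Combinations of superlevel sets\<close>

lemma loc_integrable_sum:
  assumes "\<And>j. j \<in> J \<Longrightarrow> loc_integrable (f j)"
  shows "loc_integrable (\<lambda>x. \<Sum>j\<in>J. f j x)"
  using assms by (induction J rule: infinite_finite_induct) (auto intro: loc_integrable_const loc_integrable_add)

lemma BV_sum:
  assumes "\<And>j. j \<in> J \<Longrightarrow> f j \<in> BV"
  shows "(\<lambda>x. \<Sum>j\<in>J. f j x) \<in> BV"
  using assms by (induction J rule: infinite_finite_induct) (auto intro: BV_zero BV_add)

lemma var_outside_sum:
  assumes "\<And>j. j \<in> J \<Longrightarrow> loc_integrable (f j)" "\<And>j. j \<in> J \<Longrightarrow> var_outside R (f j) \<le> ereal (g j)"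
  shows "var_outside R (\<lambda>x. \<Sum>j\<in>J. f j x) \<le> ereal (\<Sum>j\<in>J. g j)"
  using assms
proof (induction J rule: infinite_finite_induct)
  case (insert j J)
  have "var_outside R (\<lambda>x. f j x + (\<Sum>j\<in>J. f j x)) \<le> var_outside R (f j) + var_outside R (\<lambda>x. \<Sum>j\<in>J. f j x)"
    using insert.prems by (intro var_outside_add loc_integrable_sum) auto
  also have "\<dots> \<le> ereal (g j) + ereal (\<Sum>j\<in>J. g j)"
    using insert by (intro add_mono) auto
  finally show ?case using insert.hyps by simp
qed (auto intro!: var_outside_leI)

text \<open>\<open>\<phi>\<close> is a weighted mean of the truncation increments
  \<open>\<tau> j\<close>, all of which have slopes in [0,1]; hence \<open>\<phi>\<close> and its
  remainder are monotone whatever the levels and indices. Composition with \<open>\<phi>\<close>,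
  then scaling by the total weight \<open>s\<close>, yields the whole combination.\<close>

lemma optimal_residual_bands:
  fixes c t :: "nat \<Rightarrow> real"
  assumes p: "1 \<le> p" and lam: "lam > 0" and h: "admissible K p h"
    and u: "optimal_residual K p lam h u" and c: "\<And>j. j < m \<Longrightarrow> 0 \<le> c j"
  shows "optimal_residual K p lam h (\<lambda>x. \<Sum>j<m. c j * band u (t j) (N j) x)"
proof -
  define d where "d j = c j * real (Suc (N j))" for j
  have d: "0 \<le> d j" if "j < m" for j using c[OF that] by (simp add: d_def)
  define s where "s = (\<Sum>j<m. d j)"
  have s: "0 \<le> s" unfolding s_def using d by (intro sum_nonneg) auto
  define \<tau> where "\<tau> j y = min y (t j + 1 / real (Suc (N j))) - min y (t j)" for j and y :: real
  define \<phi> where "\<phi> y = (\<Sum>j<m. d j * \<tau> j y) / s" for y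
  have \<tau>: "\<tau> j y \<le> \<tau> j y'" "\<tau> j y' - \<tau> j y \<le> y' - y" if "y \<le> y'" for j y y'
  proof -
    have "0 < 1 / real (Suc (N j))" by simp
    then show "\<tau> j y \<le> \<tau> j y'" "\<tau> j y' - \<tau> j y \<le> y' - y"
      using that unfolding \<tau>_def min_def by (smt (verit))+
  qed
  have m1: "mono \<phi>"
    unfolding \<phi>_def using s d \<tau>(1) by (intro monoI divide_right_mono sum_mono mult_left_mono) auto
  have m2: "mono (\<lambda>y. y - \<phi> y)"
  proof (rule monoI)
    fix y y' :: real assume y: "y \<le> y'"
    have "\<phi> y' - \<phi> y = (\<Sum>j<m. d j * (\<tau> j y' - \<tau> j y)) / s"
      by (simp add: \<phi>_def right_diff_distrib sum_subtractf diff_divide_distrib)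
    also have "\<dots> \<le> (\<Sum>j<m. d j * (y' - y)) / s"
      using s d \<tau>(2)[OF y] by (intro divide_right_mono sum_mono mult_left_mono) auto
    also have "\<dots> = s * (y' - y) / s" by (simp add: s_def sum_distrib_right)
    also have "\<dots> \<le> y' - y" using y by (cases "s = 0") auto
    finally show "y - \<phi> y \<le> y' - \<phi> y'" by simp
  qed
  \<comment> \<open>If the total weight is 0, every weight is 0, and both sides vanish.\<close>
  have "s * \<phi> y = (\<Sum>j<m. d j * \<tau> j y)" for y
  proof (cases "s = 0")
    case True
    then have "\<forall>j\<in>{..<m}. d j = 0"
      unfolding s_def using d by (subst (asm) sum_nonneg_eq_0_iff) auto
    then show ?thesis using True by simp
  qed (simp add: \<phi>_def)
  moreover have "d j * \<tau> j (u x) = c j * band u (t j) (N j) x" for j x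
    by (simp add: d_def \<tau>_def band_def mult.assoc)
  ultimately have "(\<lambda>x. \<Sum>j<m. c j * band u (t j) (N j) x) = (\<lambda>x. s * \<phi> (u x))" by (simp add: fun_eq_iff)
  then show ?thesis
    using optimal_residual_scale[OF p lam h optimal_residual_compose[OF u m1 m2] s] by simp
qed

text \<open>The choices are nested: the radius \<open>R\<close> comes from the good levels, the
  cutoff and its gradient bound \<open>M\<close> from \<open>R\<close>, and only then the indices
  \<open>N\<close>, which must make the error small relative to \<open>M\<close>. This is why the
  radius in \<open>good_level\<close> precedes \<open>\<kappa>\<close>, \<open>r\<close> and
  \<open>n\<close>.\<close>

lemma optimal_residual_levels:
  fixes u :: "'a::euclidean_space \<Rightarrow> real" and c t :: "nat \<Rightarrow> real"
  assumes K: "admissible_kernel p K" and p: "1 \<le> p" and lam: "lam > 0" and h: "admissible K p h"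
    and u: "optimal_residual K p lam h u" and c: "\<And>j. j < m \<Longrightarrow> 0 \<le> c j"
    and t: "\<And>j. j < m \<Longrightarrow> good_level u (t j)"
  shows "optimal_residual K p lam h (\<lambda>x. \<Sum>j<m. c j * indicator (superlevel u (t j)) x)"
proof -
  define X where "X x = (\<Sum>j<m. c j * indicator (superlevel u (t j)) x)" for x
  have uB: "u \<in> BV" using u by (simp add: optimal_residual_def)
  have um: "u \<in> borel_measurable borel" using uB by (intro loc_integrable_measurable BV_loc_integrable)
  have XB: "X \<in> BV"
    unfolding X_def[abs_def] using c t by (intro BV_sum BV_cmult_nonneg) (auto simp: good_level_def)
  define S where "S = (\<Sum>j<m. c j)"
  have S: "0 \<le> S" unfolding S_def using c by (intro sum_nonneg) auto
  have "optimal_residual K p lam h X"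
  proof (rule optimal_residual_limit[OF p lam XB])
    fix \<delta> :: real assume \<delta>: "\<delta> > 0"
    \<comment> \<open>\<open>\<phi>0\<close> nearly attains \<open>tv X\<close>. It is fixed before
      the indices, so that testing \<open>v\<close> with it later shows that \<open>tv v\<close> is
      not much smaller than \<open>tv X\<close>.\<close>
    have "ereal (tv X - \<delta> / 2) < (SUP \<phi>\<in>fields_outside (-1). ereal (LINT x|lborel. X x * divergence \<phi> x))"
      using var_outside_BV[OF XB] \<delta> by (simp add: var_outside_def)
    then obtain \<phi>0 where \<phi>0: "\<phi>0 \<in> fields_outside (-1)" "tv X - \<delta> / 2 < (LINT x|lborel. X x * divergence \<phi>0 x)"
      by (auto simp: less_SUP_iff)
    obtain r0 M0 where D0: "M0 > 0" "continuous_on UNIV (divergence \<phi>0)" "\<And>x. norm x > r0 \<Longrightarrow> divergence \<phi>0 x = 0"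
      "\<And>x. norm (divergence \<phi>0 x) \<le> M0" by (rule test_fieldE[OF fields_outside_test[OF \<phi>0(1)]]) blast
    define \<delta>1 where "\<delta>1 = \<delta> / (2 * (S + 1))"
    have \<delta>1: "\<delta>1 > 0" "S * \<delta>1 \<le> \<delta> / 2" using \<delta> S by (auto simp: \<delta>1_def field_simps)
    have "\<forall>j\<in>{..<m}. \<exists>R\<ge>0. \<forall>\<kappa>>0. \<forall>r. \<exists>n.
        var_outside R (\<lambda>x. indicator (superlevel u (t j)) x - band u (t j) n x) \<le> ereal \<delta>1 \<and>
        (LINT x:cball 0 r|lborel. \<bar>indicator (superlevel u (t j)) x - band u (t j) n x\<bar>) \<le> \<kappa>"
      using t \<delta>1(1) by (auto simp: good_level_def)
    from bchoice[OF this] obtain \<rho> where "\<forall>j\<in>{..<m}. \<rho> j \<ge> 0 \<and> (\<forall>\<kappa>>0. \<forall>r. \<exists>n.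
        var_outside (\<rho> j) (\<lambda>x. indicator (superlevel u (t j)) x - band u (t j) n x) \<le> ereal \<delta>1 \<and>
        (LINT x:cball 0 r|lborel. \<bar>indicator (superlevel u (t j)) x - band u (t j) n x\<bar>) \<le> \<kappa>)" ..
    then have \<rho>: "\<And>j. j < m \<Longrightarrow> \<rho> j \<ge> 0" "\<And>j \<kappa> r. j < m \<Longrightarrow> \<kappa> > 0 \<Longrightarrow> \<exists>n.
        var_outside (\<rho> j) (\<lambda>x. indicator (superlevel u (t j)) x - band u (t j) n x) \<le> ereal \<delta>1 \<and>
        (LINT x:cball 0 r|lborel. \<bar>indicator (superlevel u (t j)) x - band u (t j) n x\<bar>) \<le> \<kappa>"
      by simp_all
    \<comment> \<open>As a common radius the sum serves as well as a maximum: it dominates every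
      nonnegative \<open>\<rho> j\<close> and makes sense for \<open>m = 0\<close> too.\<close>
    define R where "R = (\<Sum>j<m. \<rho> j)"
    have R: "R \<ge> 0" "\<And>j. j < m \<Longrightarrow> \<rho> j \<le> R"
      unfolding R_def using \<rho>(1) by (auto intro!: sum_nonneg member_le_sum)
    \<comment> \<open>The plateau reaches to \<open>R + 1\<close>, so \<open>1 - \<eta> x\<close>
      vanishes on a ball of radius strictly larger than \<open>R\<close>, as
      \<open>var_outside_mult\<close> requires.\<close>
    obtain \<eta> :: "'a \<Rightarrow> real" and g M where \<eta>: "\<And>x. (\<eta> has_derivative (\<lambda>v. g x \<bullet> v)) (at x)" "continuous_on UNIV g"
      "\<And>x. 0 \<le> \<eta> x" "\<And>x. \<eta> x \<le> 1" "\<And>x. norm x \<le> R + 1 \<Longrightarrow> \<eta> x = 1" "\<And>x. norm x > R + 1 + 1 \<Longrightarrow> \<eta> x = 0"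
      "\<And>x. norm x > R + 1 + 1 \<Longrightarrow> g x = 0" "\<And>x. norm (g x) \<le> M" "M > 0"
      by (rule smooth_cutoff_exists[of "R + 1"]) (use R(1) in auto)
    define r where "r = max r0 (R + 1 + 1)"
    \<comment> \<open>In this order: the gradient term in the variation of the outer part
      \<open>b\<close>, the test with \<open>\<phi>0\<close>, and the fidelity of the inner part
      \<open>a\<close>. The base \<open>S + 1\<close> in place of \<open>S\<close> keeps the divisor
      positive when all coefficients vanish.\<close>
    define \<kappa>2 where "\<kappa>2 = Min {\<delta> / (2 * M), \<delta> / (2 * M0), \<delta> powr p / (S + 1) powr (p - 1)}"
    have \<kappa>2: "\<kappa>2 > 0" "M * \<kappa>2 \<le> \<delta> / 2" "M0 * \<kappa>2 \<le> \<delta> / 2" "(S + 1) powr (p - 1) * \<kappa>2 \<le> \<delta> powr p"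
    proof -
      have Sp: "(S + 1) powr (p - 1) > 0" using S by simp
      show "\<kappa>2 > 0" unfolding \<kappa>2_def using \<delta> \<eta>(9) D0(1) Sp by simp
      have *: "\<kappa>2 \<le> \<delta> / (2 * M)" "\<kappa>2 \<le> \<delta> / (2 * M0)" "\<kappa>2 \<le> \<delta> powr p / (S + 1) powr (p - 1)"
        unfolding \<kappa>2_def by auto
      show "M * \<kappa>2 \<le> \<delta> / 2" using mult_left_mono[OF *(1), of M] \<eta>(9) by simp
      show "M0 * \<kappa>2 \<le> \<delta> / 2" using mult_left_mono[OF *(2), of M0] D0(1) by simp
      show "(S + 1) powr (p - 1) * \<kappa>2 \<le> \<delta> powr p"
        using mult_left_mono[OF *(3), of "(S + 1) powr (p - 1)"] Sp by simp
    qed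
    define \<kappa> where "\<kappa> = \<kappa>2 / (S + 1)"
    have \<kappa>: "\<kappa> > 0" "S * \<kappa> \<le> \<kappa>2" using \<kappa>2(1) S by (auto simp: \<kappa>_def field_simps)
    have "\<forall>j\<in>{..<m}. \<exists>n.
        var_outside (\<rho> j) (\<lambda>x. indicator (superlevel u (t j)) x - band u (t j) n x) \<le> ereal \<delta>1 \<and>
        (LINT x:cball 0 r|lborel. \<bar>indicator (superlevel u (t j)) x - band u (t j) n x\<bar>) \<le> \<kappa>"
      using \<rho>(2)[OF _ \<kappa>(1)] by simp
    from bchoice[OF this] obtain N where "\<forall>j\<in>{..<m}.
        var_outside (\<rho> j) (\<lambda>x. indicator (superlevel u (t j)) x - band u (t j) (N j) x) \<le> ereal \<delta>1 \<and>
        (LINT x:cball 0 r|lborel. \<bar>indicator (superlevel u (t j)) x - band u (t j) (N j) x\<bar>) \<le> \<kappa>" ..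
    then have N: "\<And>j. j < m \<Longrightarrow>
        var_outside (\<rho> j) (\<lambda>x. indicator (superlevel u (t j)) x - band u (t j) (N j) x) \<le> ereal \<delta>1"
      "\<And>j. j < m \<Longrightarrow> (LINT x:cball 0 r|lborel. \<bar>indicator (superlevel u (t j)) x - band u (t j) (N j) x\<bar>) \<le> \<kappa>"
      by simp_all
    define v where "v x = (\<Sum>j<m. c j * band u (t j) (N j) x)" for x
    have v: "optimal_residual K p lam h v"
      unfolding v_def by (rule optimal_residual_bands[OF p lam h u c])
    then have vB: "v \<in> BV" by (simp add: optimal_residual_def)
    define E where "E j x = indicator (superlevel u (t j)) x - band u (t j) (N j) x" for j x
    have lE: "loc_integrable (E j)" for j
      unfolding E_def[abs_def] by (intro loc_integrable_diff loc_integrable_superlevel loc_integrable_band um)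
    have Eb: "\<bar>E j x\<bar> \<le> 1" for j x
      using band_bounds[of u "t j" "N j" x] by (auto simp: E_def indicator_def)
    define D where "D x = X x - v x" for x
    have DE: "D = (\<lambda>x. \<Sum>j<m. c j * E j x)"
      by (simp add: fun_eq_iff D_def X_def v_def E_def right_diff_distrib sum_subtractf)
    have DB: "D \<in> BV" unfolding D_def[abs_def] by (rule BV_diff[OF XB vB])
    have lD: "loc_integrable D" using DB by (rule BV_loc_integrable)
    have D1: "\<bar>D x\<bar> \<le> S" for x
    proof -
      have "\<bar>D x\<bar> \<le> (\<Sum>j<m. \<bar>c j * E j x\<bar>)" unfolding DE by (rule sum_abs)
      also have "\<dots> \<le> (\<Sum>j<m. c j * 1)"
        using c Eb by (intro sum_mono) (simp add: abs_mult mult_left_le)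
      finally show ?thesis by (simp add: S_def)
    qed
    have varD: "var_outside R D \<le> ereal (S * \<delta>1)"
    proof -
      have "var_outside R (\<lambda>x. c j * E j x) \<le> ereal (c j * \<delta>1)" if j: "j < m" for j
      proof -
        have "var_outside R (E j) \<le> ereal \<delta>1"
          using order_trans[OF var_outside_antimono[OF R(2)[OF j], of "E j"]] N(1)[OF j] by (simp add: E_def[abs_def])
        from ereal_mult_left_mono[OF this, of "ereal (c j)"] var_outside_cmult_nonneg[OF c[OF j], of R "E j"] c[OF j]
        show ?thesis by (auto intro: order_trans)
      qed
      then have "var_outside R D \<le> ereal (\<Sum>j<m. c j * \<delta>1)"
        unfolding DE by (intro var_outside_sum loc_integrable_cmult lE) auto
      then show ?thesis by (simp add: S_def sum_distrib_right)
    qed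
    have intD: "(LINT x:cball 0 r|lborel. \<bar>D x\<bar>) \<le> \<kappa>2"
    proof -
      have "(LINT x:cball 0 r|lborel. \<bar>D x\<bar>) \<le> (LINT x:cball 0 r|lborel. (\<Sum>j<m. c j * \<bar>E j x\<bar>))"
      proof (rule set_integral_mono)
        show "set_integrable lborel (cball 0 r) (\<lambda>x. \<bar>D x\<bar>)"
          "set_integrable lborel (cball 0 r) (\<lambda>x. \<Sum>j<m. c j * \<bar>E j x\<bar>)"
          by (intro loc_integrable_cball loc_integrable_abs loc_integrable_sum loc_integrable_cmult lD lE)+
        show "\<bar>D x\<bar> \<le> (\<Sum>j<m. c j * \<bar>E j x\<bar>)" for x
          unfolding DE using c by (intro order_trans[OF sum_abs] sum_mono) (simp add: abs_mult)
      qed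
      also have "\<dots> = (\<Sum>j<m. c j * (LINT x:cball 0 r|lborel. \<bar>E j x\<bar>))"
        using loc_integrable_cball[OF loc_integrable_abs[OF lE], of 0 r]
        unfolding set_lebesgue_integral_def set_integrable_def
        by (simp add: sum_distrib_left mult.left_commute)
      also have "\<dots> \<le> (\<Sum>j<m. c j * \<kappa>)"
        using N(2) c by (intro sum_mono mult_left_mono) (auto simp: E_def)
      also have "\<dots> = S * \<kappa>" by (simp add: S_def sum_distrib_right)
      also have "\<dots> \<le> \<kappa>2" by (rule \<kappa>(2))
      finally show ?thesis .
    qed
    define a where "a x = \<eta> x * D x" for x
    define b where "b x = (1 - \<eta> x) * D x" for x
    have \<eta>c: "continuous_on UNIV \<eta>"
      using \<eta>(1) has_derivative_continuous by (fastforce simp: continuous_on_eq_continuous_at)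
    have \<eta>m: "\<eta> \<in> borel_measurable borel" using \<eta>c by (rule borel_measurable_continuous_onI)
    have Dm: "D \<in> borel_measurable borel" using lD by (rule loc_integrable_measurable)
    have la: "loc_integrable a"
      using D1 \<eta>(3,4) \<eta>m Dm S unfolding a_def[abs_def]
      by (intro loc_integrable_bounded[of _ S]) (auto simp: abs_mult intro: order_trans[OF mult_left_le_one_le])
    have gr: "g x = 0" if "norm x > r" for x using \<eta>(7) that by (simp add: r_def)
    \<comment> \<open>Only finiteness is wanted for the inner part; with \<open>s = 0\<close> the
      support condition of \<open>var_outside_mult\<close> is void.\<close>
    have "var_outside (-1) a \<le> var_outside (-1) D + ereal (M * (LINT x:cball 0 r|lborel. \<bar>D x\<bar>))"
      unfolding a_def[abs_def] by (rule var_outside_mult[where s=0, OF lD \<eta>(1-4) _ _ gr \<eta>(8)]) auto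
    then have aB: "a \<in> BV" using la by (intro BV_I) (auto simp: var_outside_BV[OF DB])
    have "var_outside (-1) b \<le> var_outside R D + ereal (M * (LINT x:cball 0 r|lborel. \<bar>D x\<bar>))"
      unfolding b_def[abs_def]
    proof (rule var_outside_mult[where s="R + 1" and g="\<lambda>x. - g x", OF lD])
      show "((\<lambda>x. 1 - \<eta> x) has_derivative (\<bullet>) (- g x)) (at x)" for x
        using has_derivative_diff[OF has_derivative_const[of 1] \<eta>(1)[of x]] by (simp flip: inner_minus_left)
      show "continuous_on UNIV (\<lambda>x. - g x)" using \<eta>(2) by (rule continuous_on_minus)
    qed (use \<eta> gr in auto)
    also have "\<dots> \<le> ereal (S * \<delta>1) + ereal (M * \<kappa>2)"
      using varD intD \<eta>(9) by (intro add_mono) auto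
    finally have bv: "var_outside (-1) b \<le> ereal \<delta>"
      using \<delta>1(2) \<kappa>2(2) by (auto intro: order_trans)
    have ab: "X x = v x + a x + b x" for x by (simp add: a_def b_def D_def algebra_simps)
    have "b = (\<lambda>x. D x - a x)" by (simp add: fun_eq_iff a_def b_def algebra_simps)
    then have bB: "b \<in> BV" using BV_diff[OF DB aB] by simp
    have ia: "integrable lborel a"
      using loc_integrable_mult(1)[OF lD \<eta>m, of 1 0 "R + 1 + 1"] \<eta>(3,4,6) by (simp add: a_def[abs_def] mult.commute)
    have "(LINT x|lborel. \<bar>a x\<bar>) \<le> (LINT x:cball 0 r|lborel. \<bar>D x\<bar>)"
      unfolding set_lebesgue_integral_def
    proof (rule integral_mono)
      show "integrable lborel (\<lambda>x. indicator (cball 0 r) x *\<^sub>R \<bar>D x\<bar>)"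
        using loc_integrable_cball[OF loc_integrable_abs[OF lD], of 0 r] by (simp only: set_integrable_def)
      show "\<bar>a x\<bar> \<le> indicator (cball 0 r) x *\<^sub>R \<bar>D x\<bar>" for x
        using \<eta>(3,4,6)[of x] by (auto simp: a_def r_def abs_mult indicator_def mult_left_le_one_le)
    qed (use ia in simp)
    with intD have Ia: "(LINT x|lborel. \<bar>a x\<bar>) \<le> \<kappa>2" by simp
    have a1: "\<bar>a x\<bar> \<le> S + 1" for x
      using mult_mono[OF \<eta>(4)[of x] D1[of x]] \<eta>(3)[of x] by (simp add: a_def abs_mult)
    note fa = fidelity_bounded[OF K p ia a1 Ia less_imp_le[OF \<kappa>2(1)]]
    have "fidelity K p a \<le> ((S + 1) powr (p - 1) * \<kappa>2) powr (1 / p)" by (rule fa(2))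
    also have "\<dots> \<le> (\<delta> powr p) powr (1 / p)"
      using \<kappa>2 p by (intro powr_mono2) auto
    also have "\<dots> = \<delta>" using \<delta> p by (simp add: powr_powr)
    finally have fid: "fidelity K p a \<le> \<delta>" .
    have "tv X - \<delta> \<le> tv v"
    proof -
      have "norm (LINT x|lborel. D x * divergence \<phi>0 x) \<le> M0 * (LINT x:cball 0 r|lborel. \<bar>D x\<bar>)"
        using D0 by (intro loc_integrable_mult(2)[OF lD] borel_measurable_continuous_onI) (auto simp: r_def)
      also have "\<dots> \<le> \<delta> / 2" using mult_left_mono[OF intD, of M0] D0(1) \<kappa>2(3) by linarith
      finally have "\<bar>LINT x|lborel. D x * divergence \<phi>0 x\<bar> \<le> \<delta> / 2" by simp
      moreover have "(LINT x|lborel. D x * divergence \<phi>0 x)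
          = (LINT x|lborel. X x * divergence \<phi>0 x) - (LINT x|lborel. v x * divergence \<phi>0 x)"
        using test_field_integrable[OF _ fields_outside_test[OF \<phi>0(1)]] BV_loc_integrable[OF XB] BV_loc_integrable[OF vB]
        by (simp add: D_def left_diff_distrib)
      moreover have "(LINT x|lborel. v x * divergence \<phi>0 x) \<le> tv v"
        using var_outside_upper[OF \<phi>0(1), of v] var_outside_BV[OF vB] by simp
      ultimately show ?thesis using \<phi>0(2) by linarith
    qed
    with v ab aB bB fa(1) fid tv_leI[OF bv]
    show "\<exists>v a b. optimal_residual K p lam h v \<and> (\<forall>x. X x = v x + a x + b x) \<and>
        a \<in> BV \<and> b \<in> BV \<and> admissible K p a \<and> fidelity K p a \<le> \<delta> \<and> tv b \<le> \<delta> \<and> tv X - \<delta> \<le> tv v"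
      by blast
  qed
  then show ?thesis by (simp add: X_def[abs_def])
qed

section \<open>Almost all tuples of levels, and the conclusion\<close>

lemma AE_PiM_lborel:
  fixes P :: "real \<Rightarrow> bool"
  assumes "AE t in lborel. P t" and I: "finite I" "i \<in> I"
  shows "AE t in PiM I (\<lambda>_. lborel). P (t i)"
proof -
  interpret product_sigma_finite "\<lambda>_::'i. lborel :: real measure" ..
  obtain N where N: "{t \<in> space lborel. \<not> P t} \<subseteq> N" "N \<in> sets lborel" "emeasure lborel N = 0"
    using assms(1) by (rule AE_E)
  \<comment> \<open>A cylinder with the null set \<open>N\<close> in the factor \<open>i\<close>.
    Its measure is 0 even though the other factors have infinite measure, because 0 times infinity
    is 0 in \<open>ennreal\<close>.\<close>
  let ?B = "PiE I (\<lambda>j. if j = i then N else UNIV)"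
  have "emeasure (PiM I (\<lambda>_. lborel)) ?B = (\<Prod>j\<in>I. emeasure lborel (if j = i then N else UNIV))"
    using I N(2) by (intro emeasure_PiM) auto
  also have "\<dots> = 0" using I N(3) by (auto intro!: prod_zero)
  finally have "emeasure (PiM I (\<lambda>_. lborel)) ?B = 0" .
  moreover have "?B \<in> sets (PiM I (\<lambda>_. lborel))" using I N(2) by (intro sets_PiM_I_finite) auto
  moreover have "{t \<in> space (PiM I (\<lambda>_. lborel)). \<not> P (t i)} \<subseteq> ?B"
    using N(1) I by (auto simp: space_PiM PiE_iff extensional_def)
  ultimately show ?thesis by (intro AE_I)
qed

theorem theorem3:
  fixes K u :: "'a::euclidean_space \<Rightarrow> real" and p lam :: real
  assumes "admissible_kernel p K" and "lam > 0" and "1 \<le> p"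
    and "u \<in> Mset K p lam" and "AE x in lborel. u x \<ge> 0"
  shows "(AE t in lborel. t > 0 \<longrightarrow> (indicator (superlevel u t) :: 'a \<Rightarrow> real) \<in> Mset K p lam)
       \<and> (\<forall>n (c :: nat \<Rightarrow> real). (\<forall>j<n. c j \<ge> 0) \<longrightarrow>
           (AE t in PiM {..<n} (\<lambda>_. lborel).
              (\<forall>i j. i < j \<and> j < n \<longrightarrow> t i < t j) \<longrightarrow>
              (\<lambda>x. \<Sum>j<n. c j * indicator (superlevel u (t j)) x) \<in> Mset K p lam))"
proof (intro conjI allI impI)
  obtain h where h: "admissible K p h" "optimal_residual K p lam h u"
    using assms(4) Mset_iff[OF assms(3,2)] by blast
  from h(2) have "u \<in> BV" unfolding optimal_residual_def by (rule conjunct1)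
  then have good: "AE t in lborel. good_level u t" by (rule AE_good_level)
  \<comment> \<open>All levels share the residual \<open>h\<close> found once for \<open>u\<close>.
    Part (a) is the case of one level with coefficient 1.\<close>
  have levels: "(\<lambda>x. \<Sum>j<m. c j * indicator (superlevel u (t j)) x) \<in> Mset K p lam"
    if "\<And>j. j < m \<Longrightarrow> 0 \<le> c j" "\<And>j. j < m \<Longrightarrow> good_level u (t j)" for m and c t :: "nat \<Rightarrow> real"
    unfolding Mset_iff[OF assms(3,2)]
    using h(1) optimal_residual_levels[OF assms(1,3,2) h that] by (intro exI conjI)
  from good show "AE t in lborel. t > 0 \<longrightarrow> (indicator (superlevel u t) :: 'a \<Rightarrow> real) \<in> Mset K p lam"
  proof (rule eventually_mono)
    fix t assume "good_level u t"
    then show "t > 0 \<longrightarrow> (indicator (superlevel u t) :: 'a \<Rightarrow> real) \<in> Mset K p lam"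
      using levels[of 1 "\<lambda>_. 1" "\<lambda>_. t"] by simp
  qed
  fix n and c :: "nat \<Rightarrow> real" assume c: "\<forall>j<n. 0 \<le> c j"
  have "AE t in PiM {..<n} (\<lambda>_. lborel). \<forall>j\<in>{..<n}. good_level u (t j)"
    by (intro AE_finite_allI AE_PiM_lborel[OF good]) auto
  then show "AE t in PiM {..<n} (\<lambda>_. lborel). (\<forall>i j. i < j \<and> j < n \<longrightarrow> t i < t j) \<longrightarrow>
      (\<lambda>x. \<Sum>j<n. c j * indicator (superlevel u (t j)) x) \<in> Mset K p lam"
    by (rule eventually_mono) (use c levels in auto)
qed


end
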